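(* Let $G$ be a cubic graph with a perfect matching. Then there exists a mapping $f:E(G)\to E(S_{12})$ such that $$|V(f)|\ \geq\ \frac{4}{5}\cdot |V(G)|,$$ and for any $u\in \overline{V(f)}$ there are two distinct edges $e,e'\in\partial_G(u)$ such that $f(e)=f(e')$.
   Context: Graphs are finite and undirected, have no loops, but may have parallel edges (parallel edges are distinct elements of the edge set). A cubic graph is a $3$-regular such graph, not necessarily connected. $\partial_G(v)$ denotes the set of edges of $G$ incident to the vertex $v$. For cubic graphs $G,H$ and a mapping $f:E(G)\to E(H)$, define $$V(f)=\{v\in V(G):\ \exists\, x\in V(H)\text{ with } f(\partial_G(v))=\partial_H(x)\},\qquad \overline{V(f)}=V(G)\setminus V(f),$$ where $f(\partial_G(v))$ is the image set. The graph $S_{12}$: it has $12$ vertices $t_i,p_i,q_i,r_i$ for $i\in\{1,2,3\}$. Its $18$ edges are the three triangle edges $t_1t_2,\ t_2t_3,\ t_1t_3$ and, for each $i$, the edge $t_ip_i$, the edges $p_iq_i$ and $p_ir_i$, and two parallel edges joining $q_i$ and $r_i$. (Equivalently, it is obtained from the Sylvester graph $S_{10}$, the smallest cubic multigraph without a perfect matching, by replacing its unique vertex incident to three bridges with a triangle.) *)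

theory Defs
  imports Complex_Main
begin

text \<open>
  Finite loopless multigraphs. An edge is an abstract object with a two-element set of end
  vertices, so parallel edges are distinct edges with the same set of ends.
\<close>

record ('v, 'e) multigraph =
  verts :: "'v set"
  edges :: "'e set"
  ends :: "'e \<Rightarrow> 'v set"

definition is_graph :: "('v, 'e) multigraph \<Rightarrow> bool" where
  "is_graph G \<longleftrightarrow> finite (verts G) \<and> finite (edges G) \<and>
     (\<forall>e\<in>edges G. ends G e \<subseteq> verts G \<and> card (ends G e) = 2)"

definition incident_edges :: "('v, 'e) multigraph \<Rightarrow> 'v \<Rightarrow> 'e set" where
  "incident_edges G v = {e \<in> edges G. v \<in> ends G e}"

text \<open>There are no loops, so the degree of a vertex is the number of edges incident to it.\<close>

definition cubic :: "('v, 'e) multigraph \<Rightarrow> bool" where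
  "cubic G \<longleftrightarrow> is_graph G \<and> (\<forall>v\<in>verts G. card (incident_edges G v) = 3)"

definition perfect_matching :: "('v, 'e) multigraph \<Rightarrow> 'e set \<Rightarrow> bool" where
  "perfect_matching G M \<longleftrightarrow> M \<subseteq> edges G \<and> (\<forall>v\<in>verts G. \<exists>!e. e \<in> M \<and> v \<in> ends G e)"

definition good_verts ::
  "('v, 'e) multigraph \<Rightarrow> ('w, 'd) multigraph \<Rightarrow> ('e \<Rightarrow> 'd) \<Rightarrow> 'v set" where
  "good_verts G H f =
     {v \<in> verts G. \<exists>x\<in>verts H. f ` incident_edges G v = incident_edges H x}"

datatype idx = I1 | I2 | I3

datatype s12_vert = VT idx | VP idx | VQ idx | VR idx

text \<open>The edges \<open>QR i False\<close> and \<open>QR i True\<close> are the two parallel edges joining \<open>VQ i\<close> and \<open>VR i\<close>.\<close>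

datatype s12_edge = T12 | T23 | T13 | TP idx | PQ idx | PR idx | QR idx bool

fun s12_ends :: "s12_edge \<Rightarrow> s12_vert set" where
  "s12_ends T12 = {VT I1, VT I2}"
| "s12_ends T23 = {VT I2, VT I3}"
| "s12_ends T13 = {VT I1, VT I3}"
| "s12_ends (TP i) = {VT i, VP i}"
| "s12_ends (PQ i) = {VP i, VQ i}"
| "s12_ends (PR i) = {VP i, VR i}"
| "s12_ends (QR i b) = {VQ i, VR i}"

definition S12 :: "(s12_vert, s12_edge) multigraph" where
  "S12 = \<lparr>verts = UNIV, edges = UNIV, ends = s12_ends\<rparr>"

lemma UNIV_idx: "(UNIV :: idx set) = {I1, I2, I3}"
  by (auto intro: idx.exhaust)

lemma UNIV_s12_vert: "(UNIV :: s12_vert set) = range VT \<union> range VP \<union> range VQ \<union> range VR"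
proof -
  have "v \<in> range VT \<union> range VP \<union> range VQ \<union> range VR" for v :: s12_vert
    by (cases v) auto
  then show ?thesis by blast
qed

lemma UNIV_s12_edge:
  "(UNIV :: s12_edge set) =
     {T12, T23, T13} \<union> range TP \<union> range PQ \<union> range PR \<union> range (\<lambda>i. QR i False) \<union> range (\<lambda>i. QR i True)"
proof -
  have "e \<in> {T12, T23, T13} \<union> range TP \<union> range PQ \<union> range PR
          \<union> range (\<lambda>i. QR i False) \<union> range (\<lambda>i. QR i True)" for e :: s12_edge
  proof (cases e)
    case (QR i b)
    then show ?thesis by (cases b) auto
  qed auto
  then show ?thesis by blast
qed

lemma card_verts_S12: "card (verts S12) = 12"
  by (simp add: S12_def UNIV_s12_vert UNIV_idx)

lemma card_edges_S12: "card (edges S12) = 18"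
  by (simp add: S12_def UNIV_s12_edge UNIV_idx)

lemma incident_edges_S12:
  "incident_edges S12 (VT I1) = {T12, T13, TP I1}"
  "incident_edges S12 (VT I2) = {T12, T23, TP I2}"
  "incident_edges S12 (VT I3) = {T13, T23, TP I3}"
  "incident_edges S12 (VP i) = {TP i, PQ i, PR i}"
  "incident_edges S12 (VQ i) = {PQ i, QR i False, QR i True}"
  "incident_edges S12 (VR i) = {PR i, QR i False, QR i True}"
proof -
  have *: "incident_edges S12 v = {e \<in> UNIV. v \<in> s12_ends e}" for v
    by (simp add: incident_edges_def S12_def)
  show "incident_edges S12 (VT I1) = {T12, T13, TP I1}"
    "incident_edges S12 (VT I2) = {T12, T23, TP I2}"
    "incident_edges S12 (VT I3) = {T13, T23, TP I3}"
    "incident_edges S12 (VP i) = {TP i, PQ i, PR i}"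
    "incident_edges S12 (VQ i) = {PQ i, QR i False, QR i True}"
    "incident_edges S12 (VR i) = {PR i, QR i False, QR i True}"
    unfolding * UNIV_s12_edge by auto
qed

lemma cubic_S12: "cubic S12"
  unfolding cubic_def is_graph_def
proof (intro conjI ballI)
  show "finite (verts S12)" "finite (edges S12)"
    using card_verts_S12 card_edges_S12 by (auto intro: card_ge_0_finite)
next
  fix e
  show "ends S12 e \<subseteq> verts S12" "card (ends S12 e) = 2"
    by (simp_all add: S12_def) (cases e; simp)
next
  fix v
  show "card (incident_edges S12 v) = 3"
  proof (cases v)
    case (VT i)
    then show ?thesis by (cases i) (simp_all add: incident_edges_S12)
  qed (simp_all add: incident_edges_S12)
qed

end

theory Submission imports Defs begin

text \<open>
  All edges of the perfect matching's complement lie on cycles, so every bridge belongs to the perfect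
  matching and each vertex is on at most one bridge. Cutting all bridges leaves pieces with
  semi-edges, at most one per vertex, which shall all receive the colour \<open>TP\<close>. A piece with
  \<open>n\<close> vertices and \<open>b > 0\<close> semi-edges is coloured with at most
  \<open>(n + 3 * (b - 2)) / 5\<close> defects (at most \<open>n / 5\<close> if \<open>b = 0\<close>); as the pieces of a
  connected graph form a tree under the bridges, the sum of \<open>b - 2\<close> is negative and these bounds
  add up.

  In a piece, triangles are contracted first. A quasi-matching either uses the semi-edge of a vertex
  or its two other edges; Edmonds' theorem, applied to the constant point \<open>1/3\<close> after
  replacing every semi-edge by a digon, gives quasi-matchings of small weight. The complement of a
  quasi-matching is a union of cycles, coloured alternately \<open>PQ\<close> and \<open>PR\<close>, with
  one defect per odd cycle, hence one per five vertices. A vertex whose semi-edge is not used is one more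
  defect. A second quasi-matching repairs all cycles that it meets, which is needed to gain the last
  few units when \<open>b = 1\<close> or \<open>b = 3\<close>.
\<close>

section \<open>Cuts and alternating colourings\<close>

text \<open>The perfect matching of \<open>G\<close> serves to place the bridges; the odd cycles of
  its complement are not under control, so the matchings that produce the colouring are chosen anew
  in every piece. The proof is shaped by the independence of the pieces: they have to agree on the
  bridges, hence the fixed colour, and their bounds have to add up. Cutting one bridge creates two
  semi-edges, and therefore a bound \<open>n + c * (b - 2)\<close> for five times the number of
  defects is preserved under gluing for every \<open>c\<close>. The constant \<open>c = 3\<close> is
  the largest possible one: the end block of \<open>S12\<close>, a digon whose ends are joined to a
  vertex with a semi-edge, has \<open>n = 3\<close> and \<open>b = 1\<close>, which leaves
  \<open>3 - c\<close> for its defects. With this value, averaging over quasi-matchings is enough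
  for \<open>b = 2\<close> and \<open>b >= 4\<close>; it falls short by one unit for
  \<open>b = 3\<close> and by three for \<open>b = 1\<close>, and these two cases take most of the
  effort. Triangles must disappear first because a defective cycle on three vertices is too
  expensive.\<close>

definition edge_cut :: "('v, 'e) multigraph \<Rightarrow> 'v set \<Rightarrow> 'e set" where
  "edge_cut G A = {e \<in> edges G. ends G e \<inter> A \<noteq> {} \<and> ends G e - A \<noteq> {}}"

lemma finite_incident: "finite (edges G) \<Longrightarrow> finite (incident_edges G v)"
  by (simp add: incident_edges_def)

lemma finite_cut: "finite (edges G) \<Longrightarrow> finite (edge_cut G A)"
  by (simp add: edge_cut_def)

lemma sum_degrees:
  assumes "finite S" "finite W"
  shows "(\<Sum>u\<in>W. card {e\<in>S. u \<in> d e}) = (\<Sum>e\<in>S. card (d e \<inter> W))"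
proof -
  have "(\<Sum>u\<in>W. card {e\<in>S. u \<in> d e}) = (\<Sum>u\<in>W. \<Sum>e\<in>S. if u \<in> d e then 1 else 0)"
    using assms by (intro sum.cong) (auto simp: sum.If_cases Int_def)
  also have "\<dots> = (\<Sum>e\<in>S. \<Sum>u\<in>W. if u \<in> d e then 1 else 0)"
    by (rule sum.swap)
  also have "\<dots> = (\<Sum>e\<in>S. card (d e \<inter> W))"
    using assms by (intro sum.cong) (auto simp: sum.If_cases Int_def conj_commute)
  finally show ?thesis .
qed

text \<open>The intended \<open>K\<close> consists of the edges outside two quasi-matchings; only a
  vertex with two such edges needs both colours.\<close>

definition mono_at :: "('v, 'e) multigraph \<Rightarrow> ('e \<Rightarrow> bool) \<Rightarrow> 'v set" where
  "mono_at K c = {v \<in> verts K. card (incident_edges K v) = 2 \<and>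
     (\<exists>b. \<forall>e\<in>incident_edges K v. c e = b)}"

lemma card2_other:
  assumes "card A = 2" "a \<in> A"
  obtains b where "b \<noteq> a" "A = {a, b}"
  using assms by (metis card_2_iff doubleton_eq_iff insert_iff singletonD)

text \<open>Minimise the number of monochromatic vertices of degree 2. A monochromatic vertex can then be
  pushed along any edge, so its component is a cycle without further monochromatic vertices.\<close>

lemma alternating_coloring:
  assumes g: "is_graph K"
  shows "\<exists>c W. \<forall>v\<in>mono_at K c. v \<in> W v \<and> W v \<subseteq> verts K \<and> W v \<inter> mono_at K c = {v} \<and>
    (\<forall>u\<in>W v. card (incident_edges K u) = 2 \<and> (\<forall>e\<in>incident_edges K u. ends K e \<subseteq> W v)) \<and>
    (\<forall>u\<in>mono_at K c. u \<noteq> v \<longrightarrow> W v \<inter> W u = {})"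
proof -
  define c where "c = arg_min (\<lambda>c. card (mono_at K c)) (\<lambda>_. True)"
  have c_min: "card (mono_at K c) \<le> card (mono_at K c')" for c'
    unfolding c_def using arg_min_nat_le[of "\<lambda>_. True" c' "\<lambda>c. card (mono_at K c)"] by simp
  have fin: "finite (mono_at K c')" for c'
    using g by (auto simp: is_graph_def mono_at_def)
  define R where "R = {(u, u'). \<exists>e\<in>edges K. ends K e = {u, u'}}"
  define W where "W v = {u. (v, u) \<in> R\<^sup>*}" for v
  have push: "\<exists>c'. u \<in> mono_at K c' \<and> mono_at K c' \<subseteq> insert u (mono_at K c - {v})"
    if v: "v \<in> mono_at K c" and u: "(v, u) \<in> R\<^sup>*" for v u
    using u
  proof (induction rule: rtrancl_induct)
    case base
    then show ?case using v by blast
  next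
    case (step u y)
    then obtain c' where c': "u \<in> mono_at K c'" "mono_at K c' \<subseteq> insert u (mono_at K c - {v})"
      by blast
    obtain e where e: "e \<in> edges K" "ends K e = {u, y}" using step.hyps(2) by (auto simp: R_def)
    \<comment> \<open>The two edges at \<open>u\<close> agreed before, so flipping \<open>e\<close>
      frees \<open>u\<close>, and only the other end \<open>y\<close> can have become
      monochromatic.\<close>
    define c'' where "c'' = c'(e := \<not> c' e)"
    have eu: "e \<in> incident_edges K u" using e by (simp add: incident_edges_def)
    have other: "z \<in> mono_at K c'' \<longleftrightarrow> z \<in> mono_at K c'" if "z \<noteq> u" "z \<noteq> y" for z
    proof -
      have "\<forall>d\<in>incident_edges K z. c'' d = c' d"
        using that e by (auto simp: incident_edges_def c''_def)
      then show ?thesis by (simp add: mono_at_def cong: ball_cong)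
    qed
    have "u \<notin> mono_at K c''"
    proof
      assume "u \<in> mono_at K c''"
      then obtain b where "card (incident_edges K u) = 2" "\<forall>d\<in>incident_edges K u. c'' d = b"
        by (auto simp: mono_at_def)
      moreover obtain b' where "\<forall>d\<in>incident_edges K u. c' d = b'"
        using c'(1) by (auto simp: mono_at_def)
      moreover obtain d where "d \<in> incident_edges K u" "d \<noteq> e"
        using calculation(1) eu by (metis card2_other insertI1 insertI2)
      ultimately have "c'' e = c'' d" "c' e = c' d" "d \<noteq> e" using eu by auto
      then show False by (simp add: c''_def)
    qed
    then have "mono_at K c'' \<subseteq> insert y (mono_at K c' - {u})"
      using other by (intro subsetI) (metis DiffI insertCI singletonD)
    then have sub2: "mono_at K c'' \<subseteq> insert y (mono_at K c - {v})" using c' by blast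
    \<comment> \<open>Otherwise the conflict would vanish altogether, against minimality. In
      particular \<open>y\<close> has degree 2 again, so pushing never leaves the vertices of degree
      2.\<close>
    have "y \<in> mono_at K c''"
    proof (rule ccontr)
      assume "y \<notin> mono_at K c''"
      then have "mono_at K c'' \<subseteq> mono_at K c - {v}" using sub2 by blast
      then have "card (mono_at K c'') < card (mono_at K c)"
        using v fin[of c] by (metis card_Diff1_less card_mono finite_Diff le_less_trans)
      then show False using c_min[of c''] by simp
    qed
    then show ?case using sub2 by blast
  qed
  \<comment> \<open>Pushing the conflict from \<open>v\<close> onto a second conflict
    \<open>u\<close> would merge the two and undercut the minimum.\<close>
  have W_mono: "u = v" if v: "v \<in> mono_at K c" "u \<in> W v" "u \<in> mono_at K c" for u v
  proof (rule ccontr)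
    assume "u \<noteq> v"
    obtain c' where "mono_at K c' \<subseteq> insert u (mono_at K c - {v})"
      using push[of v u] v by (auto simp: W_def)
    then have "mono_at K c' \<subseteq> mono_at K c - {v}" using \<open>u \<noteq> v\<close> that by blast
    then have "card (mono_at K c') < card (mono_at K c)"
      using v fin[of c] by (metis card_Diff1_less card_mono finite_Diff le_less_trans)
    then show False using c_min[of c'] by simp
  qed
  have Rsym: "(a, b) \<in> R \<Longrightarrow> (b, a) \<in> R" for a b by (auto simp: R_def insert_commute)
  have "sym (R\<^sup>*)" using Rsym by (intro sym_rtrancl symI)
  then have Rs: "(a, b) \<in> R\<^sup>* \<Longrightarrow> (b, a) \<in> R\<^sup>*" for a b by (meson symD)
  have W_mem: "u \<in> mono_at K c' \<Longrightarrow> u \<in> verts K \<and> card (incident_edges K u) = 2" for c' u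
    by (auto simp: mono_at_def)
  have W_deg: "u \<in> verts K \<and> card (incident_edges K u) = 2"
    if v: "v \<in> mono_at K c" "u \<in> W v" for v u
  proof -
    obtain c' where "u \<in> mono_at K c'" using push[of v u] v by (auto simp: W_def)
    then show ?thesis by (rule W_mem)
  qed
  show ?thesis
  proof (intro exI[of _ c] exI[of _ W] ballI conjI impI)
    fix v assume v: "v \<in> mono_at K c"
    show vW: "v \<in> W v" by (simp add: W_def)
    show "W v \<subseteq> verts K" using W_deg[OF v] by blast
    show "W v \<inter> mono_at K c = {v}" using W_mono v vW by blast
    show "card (incident_edges K u) = 2" if "u \<in> W v" for u using W_deg v that by blast
    show "ends K e \<subseteq> W v" if u: "u \<in> W v" and e: "e \<in> incident_edges K u" for u e
    proof -
      have eE: "e \<in> edges K" and ue: "u \<in> ends K e" using e by (auto simp: incident_edges_def)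
      have "card (ends K e) = 2" using g eE by (auto simp: is_graph_def)
      then obtain y where y: "ends K e = {u, y}" using ue by (metis card2_other)
      then have "(u, y) \<in> R" using eE by (auto simp: R_def)
      then have "y \<in> W v" using u by (auto simp: W_def)
      then show ?thesis using y u by auto
    qed
    show "W v \<inter> W u = {}" if u: "u \<in> mono_at K c" "u \<noteq> v" for u
    proof (rule ccontr)
      assume "W v \<inter> W u \<noteq> {}"
      then obtain z where "(v, z) \<in> R\<^sup>*" "(u, z) \<in> R\<^sup>*" by (auto simp: W_def)
      then have "(v, u) \<in> R\<^sup>*" using Rs rtrancl_trans by metis
      then show False using W_mono u v by (auto simp: W_def)
    qed
  qed
qed

text \<open>Handshake on the edges of one colour inside \<open>W\<close>: every vertex but
  \<open>v\<close> carries exactly one of them and \<open>v\<close> carries none or two, so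
  \<open>card W - 1\<close> is even.\<close>

lemma alternating_component_odd:
  assumes g: "is_graph K" and W: "W \<subseteq> verts K" "W \<inter> mono_at K c = {v}"
    and deg: "\<And>u. u \<in> W \<Longrightarrow> card (incident_edges K u) = 2"
    and cl: "\<And>u e. u \<in> W \<Longrightarrow> e \<in> incident_edges K u \<Longrightarrow> ends K e \<subseteq> W"
  shows "odd (card W)"
proof -
  have finW: "finite W" using W g by (auto simp: is_graph_def intro: finite_subset)
  have finE: "finite (edges K)" using g by (auto simp: is_graph_def)
  have v: "v \<in> W" using W by auto
  define S where "S = {e \<in> edges K. c e \<and> ends K e \<subseteq> W}"
  have finS: "finite S" using finE by (simp add: S_def)
  have Su: "{e\<in>S. u \<in> ends K e} = {e\<in>incident_edges K u. c e}" if "u \<in> W" for u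
    using cl[OF that] by (auto simp: S_def incident_edges_def)
  have one: "card {e\<in>S. u \<in> ends K e} = 1" if "u \<in> W - {v}" for u
  proof -
    have "card (incident_edges K u) = 2" using deg that by blast
    then obtain d d' where d: "incident_edges K u = {d, d'}" "d \<noteq> d'"
      by (meson card_2_iff)
    have "u \<notin> mono_at K c" using that W by auto
    then have "c d \<noteq> c d'" using d deg[of u] that W by (auto simp: mono_at_def)
    then have "{e\<in>incident_edges K u. c e} = {if c d then d else d'}" using d by auto
    then show ?thesis using Su that by simp
  qed
  have ev: "even (card {e\<in>S. v \<in> ends K e})"
  proof -
    have "v \<in> mono_at K c" using W by auto
    then obtain b where b: "\<forall>e\<in>incident_edges K v. c e = b" by (auto simp: mono_at_def)
    have "{e\<in>S. v \<in> ends K e} = (if b then incident_edges K v else {})"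
      unfolding Su[OF v] using b by auto
    then show ?thesis using deg[OF v] by simp
  qed
  have "card (ends K e \<inter> W) = 2" if "e \<in> S" for e
    using that g by (auto simp: S_def is_graph_def Int_absorb2)
  then have "2 * card S = (\<Sum>e\<in>S. card (ends K e \<inter> W))" by simp
  also have "\<dots> = (\<Sum>u\<in>W. card {e\<in>S. u \<in> ends K e})"
    by (rule sum_degrees[symmetric]) (use finS finW in auto)
  also have "\<dots> = card {e\<in>S. v \<in> ends K e} + card (W - {v})"
    using one by (simp add: sum.remove[OF finW v])
  finally have "even (card {e\<in>S. v \<in> ends K e} + card (W - {v}))" by (metis dvd_triv_left)
  then have "even (card (W - {v}))" using ev by simp
  then show ?thesis using v finW by (metis card.remove even_Suc)
qed

definition has_triangle :: "('v, 'e) multigraph \<Rightarrow> bool" where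
  "has_triangle K \<longleftrightarrow> (\<exists>a b d e1 e2 e3. card {a, b, d} = 3 \<and> {e1, e2, e3} \<subseteq> edges K \<and>
    ends K e1 = {a, b} \<and> ends K e2 = {b, d} \<and> ends K e3 = {a, d})"

text \<open>By parity only the sizes 1 and 3 are in question. The two neighbours of \<open>v\<close>
  differ, since the second end of a digon at \<open>v\<close> would be monochromatic as well; with
  size 3 the remaining edge closes a triangle.\<close>

lemma alternating_component_size:
  assumes g: "is_graph K" and W: "W \<subseteq> verts K" "W \<inter> mono_at K c = {v}"
    and deg: "\<And>u. u \<in> W \<Longrightarrow> card (incident_edges K u) = 2"
    and cl: "\<And>u e. u \<in> W \<Longrightarrow> e \<in> incident_edges K u \<Longrightarrow> ends K e \<subseteq> W"
  shows "card W \<ge> 5 \<or> card W = 3 \<and> has_triangle K"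
proof -
  have finW: "finite W" using W g by (auto simp: is_graph_def intro: finite_subset)
  have odd: "odd (card W)" by (rule alternating_component_odd[OF assms])
  have v: "v \<in> W" "v \<in> mono_at K c" using W by auto
  have other: "\<exists>y. y \<noteq> u \<and> y \<in> W \<and> ends K e = {u, y}" if "u \<in> W" "e \<in> incident_edges K u" for u e
  proof -
    have "card (ends K e) = 2" "u \<in> ends K e" using that g by (auto simp: is_graph_def incident_edges_def)
    then show ?thesis using cl[OF that] by (metis card2_other insert_subset)
  qed
  obtain e1 e2 where e12: "incident_edges K v = {e1, e2}" "e1 \<noteq> e2"
    using deg[OF v(1)] by (auto simp: card_2_iff)
  obtain a where a: "a \<noteq> v" "a \<in> W" "ends K e1 = {v, a}" using other[OF v(1), of e1] e12 by auto
  obtain d where d: "d \<noteq> v" "d \<in> W" "ends K e2 = {v, d}" using other[OF v(1), of e2] e12 by auto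
  have e1K: "e1 \<in> edges K" and e2K: "e2 \<in> edges K" using e12 by (auto simp: incident_edges_def)
  have ad: "a \<noteq> d"
  proof
    assume "a = d"
    then have "{e1, e2} \<subseteq> incident_edges K a" using a d e1K e2K by (auto simp: incident_edges_def)
    then have "incident_edges K a = {e1, e2}"
      using deg[OF a(2)] e12 by (metis card_2_iff card_seteq finite_incident g is_graph_def order_refl)
    then have "a \<in> mono_at K c" using v(2) e12 a W deg[OF a(2)] by (auto simp: mono_at_def)
    then show False using a W by auto
  qed
  have c3: "card {v, a, d} = 3" using a d ad by auto
  have sub: "{v, a, d} \<subseteq> W" using v a d by auto
  then have ge3: "card W \<ge> 3" using card_mono[OF finW sub] c3 by simp
  show ?thesis
  proof (cases "card W = 3")
    case True
    then have Weq: "W = {v, a, d}" using card_seteq[OF finW sub] c3 by simp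
    have "e1 \<in> incident_edges K a" using a e1K by (auto simp: incident_edges_def)
    then obtain e3 where e3: "e3 \<noteq> e1" "incident_edges K a = {e1, e3}"
      using deg[OF a(2)] card2_other by metis
    obtain y where y: "y \<noteq> a" "y \<in> W" "ends K e3 = {a, y}" using other[OF a(2), of e3] e3 by auto
    have e3K: "e3 \<in> edges K" using e3 by (auto simp: incident_edges_def)
    have "y \<noteq> v"
    proof
      assume "y = v"
      then have "e3 \<in> incident_edges K v" using y e3K by (auto simp: incident_edges_def)
      then have "e3 = e2" using e12 e3 by auto
      then show False using y d ad \<open>y = v\<close> by (auto simp: doubleton_eq_iff)
    qed
    then have "y = d" using y Weq by auto
    then have "card {v, a, d} = 3 \<and> {e1, e3, e2} \<subseteq> edges K \<and>
      ends K e1 = {v, a} \<and> ends K e3 = {a, d} \<and> ends K e2 = {v, d}"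
      using c3 e1K e2K e3K a d y by auto
    then have "has_triangle K" unfolding has_triangle_def by (intro exI)
    then show ?thesis using True by simp
  next
    case False
    then have "card W \<noteq> 4" "card W \<ge> 4" using odd ge3 by auto
    then show ?thesis by linarith
  qed
qed

section \<open>The perfect matching polytope\<close>

text \<open>Elimination: an equation with a non-zero coefficient at \<open>e0\<close> is solved for
  that unknown and substituted into the others, which leaves one equation and one unknown
  less.\<close>

lemma homogeneous_system_nontrivial:
  fixes A :: "'v \<Rightarrow> 'e \<Rightarrow> real"
  assumes "finite V" "finite E" "card V < card E"
  shows "\<exists>y. (\<exists>e\<in>E. y e \<noteq> 0) \<and> (\<forall>v\<in>V. (\<Sum>e\<in>E. A v e * y e) = 0)"
  using assms
proof (induction V arbitrary: E A rule: finite_induct)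
  case empty
  then have "E \<noteq> {}" by auto
  then show ?case by (intro exI[of _ "\<lambda>_. 1"]) auto
next
  case (insert v V)
  show ?case
  proof (cases "\<forall>e\<in>E. A v e = 0")
    case True
    have "card V < card E" using insert by simp
    then obtain y where "\<exists>e\<in>E. y e \<noteq> 0" "\<forall>u\<in>V. (\<Sum>e\<in>E. A u e * y e) = 0"
      using insert.IH[of E A] insert.prems by auto
    then show ?thesis using True by (intro exI[of _ y]) auto
  next
    case False
    then obtain e0 where e0: "e0 \<in> E" "A v e0 \<noteq> 0" by auto
    define E' where "E' = E - {e0}"
    have E': "finite E'" "e0 \<notin> E'" "E = insert e0 E'" "card V < card E'"
      using insert e0 by (auto simp: E'_def)
    obtain y where y: "\<exists>e\<in>E'. y e \<noteq> 0"
      "\<forall>u\<in>V. (\<Sum>e\<in>E'. (A u e - A u e0 * A v e / A v e0) * y e) = 0"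
      using insert.IH[OF E'(1,4), of "\<lambda>u e. A u e - A u e0 * A v e / A v e0"] by blast
    define z where "z = y(e0 := - (\<Sum>e\<in>E'. A v e * y e) / A v e0)"
    have z: "(\<Sum>e\<in>E. A u e * z e) = (\<Sum>e\<in>E'. A u e * y e) - A u e0 * ((\<Sum>e\<in>E'. A v e * y e) / A v e0)" for u
    proof -
      have "(\<Sum>e\<in>E'. A u e * z e) = (\<Sum>e\<in>E'. A u e * y e)"
        using E' by (intro sum.cong) (auto simp: z_def)
      then show ?thesis using E' by (simp add: z_def)
    qed
    have "(\<Sum>e\<in>E. A u e * z e) = 0" if "u \<in> V" for u
    proof -
      have "(\<Sum>e\<in>E'. (A u e - A u e0 * A v e / A v e0) * y e) =
        (\<Sum>e\<in>E'. A u e * y e) - A u e0 * ((\<Sum>e\<in>E'. A v e * y e) / A v e0)"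
        by (simp add: left_diff_distrib sum_subtractf sum_divide_distrib sum_distrib_left mult.assoc)
      then show ?thesis using y that z by simp
    qed
    moreover have "(\<Sum>e\<in>E. A v e * z e) = 0" using z[of v] e0 by simp
    moreover have "\<exists>e\<in>E. z e \<noteq> 0" using y(1) E' by (auto simp: z_def)
    ultimately show ?thesis by (intro exI[of _ z]) auto
  qed
qed

text \<open>The ratio test: a pair \<open>(a, b)\<close> stands for the constraint
  \<open>a + t * b >= 0\<close> with positive slack at \<open>t = 0\<close>, and the least quotient
  \<open>a / (- b)\<close> over the negative slopes is the first moment at which some constraint
  becomes tight.\<close>

lemma affine_first_hit:
  fixes S :: "(real \<times> real) set"
  assumes "finite S" "\<And>p. p \<in> S \<Longrightarrow> fst p > 0" "\<exists>a b. (a, b) \<in> S \<and> b < 0"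
  obtains t where "t > 0" "\<And>a b. (a, b) \<in> S \<Longrightarrow> a + t * b \<ge> 0" "\<exists>a b. (a, b) \<in> S \<and> a + t * b = 0"
proof -
  define Q where "Q = (\<lambda>(a, b). a / (- b)) ` {(a, b) \<in> S. b < 0}"
  have Q: "finite Q" "Q \<noteq> {}" using assms(1,3) by (auto simp: Q_def intro!: finite_imageI finite_subset[OF _ assms(1)])
  define t where "t = Min Q"
  have "t \<in> Q" unfolding t_def by (rule Min_in[OF Q])
  then obtain a b where ab: "(a, b) \<in> S" "b < 0" "t = a / (- b)" by (auto simp: Q_def)
  show thesis
  proof (rule that[of t])
    show "t > 0" using ab assms(2)[OF ab(1)] by (simp add: divide_pos_neg)
    show "\<exists>a b. (a, b) \<in> S \<and> a + t * b = 0" using ab by (intro exI[of _ a] exI[of _ b]) auto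
    fix c d assume cd: "(c, d) \<in> S"
    show "c + t * d \<ge> 0"
    proof (cases "d < 0")
      case True
      then have "t \<le> c / (- d)" unfolding t_def using cd Q by (intro Min_le) (force simp: Q_def)+
      then have "t * (- d) \<le> c / (- d) * (- d)" using True by (intro mult_right_mono) auto
      then show ?thesis using True by simp
    next
      case False
      then show ?thesis using \<open>t > 0\<close> assms(2)[OF cd] by (simp add: add_nonneg_nonneg)
    qed
  qed
qed

text \<open>These are Edmonds' inequalities. For \<open>U = verts G\<close> the cut of a graph is
  empty, so the last of them also forces an even number of vertices.\<close>

definition fractional_matching :: "('v, 'e) multigraph \<Rightarrow> ('e \<Rightarrow> real) \<Rightarrow> bool" where
  "fractional_matching G x \<longleftrightarrow> (\<forall>e\<in>edges G. 0 \<le> x e) \<and>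
     (\<forall>v\<in>verts G. sum x (incident_edges G v) = 1) \<and>
     (\<forall>U\<subseteq>verts G. odd (card U) \<longrightarrow> 1 \<le> sum x (edge_cut G U))"

text \<open>By separation this says that \<open>x\<close>, on the edges of a finite graph, lies in
  the convex hull of the perfect matchings. The dual form suits the induction better: it asks for
  one matching per weight instead of a convex combination.\<close>

definition light_matching :: "('v, 'e) multigraph \<Rightarrow> ('e \<Rightarrow> real) \<Rightarrow> bool" where
  "light_matching G x \<longleftrightarrow>
     (\<forall>w. \<exists>M. perfect_matching G M \<and> sum w M \<le> (\<Sum>e\<in>edges G. w e * x e))"


section \<open>Edges of value 0 or 1\<close>

lemma fractional_le_1:
  assumes g: "is_graph G" and x: "fractional_matching G x" and e: "e \<in> edges G"
  shows "x e \<le> 1"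
proof -
  have "card (ends G e) = 2" "ends G e \<subseteq> verts G" using g e by (auto simp: is_graph_def)
  then obtain v where v: "v \<in> ends G e" "v \<in> verts G" by (metis card_2_iff' subsetD)
  have "x e \<le> sum x (incident_edges G v)"
    using g x e v by (intro member_le_sum) (auto simp: is_graph_def incident_edges_def fractional_matching_def)
  then show ?thesis using x v by (auto simp: fractional_matching_def)
qed

lemma light_matching_delete_edge:
  assumes g: "is_graph G" and x: "fractional_matching G x" and e: "e0 \<in> edges G" "x e0 = 0"
  defines "H \<equiv> G\<lparr>edges := edges G - {e0}\<rparr>"
  shows "is_graph H" "fractional_matching H x" "light_matching H x \<Longrightarrow> light_matching G x"
proof -
  have fin: "finite (edges G)" using g by (auto simp: is_graph_def)
  have drop: "sum h (S - {e0}) = sum h S" if "S \<subseteq> edges G" "h e0 = 0" for S and h :: "'b \<Rightarrow> real"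
    using that fin by (intro sum.mono_neutral_left) (auto intro: finite_subset)
  have inc: "incident_edges H v = incident_edges G v - {e0}" for v
    by (auto simp: H_def incident_edges_def)
  have ct: "edge_cut H U = edge_cut G U - {e0}" for U by (auto simp: H_def edge_cut_def)
  show "is_graph H" using g by (auto simp: is_graph_def H_def)
  show "fractional_matching H x"
    unfolding fractional_matching_def inc ct
    using x e(2) drop[of "incident_edges G v" x for v] drop[of "edge_cut G U" x for U]
    by (auto simp: fractional_matching_def H_def incident_edges_def edge_cut_def)
  assume H: "light_matching H x"
  show "light_matching G x"
    unfolding light_matching_def
  proof
    fix w
    obtain M where "perfect_matching H M" "sum w M \<le> (\<Sum>e\<in>edges H. w e * x e)"
      using H by (auto simp: light_matching_def)
    moreover have "(\<Sum>e\<in>edges H. w e * x e) = (\<Sum>e\<in>edges G. w e * x e)"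
      using drop[of "edges G" "\<lambda>e. w e * x e"] e by (simp add: H_def)
    ultimately show "\<exists>M. perfect_matching G M \<and> sum w M \<le> (\<Sum>e\<in>edges G. w e * x e)"
      by (auto simp: perfect_matching_def H_def)
  qed
qed

text \<open>The degree equations at the two ends of \<open>e0\<close> leave value 0 for every other
  edge there, which positivity excludes. So \<open>e0\<close> with its ends is a component of its
  own and can be put back into any matching of the rest.\<close>

lemma light_matching_delete_saturated:
  assumes g: "is_graph G" and x: "fractional_matching G x" and pos: "\<And>e. e \<in> edges G \<Longrightarrow> 0 < x e"
    and e: "e0 \<in> edges G" "x e0 = 1"
  defines "H \<equiv> G\<lparr>verts := verts G - ends G e0, edges := edges G - {e0}\<rparr>"
  shows "is_graph H" "fractional_matching H x" "light_matching H x \<Longrightarrow> light_matching G x"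
proof -
  have fin: "finite (edges G)" using g by (auto simp: is_graph_def)
  have only: "incident_edges G v = {e0}" if v: "v \<in> ends G e0" for v
  proof (rule ccontr)
    have vV: "v \<in> verts G" and e0v: "e0 \<in> incident_edges G v"
      using v g e by (auto simp: is_graph_def incident_edges_def)
    assume "incident_edges G v \<noteq> {e0}"
    then obtain d where d: "d \<in> incident_edges G v" "d \<noteq> e0" using e0v by auto
    have "sum x {e0, d} \<le> sum x (incident_edges G v)"
      using d e0v fin x by (intro sum_mono2) (auto simp: incident_edges_def fractional_matching_def)
    moreover have "x d > 0" using d pos by (auto simp: incident_edges_def)
    moreover have "sum x (incident_edges G v) = 1" using x vV by (auto simp: fractional_matching_def)
    ultimately show False using d e by simp
  qed
  have disj: "ends G d \<inter> ends G e0 = {}" if "d \<in> edges G" "d \<noteq> e0" for d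
    using only that by (auto simp: incident_edges_def)
  have inc: "incident_edges H v = incident_edges G v" if "v \<in> verts H" for v
    using that by (auto simp: H_def incident_edges_def)
  have ct: "edge_cut H U = edge_cut G U" if "U \<subseteq> verts H" for U
    using that by (auto simp: H_def edge_cut_def)
  show "is_graph H" using g disj by (auto simp: is_graph_def H_def)
  have sub: "verts H \<subseteq> verts G" by (auto simp: H_def)
  show "fractional_matching H x"
    unfolding fractional_matching_def
  proof (intro conjI ballI allI impI)
    show "0 \<le> x e" if "e \<in> edges H" for e
      using that x by (auto simp: H_def fractional_matching_def)
    show "sum x (incident_edges H v) = 1" if "v \<in> verts H" for v
      using that x sub inc[OF that] by (auto simp: fractional_matching_def)
    show "1 \<le> sum x (edge_cut H U)" if "U \<subseteq> verts H" "odd (card U)" for U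
      using that x sub ct[OF that(1)] by (auto simp: fractional_matching_def)
  qed
  assume H: "light_matching H x"
  show "light_matching G x"
    unfolding light_matching_def
  proof
    fix w
    obtain M where M: "perfect_matching H M" "sum w M \<le> (\<Sum>e\<in>edges H. w e * x e)"
      using H by (auto simp: light_matching_def)
    have ME: "M \<subseteq> edges G - {e0}" using M by (auto simp: perfect_matching_def H_def)
    have "\<exists>!e. e \<in> insert e0 M \<and> v \<in> ends G e" if v: "v \<in> verts G" for v
    proof (cases "v \<in> ends G e0")
      case True
      then show ?thesis using only[OF True] ME by (intro ex1I[of _ e0]) (auto simp: incident_edges_def)
    next
      case False
      then have "v \<in> verts H" using v by (simp add: H_def)
      then have "\<exists>!e. e \<in> M \<and> v \<in> ends G e" using M(1) by (auto simp: perfect_matching_def H_def)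
      then show ?thesis using False by auto
    qed
    then have "perfect_matching G (insert e0 M)" using ME e by (auto simp: perfect_matching_def)
    moreover have "sum w (insert e0 M) = w e0 + sum w M"
      using ME fin by (subst sum.insert) (auto intro: finite_subset)
    moreover have "(\<Sum>e\<in>edges G. w e * x e) = w e0 * x e0 + (\<Sum>e\<in>edges H. w e * x e)"
      using fin e by (simp add: H_def sum.remove)
    ultimately show "\<exists>M. perfect_matching G M \<and> sum w M \<le> (\<Sum>e\<in>edges G. w e * x e)"
      using M(2) e(2) by (intro exI[of _ "insert e0 M"]) simp
  qed
qed

text \<open>A vertex \<open>r\<close> from outside \<open>A\<close> stands for the contracted
  complement, so the vertex type stays the same. Edges keep their names, so the same
  \<open>x\<close> and \<open>w\<close> serve for \<open>G\<close> and for both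
  contractions.\<close>

definition contract_compl :: "('v, 'e) multigraph \<Rightarrow> 'v set \<Rightarrow> 'v \<Rightarrow> ('v, 'e) multigraph" where
  "contract_compl G A r = \<lparr>verts = insert r A, edges = {e \<in> edges G. ends G e \<inter> A \<noteq> {}},
     ends = \<lambda>e. (\<lambda>v. if v \<in> A then v else r) ` ends G e\<rparr>"

section \<open>Cuts of a contraction, and gluing of the two contractions along an odd cut\<close>

context
  fixes G :: "('v, 'e) multigraph" and A r
  assumes g: "is_graph G" and A: "A \<subseteq> verts G" and r: "r \<in> verts G - A"
begin

lemma ends_contract_compl:
  "v \<in> A \<Longrightarrow> v \<in> ends (contract_compl G A r) e \<longleftrightarrow> v \<in> ends G e"
  "r \<in> ends (contract_compl G A r) e \<longleftrightarrow> ends G e - A \<noteq> {}"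
  using r by (auto simp: contract_compl_def image_iff)

lemma is_graph_contract_compl: "is_graph (contract_compl G A r)"
proof -
  have "card (ends (contract_compl G A r) e) = 2" if e: "e \<in> edges G" "ends G e \<inter> A \<noteq> {}" for e
  proof -
    have "card (ends G e) = 2" using g e by (auto simp: is_graph_def)
    moreover obtain u where u: "u \<in> ends G e" "u \<in> A" using e by auto
    ultimately obtain v where "v \<noteq> u" "ends G e = {u, v}" by (metis card2_other)
    then show ?thesis using r u by (cases "v \<in> A") (auto simp: contract_compl_def)
  qed
  then show ?thesis
    using g A finite_subset[OF A] by (auto simp: is_graph_def contract_compl_def)
qed

lemma incident_contract_compl:
  "v \<in> A \<Longrightarrow> incident_edges (contract_compl G A r) v = incident_edges G v"
  "incident_edges (contract_compl G A r) r = edge_cut G A"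
  using ends_contract_compl
  by (auto simp: incident_edges_def edge_cut_def contract_compl_def)

lemma cut_contract_compl:
  assumes "W \<subseteq> A"
  shows "edge_cut (contract_compl G A r) W = edge_cut G W"
    and "edge_cut (contract_compl G A r) (insert r W) = edge_cut G (W \<union> (verts G - A))"
proof -
  have V: "ends G e \<subseteq> verts G" if "e \<in> edges G" for e using g that by (auto simp: is_graph_def)
  have 1: "ends (contract_compl G A r) e \<inter> W \<noteq> {} \<longleftrightarrow> ends G e \<inter> W \<noteq> {}" for e
    using assms r by (auto simp: contract_compl_def image_iff)
  have 2: "ends (contract_compl G A r) e - W \<noteq> {} \<longleftrightarrow> ends G e - W \<noteq> {}" for e
    using assms r by (auto simp: contract_compl_def image_iff)
  have 3: "ends (contract_compl G A r) e \<inter> insert r W \<noteq> {} \<longleftrightarrow> ends G e \<inter> (W \<union> (verts G - A)) \<noteq> {}"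
    if "e \<in> edges G" for e
    using assms r V[OF that] by (auto simp: contract_compl_def image_iff)
  have 4: "ends (contract_compl G A r) e - insert r W \<noteq> {} \<longleftrightarrow> ends G e - (W \<union> (verts G - A)) \<noteq> {}"
    if "e \<in> edges G" for e
    using assms r V[OF that] by (auto simp: contract_compl_def image_iff)
  show "edge_cut (contract_compl G A r) W = edge_cut G W"
    unfolding edge_cut_def 1 2 using assms by (auto simp: contract_compl_def)
  have 5: "ends G e \<inter> A \<noteq> {}"
    if "e \<in> edges G" "ends G e - (W \<union> (verts G - A)) \<noteq> {}" for e
    using that V[OF that(1)] by auto
  have E: "edges (contract_compl G A r) = {e \<in> edges G. ends G e \<inter> A \<noteq> {}}"
    by (simp add: contract_compl_def)
  have "e \<in> edge_cut (contract_compl G A r) (insert r W) \<longleftrightarrow> e \<in> edge_cut G (W \<union> (verts G - A))" for e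
    unfolding edge_cut_def mem_Collect_eq E
    by (cases "e \<in> edges G") (simp_all only: 3 4 5 simp_thms, use 5[of e] in blast)
  then show "edge_cut (contract_compl G A r) (insert r W) = edge_cut G (W \<union> (verts G - A))" by blast
qed

text \<open>An odd set through \<open>r\<close> becomes an odd set of \<open>G\<close> once
  \<open>r\<close> is replaced by the odd complement of \<open>A\<close>; the degree equation at
  \<open>r\<close> is the tightness of the cut.\<close>

lemma fractional_contract_compl:
  assumes x: "fractional_matching G x" and odd: "odd (card (verts G - A))"
    and tight: "sum x (edge_cut G A) = 1"
  shows "fractional_matching (contract_compl G A r) x"
  unfolding fractional_matching_def
proof (intro conjI ballI allI impI)
  show "0 \<le> x e" if "e \<in> edges (contract_compl G A r)" for e
    using that x by (auto simp: contract_compl_def fractional_matching_def)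
  show "sum x (incident_edges (contract_compl G A r) v) = 1"
    if "v \<in> verts (contract_compl G A r)" for v
  proof (cases "v \<in> A")
    case True
    then show ?thesis using x A incident_contract_compl(1)[OF True] by (auto simp: fractional_matching_def)
  next
    case False
    then have "v = r" using that by (simp add: contract_compl_def)
    then show ?thesis using tight incident_contract_compl(2) by simp
  qed
  fix U assume U: "U \<subseteq> verts (contract_compl G A r)" "odd (card U)"
  have fV: "finite (verts G)" using g by (auto simp: is_graph_def)
  show "1 \<le> sum x (edge_cut (contract_compl G A r) U)"
  proof (cases "r \<in> U")
    case False
    then have "U \<subseteq> A" using U by (auto simp: contract_compl_def)
    then show ?thesis using x A U by (auto simp: cut_contract_compl fractional_matching_def)
  next
    case True
    define W where "W = U - {r}"
    have W: "W \<subseteq> A" "U = insert r W" "r \<notin> W" using U True by (auto simp: contract_compl_def W_def)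
    have fW: "finite W" using finite_subset[OF W(1)] finite_subset[OF A fV] by simp
    have "even (card W)" using U W fW by simp
    moreover have "card (W \<union> (verts G - A)) = card W + card (verts G - A)"
      using W fW fV by (intro card_Un_disjoint) auto
    ultimately have "odd (card (W \<union> (verts G - A)))" using odd by simp
    moreover have "W \<union> (verts G - A) \<subseteq> verts G" using W A by auto
    ultimately have "1 \<le> sum x (edge_cut G (W \<union> (verts G - A)))"
      using x unfolding fractional_matching_def by blast
    then show ?thesis using W by (simp add: cut_contract_compl)
  qed
qed

end


text \<open>The cut is the star of the contracted vertex in both contractions, so a perfect matching
  of either one uses exactly one cut edge, and two of them fit together when these edges agree. For
  a given \<open>w\<close> the agreement is arranged through the weights, without decomposing
  \<open>x\<close>.\<close>

lemma light_matching_glue: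
  fixes G :: "('v, 'e) multigraph"
  assumes g: "is_graph G" and x: "fractional_matching G x"
    and A: "A \<subseteq> verts G" and r1: "r1 \<in> verts G - A" and r2: "r2 \<in> A"
    and L1: "light_matching (contract_compl G A r1) x"
    and L2: "light_matching (contract_compl G (verts G - A) r2) x"
  shows "light_matching G x"
  unfolding light_matching_def
proof
  fix w :: "'e \<Rightarrow> real"
  define B where "B = verts G - A"
  define G1 where "G1 = contract_compl G A r1"
  define G2 where "G2 = contract_compl G B r2"
  have B: "B \<subseteq> verts G" "r2 \<in> verts G - B" "verts G = A \<union> B" "A \<inter> B = {}"
    using A r2 by (auto simp: B_def)
  have V: "ends G e \<subseteq> A \<union> B" "ends G e \<noteq> {}" if "e \<in> edges G" for e
    using g that B by (auto simp: is_graph_def)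
  have fin: "finite (edges G)" using g by (auto simp: is_graph_def)
  define D where "D = edge_cut G A"
  have D2: "edge_cut G B = D" unfolding D_def edge_cut_def using V B(4) by blast
  have E1: "edges G1 = {e \<in> edges G. ends G e \<inter> A \<noteq> {}}" by (simp add: G1_def contract_compl_def)
  have E2: "edges G2 = {e \<in> edges G. ends G e \<inter> B \<noteq> {}}" by (simp add: G2_def contract_compl_def)
  have EU: "edges G = edges G1 \<union> edges G2" unfolding E1 E2 using V by blast
  have EI: "edges G1 \<inter> edges G2 = D" unfolding E1 E2 D_def edge_cut_def using V B(4) by blast
  have ends1: "v \<in> A \<Longrightarrow> v \<in> ends G1 e \<longleftrightarrow> v \<in> ends G e" for v e
    unfolding G1_def by (rule ends_contract_compl(1)[OF g A r1])
  have ends2: "v \<in> B \<Longrightarrow> v \<in> ends G2 e \<longleftrightarrow> v \<in> ends G e" for v e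
    unfolding G2_def by (rule ends_contract_compl(1)[OF g B(1,2)])
  have cross1: "\<exists>!e. e \<in> M \<inter> D" if M: "perfect_matching G1 M" for M
  proof -
    have "\<exists>!e. e \<in> M \<and> r1 \<in> ends G1 e" "M \<subseteq> edges G1"
      using M by (auto simp: perfect_matching_def G1_def contract_compl_def)
    moreover have "e \<in> D \<longleftrightarrow> r1 \<in> ends G1 e" if "e \<in> M" for e
      using that calculation(2) ends_contract_compl(2)[OF g A r1]
      unfolding D_def edge_cut_def G1_def by (auto simp: contract_compl_def)
    ultimately show ?thesis by (metis Int_iff)
  qed
  have cross2: "\<exists>!e. e \<in> M \<inter> D" if M: "perfect_matching G2 M" for M
  proof -
    have "\<exists>!e. e \<in> M \<and> r2 \<in> ends G2 e" "M \<subseteq> edges G2"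
      using M by (auto simp: perfect_matching_def G2_def contract_compl_def)
    moreover have "e \<in> D \<longleftrightarrow> r2 \<in> ends G2 e" if "e \<in> M" for e
      using that calculation(2) ends_contract_compl(2)[OF g B(1,2)]
      unfolding D2[symmetric] edge_cut_def G2_def by (auto simp: contract_compl_def)
    ultimately show ?thesis by (metis Int_iff)
  qed
  define PM where "PM e = {M. perfect_matching G1 M \<and> e \<in> M}" for e
  have finPM: "finite (PM e)" for e
    using fin by (intro finite_subset[of "PM e" "Pow (edges G)"]) (auto simp: PM_def perfect_matching_def E1)
  \<comment> \<open>So large that, even after cancellation with the remaining edges, more than the
    sum of all absolute weights is left, which already bounds the target value. A matching within
    the target thus contains no cut edge that the first side is unable to complete.\<close>
  define Big where "Big = 2 * (\<Sum>e\<in>edges G. \<bar>w e\<bar>) + 1"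
  \<comment> \<open>The value of a cut edge in the second contraction is the cheapest way to complete it in the first.\<close>
  define val where "val e = (if PM e = {} then Big else Min (sum w ` PM e))" for e
  have val_le: "val e \<le> sum w M" if "M \<in> PM e" for M e
    using that finPM by (auto simp: val_def)
  have split_sum: "sum h M = h e + sum h (M - {e})" if "finite M" "e \<in> M" for h :: "'e \<Rightarrow> real" and M e
    using that by (simp add: sum.remove)
  have cutsum: "(\<Sum>e\<in>D. val e * x e) \<le> (\<Sum>e\<in>edges G1. w e * x e)"
  proof -
    \<comment> \<open>With \<open>val\<close> subtracted on the cut, every perfect matching of the
      first side has weight at least 0, and lightness carries this over to \<open>x\<close>.\<close>
    define w1 where "w1 e = (if e \<in> D then w e - val e else w e)" for e
    obtain M where M: "perfect_matching G1 M" "sum w1 M \<le> (\<Sum>e\<in>edges G1. w1 e * x e)"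
      using L1 by (auto simp: light_matching_def G1_def)
    obtain e where e: "M \<inter> D = {e}" using cross1[OF M(1)] by auto
    have finM: "finite M" using M(1) fin by (auto simp: perfect_matching_def E1 intro: finite_subset)
    have "sum w1 (M - {e}) = sum w (M - {e})" using e by (intro sum.cong) (auto simp: w1_def)
    moreover have eM: "e \<in> M" "w1 e = w e - val e" using e by (auto simp: w1_def)
    ultimately have "sum w1 M = sum w M - val e"
      using split_sum[OF finM eM(1), of w1] split_sum[OF finM eM(1), of w] by simp
    moreover have "val e \<le> sum w M" using e M by (intro val_le) (auto simp: PM_def)
    ultimately have "0 \<le> (\<Sum>e\<in>edges G1. w1 e * x e)" using M by simp
    also have "\<dots> = (\<Sum>e\<in>edges G1. w e * x e - (if e \<in> D then val e * x e else 0))"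
      by (intro sum.cong) (auto simp: w1_def left_diff_distrib)
    also have "\<dots> = (\<Sum>e\<in>edges G1. w e * x e) - (\<Sum>e\<in>D. val e * x e)"
    proof -
      have "D \<subseteq> edges G1" "finite (edges G1)" using EI EU fin by auto
      then have "(\<Sum>e\<in>edges G1. if e \<in> D then val e * x e else 0) = (\<Sum>e\<in>D. val e * x e)"
        by (intro sum.mono_neutral_cong_right) auto
      then show ?thesis by (simp add: sum_subtractf)
    qed
    finally show ?thesis by simp
  qed
  define w2 where "w2 e = (if e \<in> D then val e else w e)" for e
  obtain M2 where M2: "perfect_matching G2 M2" "sum w2 M2 \<le> (\<Sum>e\<in>edges G2. w2 e * x e)"
    using L2 by (auto simp: light_matching_def G2_def B_def)
  obtain e where e: "M2 \<inter> D = {e}" using cross2[OF M2(1)] by auto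
  have M2E: "M2 \<subseteq> edges G2" using M2(1) by (auto simp: perfect_matching_def)
  have finM2: "finite M2" using M2E fin EU by (auto intro: finite_subset)
  have "sum w2 (M2 - {e}) = sum w (M2 - {e})" using e by (intro sum.cong) (auto simp: w2_def)
  moreover have eM2: "e \<in> M2" "w2 e = val e" using e by (auto simp: w2_def)
  ultimately have w2M: "sum w2 M2 = val e + sum w (M2 - {e})"
    using split_sum[OF finM2 eM2(1), of w2] by simp
  have "(\<Sum>e\<in>edges G2. w2 e * x e) = (\<Sum>e\<in>edges G2 - D. w e * x e) + (\<Sum>e\<in>D. val e * x e)"
  proof -
    have "D \<subseteq> edges G2" "finite (edges G2)" using EI EU fin by auto
    then have "(\<Sum>e\<in>edges G2. w2 e * x e) = (\<Sum>e\<in>edges G2 - D. w2 e * x e) + (\<Sum>e\<in>D. w2 e * x e)"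
      by (rule sum.subset_diff)
    then show ?thesis by (simp add: w2_def)
  qed
  also have "\<dots> \<le> (\<Sum>e\<in>edges G2 - D. w e * x e) + (\<Sum>e\<in>edges G1. w e * x e)"
    using cutsum by simp
  also have "\<dots> = (\<Sum>e\<in>edges G. w e * x e)"
  proof -
    have "edges G = (edges G2 - D) \<union> edges G1" "(edges G2 - D) \<inter> edges G1 = {}" using EU EI by auto
    then show ?thesis using fin by (subst \<open>edges G = (edges G2 - D) \<union> edges G1\<close>, intro sum.union_disjoint[symmetric]) auto
  qed
  finally have w2le: "sum w2 M2 \<le> (\<Sum>e\<in>edges G. w e * x e)" using M2 by simp
  have "PM e \<noteq> {}"
  proof
    assume "PM e = {}"
    then have "sum w2 M2 = Big + sum w (M2 - {e})" using w2M by (simp add: val_def)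
    moreover have "\<bar>sum w (M2 - {e})\<bar> \<le> (\<Sum>e\<in>edges G. \<bar>w e\<bar>)"
    proof -
      have "\<bar>sum w (M2 - {e})\<bar> \<le> (\<Sum>e\<in>M2 - {e}. \<bar>w e\<bar>)" by (rule sum_abs)
      also have "\<dots> \<le> (\<Sum>e\<in>edges G. \<bar>w e\<bar>)" using fin M2E EU by (intro sum_mono2) auto
      finally show ?thesis .
    qed
    moreover have "(\<Sum>e\<in>edges G. w e * x e) \<le> (\<Sum>e\<in>edges G. \<bar>w e\<bar>)"
    proof (rule sum_mono)
      fix d assume d: "d \<in> edges G"
      have "0 \<le> x d" using x d by (auto simp: fractional_matching_def)
      moreover have "x d \<le> 1" by (rule fractional_le_1[OF g x d])
      ultimately have "\<bar>w d\<bar> * x d \<le> \<bar>w d\<bar>" by (simp add: mult_left_le)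
      moreover have "w d * x d \<le> \<bar>w d\<bar> * x d" using \<open>0 \<le> x d\<close> by (intro mult_right_mono) auto
      ultimately show "w d * x d \<le> \<bar>w d\<bar>" by simp
    qed
    ultimately show False using w2le by (simp add: Big_def)
  qed
  then have "val e \<in> sum w ` PM e" using finPM by (simp add: val_def)
  then obtain M1 where M1: "perfect_matching G1 M1" "e \<in> M1" "sum w M1 = val e"
    by (auto simp: PM_def)
  have M1E: "M1 \<subseteq> edges G1" using M1(1) by (auto simp: perfect_matching_def)
  have finM1: "finite M1" using M1E fin EU by (auto intro: finite_subset)
  have M1D: "M1 \<inter> D = {e}" using cross1[OF M1(1)] M1(2) e by auto
  have "perfect_matching G (M1 \<union> M2)"
    unfolding perfect_matching_def
  proof (intro conjI ballI)
    show "M1 \<union> M2 \<subseteq> edges G" using M1E M2E EU by auto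
    fix v assume "v \<in> verts G"
    then consider "v \<in> A" | "v \<in> B" using B by auto
    then show "\<exists>!d. d \<in> M1 \<union> M2 \<and> v \<in> ends G d"
    proof cases
      case 1
      then have "\<exists>!d. d \<in> M1 \<and> v \<in> ends G d"
        using M1(1) ends1 by (auto simp: perfect_matching_def G1_def contract_compl_def)
      moreover have "d \<in> M1" if "d \<in> M2" "v \<in> ends G d" for d
      proof -
        have "d \<in> edges G1" using that 1 M2E by (auto simp: E1 E2)
        then have "d \<in> M2 \<inter> D" using that M2E EI by auto
        then show ?thesis using e M1(2) by auto
      qed
      ultimately show ?thesis by auto
    next
      case 2
      then have "\<exists>!d. d \<in> M2 \<and> v \<in> ends G d"
        using M2(1) ends2 by (auto simp: perfect_matching_def G2_def contract_compl_def)
      moreover have "d \<in> M2" if "d \<in> M1" "v \<in> ends G d" for d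
      proof -
        have "d \<in> edges G2" using that 2 M1E by (auto simp: E1 E2)
        then have "d \<in> M1 \<inter> D" using that M1E EI by auto
        then show ?thesis using e M1D by auto
      qed
      ultimately show ?thesis by auto
    qed
  qed
  moreover have "sum w (M1 \<union> M2) = sum w2 M2"
  proof -
    have "M1 \<inter> (M2 - {e}) = {}" using M1E M2E M1D e EI by auto
    moreover have "M1 \<union> M2 = M1 \<union> (M2 - {e})" using M1(2) by auto
    ultimately have "sum w (M1 \<union> M2) = sum w M1 + sum w (M2 - {e})"
      using finM1 finM2 by (simp add: sum.union_disjoint)
    then show ?thesis using w2M M1(3) by simp
  qed
  ultimately show "\<exists>M. perfect_matching G M \<and> sum w M \<le> (\<Sum>e\<in>edges G. w e * x e)"
    using w2le by auto
qed


section \<open>Edmonds' theorem\<close>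

lemma edge_cut_compl:
  assumes "\<And>e. e \<in> edges G \<Longrightarrow> ends G e \<subseteq> verts G" "A \<subseteq> verts G"
  shows "edge_cut G (verts G - A) = edge_cut G A"
  using assms unfolding edge_cut_def by blast

lemma edge_cut_singleton:
  assumes "is_graph G"
  shows "edge_cut G {v} = incident_edges G v"
proof -
  have "ends G e - {v} \<noteq> {}" if "e \<in> edges G" "v \<in> ends G e" for e
  proof -
    have "card (ends G e) = 2" using assms that by (auto simp: is_graph_def)
    then show ?thesis by (auto simp: card_2_iff)
  qed
  then show ?thesis by (auto simp: edge_cut_def incident_edges_def)
qed

text \<open>Edmonds' description of the perfect matching polytope, in the form of a bound on the minimum
  weight of a perfect matching. A feasible point without zero, saturated or tight odd cut constraint
  can be moved along the kernel of the degree equations; the kernel is trivial only if the graph is a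
  disjoint union of odd cycles, which the cut inequalities exclude.\<close>

theorem edmonds_light_matching:
  fixes G :: "('v, 'e) multigraph"
  assumes "is_graph G" "fractional_matching G x"
  shows "light_matching G x"
  using assms
proof (induction "card (verts G) + card (edges G)" arbitrary: G x rule: less_induct)
  case less
  note g = less.prems(1) and x = less.prems(2)
  have fV: "finite (verts G)" and fE: "finite (edges G)" using g by (auto simp: is_graph_def)
  have endsV: "e \<in> edges G \<Longrightarrow> ends G e \<subseteq> verts G" and ends2: "e \<in> edges G \<Longrightarrow> card (ends G e) = 2" for e
    using g by (auto simp: is_graph_def)
  have evV: "even (card (verts G))"
  proof (rule ccontr)
    assume "odd (card (verts G))"
    then have "1 \<le> sum x (edge_cut G (verts G))" using x by (auto simp: fractional_matching_def)
    moreover have "edge_cut G (verts G) = {}" using endsV by (auto simp: edge_cut_def)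
    ultimately show False by simp
  qed
  \<comment> \<open>Singletons and their complements are left out: their cuts are degree equations,
    tight at every feasible point, and one of the two contractions would not shrink the
    graph.\<close>
  define nontriv where "nontriv U \<longleftrightarrow> U \<subseteq> verts G \<and> odd (card U) \<and> 2 \<le> card U \<and> 2 \<le> card (verts G - U)" for U
  have zero: "light_matching G y" if y: "fractional_matching G y" "e \<in> edges G" "y e = 0" for y e
  proof -
    note del = light_matching_delete_edge[OF g y]
    have "card (verts G) + card (edges G - {e}) < card (verts G) + card (edges G)"
      using card_Diff1_less[OF fE y(2)] by simp
    then show ?thesis using less.hyps[OF _ del(1,2)] del(3) by simp
  qed
  have tight: "light_matching G y"
    if y: "fractional_matching G y" "nontriv U" "sum y (edge_cut G U) = 1" for y U
  proof -
    have U: "U \<subseteq> verts G" "odd (card U)" using y by (auto simp: nontriv_def)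
    have fU: "finite U" using U fV finite_subset by blast
    have cU: "card (verts G - U) = card (verts G) - card U" "card U \<le> card (verts G)"
      using U fV fU by (auto simp: card_Diff_subset card_mono)
    then have odd2: "odd (card (verts G - U))" using evV U by simp
    have "U \<noteq> {}" "verts G - U \<noteq> {}" using y(2) unfolding nontriv_def by (metis card.empty not_numeral_le_zero)+
    then obtain r1 r2 where r: "r1 \<in> verts G - U" "r2 \<in> U" by blast
    have r2: "r2 \<in> verts G - (verts G - U)" using r U by auto
    have UU: "verts G - (verts G - U) = U" using U by auto
    have tight2: "sum y (edge_cut G (verts G - U)) = 1" using y(3) edge_cut_compl[OF endsV U(1)] by simp
    have edges_le: "card (edges (contract_compl G A r)) \<le> card (edges G)" for A r
      using fE by (intro card_mono) (auto simp: contract_compl_def)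
    have big: "card U + 2 \<le> card (verts G)" "card (verts G - U) + 2 \<le> card (verts G)"
      using cU y(2) unfolding nontriv_def by linarith+
    have "card (verts (contract_compl G U r1)) < card (verts G)"
      using r fU big by (simp add: contract_compl_def)
    then have L1: "light_matching (contract_compl G U r1) y"
      using edges_le[of U r1] is_graph_contract_compl[OF g U(1) r(1)]
        fractional_contract_compl[OF g U(1) r(1) y(1) odd2 y(3)]
      by (intro less.hyps) auto
    have "card (verts (contract_compl G (verts G - U) r2)) < card (verts G)"
      using r fV big(2) by (simp add: contract_compl_def)
    then have L2: "light_matching (contract_compl G (verts G - U) r2) y"
      using edges_le[of "verts G - U" r2] is_graph_contract_compl[OF g Diff_subset r2]
        fractional_contract_compl[OF g Diff_subset r2 y(1) _ tight2] UU U(2)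
      by (intro less.hyps) auto
    show ?thesis by (rule light_matching_glue[OF g y(1) U(1) r L1 L2])
  qed
  show ?case
  proof (cases "(\<exists>e\<in>edges G. x e = 0) \<or> (\<exists>U. nontriv U \<and> sum x (edge_cut G U) = 1)")
    case True
    then show ?thesis using zero[OF x] tight[OF x] by blast
  next
    case False
    have pos: "0 < x e" if "e \<in> edges G" for e
      using False x that by (auto simp: fractional_matching_def order_less_le)
    have slack: "1 < sum x (edge_cut G U)" if "nontriv U" for U
      using False x that by (auto simp: fractional_matching_def order_less_le nontriv_def)
    show ?thesis
    proof (cases "\<exists>e\<in>edges G. x e = 1")
      case True
      then obtain e where e: "e \<in> edges G" "x e = 1" by auto
      note del = light_matching_delete_saturated[OF g x pos e]
      have "card (edges G - {e}) < card (edges G)" using card_Diff1_less[OF fE e(1)] by simp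
      moreover have "card (verts G - ends G e) \<le> card (verts G)" using fV by (simp add: card_mono)
      ultimately have "card (verts G - ends G e) + card (edges G - {e}) < card (verts G) + card (edges G)"
        by simp
      then show ?thesis using less.hyps[OF _ del(1,2)] del(3) by simp
    next
      case no1: False
      show ?thesis
      proof (cases "\<exists>y :: 'e \<Rightarrow> real. (\<exists>e\<in>edges G. y e \<noteq> 0) \<and> (\<forall>v\<in>verts G. sum y (incident_edges G v) = 0)")
        case True
        then obtain y0 :: "'e \<Rightarrow> real" where y0: "\<exists>e\<in>edges G. y0 e \<noteq> 0"
          "\<forall>v\<in>verts G. sum y0 (incident_edges G v) = 0" by blast
        show ?thesis
          unfolding light_matching_def
        proof
          fix w
          \<comment> \<open>The sign is chosen such that moving along \<open>y\<close> does not
            increase the weight. A negative coordinate exists for either sign, because the sums at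
            the vertices vanish.\<close>
          define y where "y = (if (\<Sum>e\<in>edges G. w e * y0 e) \<le> 0 then y0 else (\<lambda>e. - y0 e))"
          have y: "\<exists>e\<in>edges G. y e \<noteq> 0" "\<forall>v\<in>verts G. sum y (incident_edges G v) = 0"
            "(\<Sum>e\<in>edges G. w e * y e) \<le> 0"
            using y0 by (auto simp: y_def sum_negf)
          have neg: "\<exists>e\<in>edges G. y e < 0"
          proof (rule ccontr)
            assume "\<not> (\<exists>e\<in>edges G. y e < 0)"
            then have nn: "0 \<le> y e" if "e \<in> edges G" for e using that by force
            obtain e where e: "e \<in> edges G" "y e \<noteq> 0" using y by auto
            obtain v where v: "v \<in> ends G e" "v \<in> verts G"
              using ends2[OF e(1)] endsV[OF e(1)] by (metis card_2_iff' subsetD)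
            have "\<forall>d\<in>incident_edges G v. y d = 0"
              using y(2) v nn finite_incident[OF fE]
              by (subst sum_nonneg_eq_0_iff[symmetric]) (auto simp: incident_edges_def)
            then show False using e v by (auto simp: incident_edges_def)
          qed
          \<comment> \<open>Slack at \<open>x\<close> paired with the rate of change along
            \<open>y\<close>, for every inequality that does not follow from the degree
            equations.\<close>
          define S where "S = (\<lambda>e. (x e, y e)) ` edges G \<union>
            (\<lambda>U. (sum x (edge_cut G U) - 1, sum y (edge_cut G U))) ` {U. nontriv U}"
          have "finite {U. nontriv U}"
            using fV by (intro finite_subset[of "{U. nontriv U}" "Pow (verts G)"]) (auto simp: nontriv_def)
          then have S1: "finite S" using fE by (simp add: S_def)
          have S2: "0 < fst p" if "p \<in> S" for p using that pos slack by (auto simp: S_def)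
          have S3: "\<exists>a b. (a, b) \<in> S \<and> b < 0" using neg by (auto simp: S_def)
          obtain t where t: "t > 0" "\<And>a b. (a, b) \<in> S \<Longrightarrow> a + t * b \<ge> 0" "\<exists>a b. (a, b) \<in> S \<and> a + t * b = 0"
            using affine_first_hit[OF S1 S2 S3] by blast
          define z where "z e = x e + t * y e" for e
          have sumz: "sum z F = sum x F + t * sum y F" for F
            by (simp add: z_def sum.distrib sum_distrib_left)
          have inc1: "sum z (incident_edges G v) = 1" if "v \<in> verts G" for v
            using x y(2) that by (simp add: sumz fractional_matching_def)
          have zfrac: "fractional_matching G z"
            unfolding fractional_matching_def
          proof (intro conjI ballI allI impI)
            show "0 \<le> z e" if "e \<in> edges G" for e using t(2)[of "x e" "y e"] that by (auto simp: S_def z_def)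
            show "sum z (incident_edges G v) = 1" if "v \<in> verts G" for v using inc1[OF that] .
            fix U assume U: "U \<subseteq> verts G" "odd (card U)"
            have fU: "finite U" using U fV finite_subset by blast
            have cU: "card (verts G - U) + card U = card (verts G)"
              using U fV fU by (simp add: card_Diff_subset card_mono)
            show "1 \<le> sum z (edge_cut G U)"
            proof (cases "nontriv U")
              case True
              then show ?thesis using t(2)[of "sum x (edge_cut G U) - 1" "sum y (edge_cut G U)"]
                by (auto simp: S_def sumz)
            next
              case False
              have "odd (card (verts G - U))" using cU U evV by presburger
              moreover have "card U < 2 \<or> card (verts G - U) < 2" using False U by (auto simp: nontriv_def)
              ultimately have "card U = 1 \<or> card (verts G - U) = 1" using U(2) by presburger
              then obtain v where "v \<in> verts G" "U = {v} \<or> verts G - U = {v}"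
                using U(1) by (metis Diff_subset card_1_singletonE insert_subset)
              then have "edge_cut G U = incident_edges G v"
                using edge_cut_compl[OF endsV U(1)] edge_cut_singleton[OF g, of v] by auto
              then show ?thesis using inc1[OF \<open>v \<in> verts G\<close>] by simp
            qed
          qed
          have "(\<exists>e\<in>edges G. z e = 0) \<or> (\<exists>U. nontriv U \<and> sum z (edge_cut G U) = 1)"
          proof -
            from t(3) consider e where "e \<in> edges G" "x e + t * y e = 0"
              | U where "nontriv U" "sum x (edge_cut G U) - 1 + t * sum y (edge_cut G U) = 0"
              by (auto simp: S_def)
            then show ?thesis
            proof cases
              case 1
              then show ?thesis by (auto simp: z_def)
            next
              case (2 U)
              then have "sum z (edge_cut G U) = 1" using sumz[of "edge_cut G U"] by linarith
              then show ?thesis using 2(1) by blast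
            qed
          qed
          then have "light_matching G z" using zero[OF zfrac] tight[OF zfrac] by blast
          then obtain M where M: "perfect_matching G M" "sum w M \<le> (\<Sum>e\<in>edges G. w e * z e)"
            by (auto simp: light_matching_def)
          have "(\<Sum>e\<in>edges G. w e * z e) = (\<Sum>e\<in>edges G. w e * x e) + t * (\<Sum>e\<in>edges G. w e * y e)"
            by (simp add: z_def distrib_left sum.distrib sum_distrib_left mult.left_commute)
          also have "\<dots> \<le> (\<Sum>e\<in>edges G. w e * x e)" using t(1) y(3) by (simp add: mult_nonneg_nonpos)
          finally show "\<exists>M. perfect_matching G M \<and> sum w M \<le> (\<Sum>e\<in>edges G. w e * x e)"
            using M by force
        qed
      next
        case noker: False
        show ?thesis
        proof (cases "edges G = {}")
          case True
          then have "verts G = {}" using x by (auto simp: fractional_matching_def incident_edges_def)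
          then have "perfect_matching G {}" by (simp add: perfect_matching_def)
          then show ?thesis using True by (auto simp: light_matching_def intro!: exI[of _ "{}"])
        next
          case Ene: False
          have deg_ge: "2 \<le> card (incident_edges G v)" if v: "v \<in> verts G" for v
          proof (rule ccontr)
            assume "\<not> 2 \<le> card (incident_edges G v)"
            then consider "card (incident_edges G v) = 0" | "card (incident_edges G v) = 1" by linarith
            then show False
            proof cases
              case 1
              then show ?thesis using x v finite_incident[OF fE, of v] by (auto simp: fractional_matching_def)
            next
              case 2
              then obtain e where e: "incident_edges G v = {e}" by (metis card_1_singletonE)
              then have "x e = 1" "e \<in> edges G" using x v by (auto simp: fractional_matching_def incident_edges_def)
              then show ?thesis using no1 by blast
            qed
          qed
          \<comment> \<open>A trivial kernel bounds the number of edges by the number of vertices.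
            No edge has value 1, so all degrees are at least 2, and the degree sum makes them
            exactly 2.\<close>
          have "\<not> card (verts G) < card (edges G)"
          proof
            assume "card (verts G) < card (edges G)"
            then obtain y :: "'e \<Rightarrow> real" where y: "\<exists>e\<in>edges G. y e \<noteq> 0"
              "\<forall>v\<in>verts G. (\<Sum>e\<in>edges G. (if v \<in> ends G e then 1 else 0) * y e) = 0"
              using homogeneous_system_nontrivial[OF fV fE, of "\<lambda>v e. if v \<in> ends G e then 1 else 0"] by blast
            have "(\<Sum>e\<in>edges G. (if v \<in> ends G e then 1 else 0) * y e) = sum y (incident_edges G v)" for v
              using fE by (simp add: if_distrib[of "\<lambda>a. a * _"] sum.If_cases incident_edges_def Int_def cong: if_cong)
            then show False using noker y by auto
          qed
          moreover have "(\<Sum>v\<in>verts G. card (incident_edges G v)) = 2 * card (edges G)"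
          proof -
            have "(\<Sum>v\<in>verts G. card (incident_edges G v)) = (\<Sum>e\<in>edges G. card (ends G e \<inter> verts G))"
              unfolding incident_edges_def by (rule sum_degrees[OF fE fV])
            also have "\<dots> = (\<Sum>e\<in>edges G. 2)"
              using ends2 endsV by (intro sum.cong) (auto simp: Int_absorb2)
            finally show ?thesis by simp
          qed
          ultimately have "(\<Sum>v\<in>verts G. card (incident_edges G v)) \<le> (\<Sum>v\<in>verts G. 2)" by simp
          then have deg: "card (incident_edges G v) = 2" if v: "v \<in> verts G" for v
          proof (rule_tac ccontr)
            assume *: "(\<Sum>v\<in>verts G. card (incident_edges G v)) \<le> (\<Sum>v\<in>verts G. 2)"
              and "card (incident_edges G v) \<noteq> 2"
            then have "2 < card (incident_edges G v)" using deg_ge[OF v] by simp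
            then have "(\<Sum>v\<in>verts G. 2) < (\<Sum>v\<in>verts G. card (incident_edges G v))"
              using deg_ge v fV by (intro sum_strict_mono_ex1) auto
            then show False using * by simp
          qed
          from alternating_coloring[OF g] obtain c W where
            W: "\<forall>v\<in>mono_at G c. v \<in> W v \<and> W v \<subseteq> verts G \<and> W v \<inter> mono_at G c = {v} \<and>
              (\<forall>u\<in>W v. card (incident_edges G u) = 2 \<and> (\<forall>e\<in>incident_edges G u. ends G e \<subseteq> W v)) \<and>
              (\<forall>u\<in>mono_at G c. u \<noteq> v \<longrightarrow> W v \<inter> W u = {})" by auto
          show ?thesis
          proof (cases "mono_at G c = {}")
            case True
            \<comment> \<open>Without conflicts, opposite signs on the two colours give a kernel
              vector.\<close>
            define y :: "'e \<Rightarrow> real" where "y e = (if c e then 1 else -1)" for e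
            have "sum y (incident_edges G v) = 0" if v: "v \<in> verts G" for v
            proof -
              obtain d d' where d: "incident_edges G v = {d, d'}" "d \<noteq> d'"
                using deg[OF v] by (meson card_2_iff)
              have "v \<notin> mono_at G c" using True by simp
              then have "c d \<noteq> c d'" using v deg[OF v] d by (auto simp: mono_at_def)
              then show ?thesis using d by (auto simp: y_def)
            qed
            moreover have "\<exists>e\<in>edges G. y e \<noteq> 0" using Ene by (auto simp: y_def)
            ultimately show ?thesis using noker by blast
          next
            case False
            then obtain v where v: "v \<in> mono_at G c" by auto
            \<comment> \<open>The component of a conflict is an odd set with empty cut and violates
              its own cut inequality.\<close>
            have "odd (card (W v))"
              by (rule alternating_component_odd[OF g]) (use bspec[OF W v] in auto)
            then have "1 \<le> sum x (edge_cut G (W v))" using x bspec[OF W v] by (auto simp: fractional_matching_def)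
            moreover have "edge_cut G (W v) = {}"
            proof -
              have "ends G e \<subseteq> W v" if "e \<in> edges G" "u \<in> ends G e" "u \<in> W v" for e u
                using bspec[OF W v] that by (auto simp: incident_edges_def)
              then show ?thesis unfolding edge_cut_def by blast
            qed
            ultimately show ?thesis by simp
          qed
        qed
      qed
    qed
  qed
qed

section \<open>Quasi-matchings of graphs with semi-edges\<close>

text \<open>A semi-edge is an edge with a single end. It counts once towards the degree and, having
  no second end, belongs to no \<open>edge_cut\<close>.\<close>

definition precubic :: "('v, 'e) multigraph \<Rightarrow> bool" where
  "precubic G \<longleftrightarrow> finite (verts G) \<and> finite (edges G) \<and>
     (\<forall>e\<in>edges G. ends G e \<subseteq> verts G \<and> (card (ends G e) = 1 \<or> card (ends G e) = 2)) \<and>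
     (\<forall>v\<in>verts G. card (incident_edges G v) = 3)"

definition links :: "('v, 'e) multigraph \<Rightarrow> 'e set" where
  "links G = {e \<in> edges G. card (ends G e) = 2}"

definition semis :: "('v, 'e) multigraph \<Rightarrow> 'e set" where
  "semis G = {e \<in> edges G. card (ends G e) = 1}"

definition semi_sparse :: "('v, 'e) multigraph \<Rightarrow> bool" where
  "semi_sparse G \<longleftrightarrow> (\<forall>v\<in>verts G. card (semis G \<inter> incident_edges G v) \<le> 1)"

definition bridgeless :: "('v, 'e) multigraph \<Rightarrow> bool" where
  "bridgeless G \<longleftrightarrow> (\<forall>A\<subseteq>verts G. card (edge_cut G A) \<noteq> 1)"

definition quasi_matching :: "('v, 'e) multigraph \<Rightarrow> 'e set \<Rightarrow> bool" where
  "quasi_matching G M \<longleftrightarrow> M \<subseteq> edges G \<and> (\<forall>v\<in>verts G.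
     semis G \<inter> incident_edges G v = {} \<and> card (M \<inter> incident_edges G v) = 1 \<or>
     (\<exists>s. semis G \<inter> incident_edges G v = {s} \<and>
        (M \<inter> incident_edges G v = {s} \<or> M \<inter> incident_edges G v = incident_edges G v - {s})))"

lemma precubic_edges:
  assumes "precubic G"
  shows "edges G = links G \<union> semis G" "links G \<inter> semis G = {}" "finite (links G)" "finite (semis G)"
  using assms by (auto simp: precubic_def links_def semis_def)

text \<open>Handshake modulo 2: an edge inside \<open>U\<close> contributes 2 and an edge across the
  boundary contributes 1. This makes cuts of odd sets odd in cubic graphs, and it places the bridges
  in perfect matchings.\<close>

lemma even_degree_sum_cut:
  assumes fin: "finite S" "finite U" and two: "\<And>e. e \<in> S \<Longrightarrow> card (d e) = 2"
  shows "even ((\<Sum>u\<in>U. card {e\<in>S. u \<in> d e}) + card {e\<in>S. d e \<inter> U \<noteq> {} \<and> d e - U \<noteq> {}})"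
proof -
  have par: "card (d e \<inter> U) = (if d e \<inter> U \<noteq> {} \<and> d e - U \<noteq> {} then 1 else 0) + 2 * (if d e \<subseteq> U then 1 else 0)"
    if "e \<in> S" for e
  proof -
    have "card (d e) = 2" using two that .
    then obtain a b where "d e = {a, b}" "a \<noteq> b" by (meson card_2_iff)
    then show ?thesis by (cases "a \<in> U"; cases "b \<in> U") auto
  qed
  have "(\<Sum>u\<in>U. card {e\<in>S. u \<in> d e}) = (\<Sum>e\<in>S. card (d e \<inter> U))" by (rule sum_degrees[OF fin])
  also have "\<dots> = (\<Sum>e\<in>S. if d e \<inter> U \<noteq> {} \<and> d e - U \<noteq> {} then 1 else 0) + 2 * (\<Sum>e\<in>S. if d e \<subseteq> U then 1 else 0)"
    using par by (simp add: sum.distrib sum_distrib_left)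
  also have "(\<Sum>e\<in>S. if d e \<inter> U \<noteq> {} \<and> d e - U \<noteq> {} then 1 else 0) =
      card {e\<in>S. d e \<inter> U \<noteq> {} \<and> d e - U \<noteq> {}}"
    using fin by (simp add: sum.If_cases Int_def)
  finally show ?thesis by simp
qed

lemma link_minus_semi:
  assumes "precubic G" "v \<in> verts G" "semis G \<inter> incident_edges G v = {s}"
  obtains e1 e2 where "e1 \<noteq> e2" "incident_edges G v = {s, e1, e2}" "s \<notin> {e1, e2}" "{e1, e2} \<subseteq> links G"
proof -
  have "card (incident_edges G v) = 3" "s \<in> incident_edges G v" using assms by (auto simp: precubic_def)
  then have "card (incident_edges G v - {s}) = 2" by (simp add: card_Diff_singleton)
  then obtain e1 e2 where e: "incident_edges G v - {s} = {e1, e2}" "e1 \<noteq> e2" by (meson card_2_iff)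
  then have "incident_edges G v = {s, e1, e2}" "s \<notin> {e1, e2}" using \<open>s \<in> incident_edges G v\<close> by blast+
  moreover have "{e1, e2} \<subseteq> links G"
  proof -
    have "{e1, e2} \<subseteq> incident_edges G v - semis G" using e assms(3) by blast
    then show ?thesis using precubic_edges(1)[OF assms(1)] by (auto simp: incident_edges_def)
  qed
  ultimately show thesis using that e(2) by blast
qed

text \<open>A vertex with a semi-edge is replaced by a digon whose two ends carry the two other edges.\<close>

lemma light_quasi_matching:
  fixes G :: "('v, 'e) multigraph" and w :: "'e \<Rightarrow> real"
  assumes G: "precubic G" "semi_sparse G" "bridgeless G"
  obtains M where "quasi_matching G M" "3 * sum w (M \<inter> links G) \<le> sum w (links G)"
proof -
  have fV: "finite (verts G)" using G by (auto simp: precubic_def)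
  note sp = precubic_edges[OF G(1)]
  define X where "X = {v \<in> verts G. semis G \<inter> incident_edges G v \<noteq> {}}"
  have semi_at: "\<exists>s. semis G \<inter> incident_edges G v = {s}" if "v \<in> X" for v
  proof -
    have "card (semis G \<inter> incident_edges G v) \<le> 1" "semis G \<inter> incident_edges G v \<noteq> {}"
      using that G(2) by (auto simp: X_def semi_sparse_def)
    moreover have "finite (semis G \<inter> incident_edges G v)" using sp by simp
    ultimately have "card (semis G \<inter> incident_edges G v) = 1"
      by (metis One_nat_def card_0_eq le_SucE le_zero_eq)
    then show ?thesis by (metis card_1_singletonE)
  qed
  have "\<forall>v\<in>X. \<exists>e. \<exists>s e1. semis G \<inter> incident_edges G v = {s} \<and> e1 \<noteq> e \<and>
      incident_edges G v = {s, e1, e} \<and> s \<notin> {e1, e} \<and> {e1, e} \<subseteq> links G"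
  proof
    fix v assume v: "v \<in> X"
    obtain s where s: "semis G \<inter> incident_edges G v = {s}" using semi_at[OF v] by blast
    have "v \<in> verts G" using v by (simp add: X_def)
    then obtain e1 e2 where "e1 \<noteq> e2" "incident_edges G v = {s, e1, e2}" "s \<notin> {e1, e2}" "{e1, e2} \<subseteq> links G"
      by (rule link_minus_semi[OF G(1) _ s])
    then show "\<exists>e. \<exists>s e1. semis G \<inter> incident_edges G v = {s} \<and> e1 \<noteq> e \<and>
      incident_edges G v = {s, e1, e} \<and> s \<notin> {e1, e} \<and> {e1, e} \<subseteq> links G"
      using s by blast
  qed
  then obtain e2 where e2: "\<forall>v\<in>X. \<exists>s e1. semis G \<inter> incident_edges G v = {s} \<and> e1 \<noteq> e2 v \<and>
      incident_edges G v = {s, e1, e2 v} \<and> s \<notin> {e1, e2 v} \<and> {e1, e2 v} \<subseteq> links G"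
    by (auto dest: bchoice)
  have XV: "X \<subseteq> verts G" by (auto simp: X_def)
  \<comment> \<open>At a vertex with a semi-edge the copy \<open>(v, True)\<close> carries the
    chosen link \<open>e2 v\<close> and the copy \<open>(v, False)\<close> the other link; the edges
    \<open>Inr\<close> form the digon between the copies.\<close>
  define h where "h e v = (v, v \<in> X \<and> e = e2 v)" for e v
  define H :: "('v \<times> bool, 'e + 'v \<times> bool) multigraph" where
    "H = \<lparr>verts = verts G \<times> {False} \<union> X \<times> {True}, edges = Inl ` links G \<union> Inr ` (X \<times> UNIV),
       ends = case_sum (\<lambda>e. h e ` ends G e) (\<lambda>p. {(fst p, False), (fst p, True)})\<rparr>"
  have endsL: "ends H (Inl e) = h e ` ends G e" and endsR: "ends H (Inr (x, b)) = {(x, False), (x, True)}" for e x b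
    by (simp_all add: H_def)
  have VH: "verts H = verts G \<times> {False} \<union> X \<times> {True}" and EH: "edges H = Inl ` links G \<union> Inr ` (X \<times> UNIV)"
    by (simp_all add: H_def)
  have linkD: "e \<in> edges G" "card (ends G e) = 2" "ends G e \<subseteq> verts G" if "e \<in> links G" for e
    using that G(1) by (auto simp: links_def precubic_def)
  have fH: "finite (verts H)" "finite (edges H)"
    using fV sp(3) finite_subset[OF XV fV] by (auto simp: VH EH)
  have gH: "is_graph H"
    unfolding is_graph_def
  proof (intro conjI ballI fH)
    fix e assume "e \<in> edges H"
    then consider e' where "e = Inl e'" "e' \<in> links G" | x b where "e = Inr (x, b)" "x \<in> X" by (auto simp: EH)
    then have "ends H e \<subseteq> verts H \<and> card (ends H e) = 2"
    proof cases
      case 1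
      have "inj_on (h e') (ends G e')" by (rule inj_onI) (simp add: h_def)
      then have "card (ends H e) = 2" using 1 linkD by (simp add: endsL card_image)
      moreover have "ends H e \<subseteq> verts H" using 1 linkD[of e'] by (auto simp: endsL VH h_def)
      ultimately show ?thesis by simp
    next
      case 2
      then show ?thesis using XV by (auto simp: endsR VH)
    qed
    then show "ends H e \<subseteq> verts H" "card (ends H e) = 2" by auto
  qed
  have memL: "(v, b) \<in> ends H (Inl e) \<longleftrightarrow> v \<in> ends G e \<and> b = (v \<in> X \<and> e = e2 v)" for v b e
    by (auto simp: endsL h_def)
  have memR: "(v, b) \<in> ends H (Inr (x, b')) \<longleftrightarrow> v = x" for v b x b'
    by (cases b) (auto simp: endsR)
  have inc_out: "incident_edges H (v, False) = Inl ` incident_edges G v" if v: "v \<in> verts G" "v \<notin> X" for v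
  proof -
    have "incident_edges G v \<subseteq> links G" using v sp(1) by (auto simp: X_def incident_edges_def)
    then show ?thesis using v by (auto simp: incident_edges_def EH memL memR) (auto simp: links_def)
  qed
  have inc_X: "incident_edges H (v, False) = {Inl e1, Inr (v, False), Inr (v, True)}"
      "incident_edges H (v, True) = {Inl (e2 v), Inr (v, False), Inr (v, True)}"
    if v: "v \<in> X" and e1: "incident_edges G v = {s, e1, e2 v}" "semis G \<inter> incident_edges G v = {s}"
      "s \<notin> {e1, e2 v}" "e1 \<noteq> e2 v" for v s e1
  proof -
    have L: "e \<in> links G \<and> v \<in> ends G e \<longleftrightarrow> e = e1 \<or> e = e2 v" for e
    proof -
      have "e \<in> links G \<and> v \<in> ends G e \<longleftrightarrow> e \<in> incident_edges G v - semis G"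
        using sp by (auto simp: incident_edges_def)
      also have "incident_edges G v - semis G = incident_edges G v - (semis G \<inter> incident_edges G v)" by blast
      also have "\<dots> = {s, e1, e2 v} - {s}" using e1(1,2) by simp
      also have "\<dots> = {e1, e2 v}" using e1(3) by auto
      finally show ?thesis by simp
    qed
    have mem: "e \<in> incident_edges H (v, b) \<longleftrightarrow>
      (\<exists>e'. e = Inl e' \<and> (e' = e1 \<or> e' = e2 v) \<and> b = (e' = e2 v)) \<or> e = Inr (v, False) \<or> e = Inr (v, True)" for e b
    proof (cases e)
      case (Inl e')
      then show ?thesis using L[of e'] v by (auto simp: incident_edges_def EH memL)
    next
      case (Inr p)
      then show ?thesis using v by (cases p; cases "snd p") (auto simp: incident_edges_def EH memR)
    qed
    show "incident_edges H (v, False) = {Inl e1, Inr (v, False), Inr (v, True)}"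
      "incident_edges H (v, True) = {Inl (e2 v), Inr (v, False), Inr (v, True)}"
      using mem e1(4) by auto
  qed
  have degH: "card (incident_edges H p) = 3" if "p \<in> verts H" for p
  proof -
    obtain v b where p: "p = (v, b)" by (cases p)
    show ?thesis
    proof (cases "v \<in> X")
      case True
      obtain s e1 where "semis G \<inter> incident_edges G v = {s}" "e1 \<noteq> e2 v"
        "incident_edges G v = {s, e1, e2 v}" "s \<notin> {e1, e2 v}" using bspec[OF e2 True] by auto
      then show ?thesis using inc_X[OF True] p by (cases b) simp_all
    next
      case False
      then have "v \<in> verts G" "b = False" using that p by (auto simp: VH)
      then show ?thesis using inc_out False p G(1) by (simp add: card_image precubic_def)
    qed
  qed
  \<comment> \<open>A set that separates the two ends of a digon cuts both of its edges; any other
    set comes from a vertex set of \<open>G\<close> with the same cut.\<close>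
  have cutH: "card (edge_cut H U) \<noteq> 1" if U: "U \<subseteq> verts H" for U
  proof (cases "\<exists>x\<in>X. ((x, False) \<in> U) \<noteq> ((x, True) \<in> U)")
    case True
    then obtain x where x: "x \<in> X" "((x, False) \<in> U) \<noteq> ((x, True) \<in> U)" by blast
    then have "{Inr (x, False), Inr (x, True)} \<subseteq> edge_cut H U" by (auto simp: edge_cut_def EH endsR)
    then have "card {Inr (x, False) :: 'e + 'v \<times> bool, Inr (x, True)} \<le> card (edge_cut H U)"
      using fH by (intro card_mono finite_cut)
    then show ?thesis by simp
  next
    case False
    define A where "A = fst ` U"
    have "fst ` verts H \<subseteq> verts G" using XV by (auto simp: VH)
    then have AV: "A \<subseteq> verts G" using U by (auto simp: A_def)
    have mem: "p \<in> U \<longleftrightarrow> fst p \<in> A" if p: "p \<in> verts H" for p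
    proof
      assume "fst p \<in> A"
      then obtain b where b: "(fst p, b) \<in> U" by (auto simp: A_def)
      then show "p \<in> U"
        using False p U by (cases p; cases b; cases "snd p") (auto simp: VH)
    qed (simp add: A_def)
    have hV: "h e v \<in> verts H" if "v \<in> verts G" for e v using that by (auto simp: h_def VH)
    have hU: "h e v \<in> U \<longleftrightarrow> v \<in> A" if "v \<in> verts G" for e v
      using mem[OF hV[OF that]] by (simp add: h_def)
    have "edge_cut H U = Inl ` edge_cut G A"
    proof (intro set_eqI iffI)
      fix e assume e: "e \<in> edge_cut H U"
      show "e \<in> Inl ` edge_cut G A"
      proof (cases e)
        case (Inl e')
        then have e': "e' \<in> links G" using e by (auto simp: edge_cut_def EH)
        obtain u v where "u \<in> ends G e'" "h e' u \<in> U" "v \<in> ends G e'" "h e' v \<notin> U"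
          using e Inl by (auto simp: edge_cut_def endsL)
        then have "ends G e' \<inter> A \<noteq> {} \<and> ends G e' - A \<noteq> {}"
          using hU linkD(3)[OF e'] by blast
        then show ?thesis using Inl e' linkD by (auto simp: edge_cut_def)
      next
        case (Inr p)
        then obtain x b where "e = Inr (x, b)" "x \<in> X" using e by (auto simp: edge_cut_def EH)
        then show ?thesis using e False by (auto simp: edge_cut_def endsR)
      qed
    next
      fix e :: "'e + 'v \<times> bool" assume "e \<in> Inl ` edge_cut G A"
      then obtain e' where e': "e = Inl e'" "e' \<in> edge_cut G A" by blast
      have "card (ends G e') \<noteq> 1" using e'(2) by (auto simp: edge_cut_def card_1_singleton_iff)
      then have l: "e' \<in> links G" using e'(2) G(1) by (auto simp: edge_cut_def precubic_def links_def)
      obtain u v where uv: "u \<in> ends G e'" "u \<in> A" "v \<in> ends G e'" "v \<notin> A" using e'(2) by (auto simp: edge_cut_def)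
      then have "h e' u \<in> U" "h e' v \<notin> U" using hU linkD(3)[OF l] by auto
      then show "e \<in> edge_cut H U" using e'(1) l uv by (auto simp: edge_cut_def EH endsL)
    qed
    then have "card (edge_cut H U) = card (edge_cut G A)" by (simp add: card_image)
    then show ?thesis using G(3) AV by (auto simp: bridgeless_def)
  qed
  \<comment> \<open>In a cubic graph parity makes the cut of an odd set odd, and size 1 is excluded,
    so at least three edges of value 1/3 cross it.\<close>
  have "fractional_matching H (\<lambda>_. 1/3)"
    unfolding fractional_matching_def
  proof (intro conjI ballI allI impI)
    show "(\<Sum>_\<in>incident_edges H p. 1 / 3) = (1::real)" if "p \<in> verts H" for p
      using degH[OF that] by simp
    fix U assume U: "U \<subseteq> verts H" "odd (card U)"
    have fU: "finite U" using U fH finite_subset by blast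
    have "even ((\<Sum>u\<in>U. card {e\<in>edges H. u \<in> ends H e}) + card (edge_cut H U))"
      unfolding edge_cut_def using gH by (intro even_degree_sum_cut fH fU) (auto simp: is_graph_def)
    moreover have "(\<Sum>u\<in>U. card {e\<in>edges H. u \<in> ends H e}) = 3 * card U"
    proof -
      have "card {e\<in>edges H. u \<in> ends H e} = 3" if "u \<in> U" for u
        using degH[of u] U(1) that by (auto simp: incident_edges_def)
      then show ?thesis by simp
    qed
    ultimately have "odd (card (edge_cut H U))" using U(2) by presburger
    then have "card (edge_cut H U) \<ge> 3" using cutH[OF U(1)] by presburger
    then show "1 \<le> (\<Sum>_\<in>edge_cut H U. 1 / 3 :: real)" by simp
  qed simp
  then have "light_matching H (\<lambda>_. 1/3)" by (rule edmonds_light_matching[OF gH])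
  moreover define w' :: "'e + 'v \<times> bool \<Rightarrow> real" where "w' = case_sum w (\<lambda>_. 0)"
  ultimately obtain N where N: "perfect_matching H N"
    "sum (w') N \<le> (\<Sum>e\<in>edges H. w' e * (1/3))"
    unfolding light_matching_def by blast
  have NE: "N \<subseteq> edges H" using N(1) by (simp add: perfect_matching_def)
  have N1: "\<exists>!e. e \<in> N \<inter> incident_edges H p" if "p \<in> verts H" for p
  proof -
    have "e \<in> N \<inter> incident_edges H p \<longleftrightarrow> e \<in> N \<and> p \<in> ends H e" for e
      using NE by (auto simp: incident_edges_def)
    then show ?thesis using N(1) that by (simp add: perfect_matching_def)
  qed
  \<comment> \<open>If \<open>N\<close> uses a digon edge, it matches neither link of that vertex
    and the semi-edge is taken; otherwise \<open>N\<close> contains both links. Digon edges have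
    weight 0, so only links are paid for.\<close>
  define M where "M = {e \<in> links G. Inl e \<in> N} \<union> {s \<in> semis G. \<forall>x\<in>X. x \<in> ends G s \<longrightarrow> Inl (e2 x) \<notin> N}"
  have Mlink: "e \<in> M \<longleftrightarrow> Inl e \<in> N" if "e \<in> links G" for e using that sp(2) by (auto simp: M_def)
  have "quasi_matching G M"
    unfolding quasi_matching_def
  proof (intro conjI ballI)
    show "M \<subseteq> edges G" using sp(1) by (auto simp: M_def)
    fix v assume v: "v \<in> verts G"
    show "semis G \<inter> incident_edges G v = {} \<and> card (M \<inter> incident_edges G v) = 1 \<or>
     (\<exists>s. semis G \<inter> incident_edges G v = {s} \<and>
        (M \<inter> incident_edges G v = {s} \<or> M \<inter> incident_edges G v = incident_edges G v - {s}))"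
    proof (cases "v \<in> X")
      case False
      then have inc: "incident_edges G v \<subseteq> links G" "semis G \<inter> incident_edges G v = {}"
        using v sp(1) by (auto simp: X_def incident_edges_def)
      have "(v, False) \<in> verts H" using v by (simp add: VH)
      then have "\<exists>!e. e \<in> N \<inter> Inl ` incident_edges G v" using N1 inc_out[OF v False] by metis
      then obtain p where p: "N \<inter> Inl ` incident_edges G v = {p}" by blast
      then obtain e where "p = Inl e" by blast
      then have e: "N \<inter> Inl ` incident_edges G v = {Inl e}" using p by simp
      then have "M \<inter> incident_edges G v = {e}" using inc Mlink by blast
      then show ?thesis using inc(2) by simp
    next
      case True
      obtain s e1 where e1: "semis G \<inter> incident_edges G v = {s}" "e1 \<noteq> e2 v"
        "incident_edges G v = {s, e1, e2 v}" "s \<notin> {e1, e2 v}" "{e1, e2 v} \<subseteq> links G"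
        using bspec[OF e2 True] by auto
      have N2: "\<exists>!e. e \<in> N \<inter> {Inl e1, Inr (v, False), Inr (v, True)}"
        "\<exists>!e. e \<in> N \<inter> {Inl (e2 v), Inr (v, False), Inr (v, True)}"
        using N1[of "(v, False)"] N1[of "(v, True)"] inc_X[OF True e1(3,1,4,2)] True v by (auto simp: VH)
      have ss: "s \<in> semis G" "v \<in> ends G s" using e1 by (auto simp: incident_edges_def)
      then have "ends G s = {v}" by (auto simp: semis_def card_1_singleton_iff)
      then have sM: "s \<in> M \<longleftrightarrow> Inl (e2 v) \<notin> N" using ss True sp(2) by (auto simp: M_def)
      have eM: "e1 \<in> M \<longleftrightarrow> Inl e1 \<in> N" "e2 v \<in> M \<longleftrightarrow> Inl (e2 v) \<in> N" using Mlink e1(5) by auto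
      have same: "Inl e1 \<in> N \<longleftrightarrow> Inl (e2 v) \<in> N" using N2 e1(2) by blast
      show ?thesis
      proof (cases "Inl (e2 v) \<in> N")
        case True
        then have "M \<inter> incident_edges G v = incident_edges G v - {s}" using sM eM same e1 by auto
        then show ?thesis using e1 by blast
      next
        case False
        then have "M \<inter> incident_edges G v = {s}" using sM eM same e1 by auto
        then show ?thesis using e1 by blast
      qed
    qed
  qed
  moreover have "3 * sum w (M \<inter> links G) \<le> sum w (links G)"
  proof -
    have fN: "finite N" using NE fH finite_subset by blast
    have "sum (w') N = sum (w') (Inl ` (M \<inter> links G))"
      using NE Mlink fN by (intro sum.mono_neutral_right) (auto simp: EH w'_def)
    also have "\<dots> = sum w (M \<inter> links G)" by (subst sum.reindex) (auto simp: w'_def)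
    finally have 1: "sum (w') N = sum w (M \<inter> links G)" .
    have "(\<Sum>e\<in>edges H. w' e * (1/3)) = (\<Sum>e\<in>Inl ` links G. w' e * (1/3))"
      using fH(2) by (intro sum.mono_neutral_right) (auto simp: EH w'_def)
    also have "\<dots> = (\<Sum>e\<in>links G. w e / 3)" by (subst sum.reindex) (auto simp: w'_def)
    also have "\<dots> = sum w (links G) / 3" by (simp add: sum_divide_distrib)
    finally show ?thesis using N(2) 1 by simp
  qed
  ultimately show thesis by (rule that)
qed

section \<open>Colourings from pairs of quasi-matchings\<close>

text \<open>The stars of \<open>VP I1\<close>, \<open>VQ I1\<close> and \<open>VR I1\<close>: a
  single end block of the target receives all vertices that are not defects.\<close>

definition stars :: "s12_edge set set" where
  "stars = {{TP I1, PQ I1, PR I1}, {PQ I1, QR I1 False, QR I1 True}, {PR I1, QR I1 False, QR I1 True}}"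

definition defects :: "('v, 'e) multigraph \<Rightarrow> ('e \<Rightarrow> s12_edge) \<Rightarrow> 'v set" where
  "defects G f = {v \<in> verts G. f ` incident_edges G v \<notin> stars}"

text \<open>The fixed colour on semi-edges makes any two colourings compatible across a bridge. The
  repeated colour at a defect is the second claim of the theorem and has to survive every
  reduction.\<close>

definition palette_coloring :: "('v, 'e) multigraph \<Rightarrow> ('e \<Rightarrow> s12_edge) \<Rightarrow> bool" where
  "palette_coloring G f \<longleftrightarrow> f ` edges G \<subseteq> \<Union> stars \<and> f ` semis G \<subseteq> {TP I1} \<and>
     (\<forall>v\<in>defects G f. \<not> inj_on f (incident_edges G v))"

definition unsaturated :: "('v, 'e) multigraph \<Rightarrow> 'e set \<Rightarrow> 'v set" where
  "unsaturated G M = {v \<in> verts G. \<exists>s \<in> semis G \<inter> incident_edges G v. s \<notin> M}"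

section \<open>Semi-edges and unsaturated vertices\<close>

lemma card_verts_with_semi:
  assumes G: "precubic G" "semi_sparse G"
  shows "card {v \<in> verts G. semis G \<inter> incident_edges G v \<noteq> {}} = card (semis G)"
proof -
  note sp = precubic_edges[OF G(1)]
  have fV: "finite (verts G)" using G by (auto simp: precubic_def)
  have at: "card {e \<in> semis G. v \<in> ends G e} = (if semis G \<inter> incident_edges G v \<noteq> {} then 1 else 0)"
    if v: "v \<in> verts G" for v
  proof -
    have eq: "{e \<in> semis G. v \<in> ends G e} = semis G \<inter> incident_edges G v"
      by (auto simp: semis_def incident_edges_def)
    have "card (semis G \<inter> incident_edges G v) \<le> 1" using v G by (auto simp: semi_sparse_def)
    then show ?thesis unfolding eq using sp(4)
      by (cases "semis G \<inter> incident_edges G v = {}") (auto simp: le_Suc_eq)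
  qed
  have "card (semis G) = (\<Sum>e\<in>semis G. card (ends G e \<inter> verts G))"
  proof -
    have "card (ends G e \<inter> verts G) = 1" if "e \<in> semis G" for e
      using that G(1) by (auto simp: semis_def precubic_def Int_absorb2)
    then show ?thesis by simp
  qed
  also have "\<dots> = (\<Sum>v\<in>verts G. card {e \<in> semis G. v \<in> ends G e})"
    by (rule sum_degrees[symmetric]) (use sp fV in auto)
  also have "\<dots> = card {v \<in> verts G. semis G \<inter> incident_edges G v \<noteq> {}}"
    using at fV by (simp add: sum.If_cases Int_def)
  finally show ?thesis by simp
qed

lemma even_verts_semis:
  assumes G: "precubic G"
  shows "even (card (verts G) + card (semis G))"
proof -
  note sp = precubic_edges[OF G]
  have fin: "finite (edges G)" "finite (verts G)" using G by (auto simp: precubic_def)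
  have "3 * card (verts G) = (\<Sum>v\<in>verts G. card {e \<in> edges G. v \<in> ends G e})"
    using G by (simp add: precubic_def incident_edges_def)
  also have "\<dots> = (\<Sum>e\<in>edges G. card (ends G e \<inter> verts G))" by (rule sum_degrees[OF fin])
  also have "\<dots> = (\<Sum>e\<in>links G. card (ends G e \<inter> verts G)) + (\<Sum>e\<in>semis G. card (ends G e \<inter> verts G))"
    using sp by (simp add: sum.union_disjoint)
  also have "(\<Sum>e\<in>links G. card (ends G e \<inter> verts G)) = (\<Sum>e\<in>links G. 2)"
    using G by (intro sum.cong) (auto simp: links_def precubic_def Int_absorb2)
  also have "(\<Sum>e\<in>semis G. card (ends G e \<inter> verts G)) = (\<Sum>e\<in>semis G. 1)"
    using G by (intro sum.cong) (auto simp: semis_def precubic_def Int_absorb2)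
  finally have "3 * card (verts G) = 2 * card (links G) + card (semis G)" by simp
  then show ?thesis by presburger
qed

lemma quasi_matching_cases:
  assumes G: "precubic G" and M: "quasi_matching G M" and v: "v \<in> verts G"
  obtains (plain) m where "semis G \<inter> incident_edges G v = {}" "M \<inter> incident_edges G v = {m}" "v \<notin> unsaturated G M"
  | (sat) s where "semis G \<inter> incident_edges G v = {s}" "M \<inter> incident_edges G v = {s}" "v \<notin> unsaturated G M"
  | (unsat) s where "semis G \<inter> incident_edges G v = {s}" "M \<inter> incident_edges G v = incident_edges G v - {s}"
      "v \<in> unsaturated G M"
proof -
  from M v consider "semis G \<inter> incident_edges G v = {}" "card (M \<inter> incident_edges G v) = 1"
    | s where "semis G \<inter> incident_edges G v = {s}" "M \<inter> incident_edges G v = {s}"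
    | s where "semis G \<inter> incident_edges G v = {s}" "M \<inter> incident_edges G v = incident_edges G v - {s}"
    unfolding quasi_matching_def by blast
  then show thesis
  proof cases
    case 1
    obtain m where "M \<inter> incident_edges G v = {m}" using 1(2) by (metis card_1_singletonE)
    moreover have "v \<notin> unsaturated G M" using 1(1) by (simp add: unsaturated_def)
    ultimately show thesis using plain 1 by blast
  next
    case (2 s)
    have "s \<in> M" using 2(2) by blast
    then have "v \<notin> unsaturated G M" using 2(1) by (simp add: unsaturated_def)
    then show thesis using sat 2 by blast
  next
    case (3 s)
    have "s \<notin> M" using 3 by blast
    then have "v \<in> unsaturated G M" using 3(1) v by (simp add: unsaturated_def)
    then show thesis using unsat 3 by blast
  qed
qed

text \<open>A quasi-matching takes both links of such a vertex or neither, so a single link decides;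
  being unsaturated can therefore be priced by a weight on one link.\<close>

lemma unsaturated_iff:
  assumes G: "precubic G" and M: "quasi_matching G M" and v: "v \<in> verts G"
    and s: "semis G \<inter> incident_edges G v \<noteq> {}" and e: "e \<in> links G" "e \<in> incident_edges G v"
  shows "v \<in> unsaturated G M \<longleftrightarrow> e \<in> M"
  using G M v
proof (cases rule: quasi_matching_cases)
  case (plain m)
  then show ?thesis using s by simp
next
  case (sat s)
  have "e \<noteq> s" using sat precubic_edges(2)[OF G] e by blast
  then show ?thesis using sat e by blast
next
  case (unsat s)
  have "e \<noteq> s" using unsat precubic_edges(2)[OF G] e by blast
  then show ?thesis using unsat e by blast
qed

text \<open>The weight is \<open>r\<close> on one chosen link at each vertex with a semi-edge, which
  counts unsaturated vertices, plus 1 on each edge of \<open>S\<close>; the quasi-matching costs at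
  most a third of the total. A large \<open>r\<close> gives unsaturated vertices priority over
  avoiding \<open>S\<close>, and \<open>r = 0\<close> looks at \<open>S\<close> alone.\<close>

lemma light_quasi_matching_unsaturated:
  fixes G :: "('v, 'e) multigraph" and r :: nat
  assumes G: "precubic G" "semi_sparse G" "bridgeless G" and S: "S \<subseteq> links G"
  obtains M where "quasi_matching G M"
    "3 * (r * card (unsaturated G M) + card (M \<inter> S)) \<le> r * card (semis G) + card S"
proof -
  note sp = precubic_edges[OF G(1)]
  have fV: "finite (verts G)" using G by (auto simp: precubic_def)
  define X where "X = {v \<in> verts G. semis G \<inter> incident_edges G v \<noteq> {}}"
  have fX: "finite X" using fV by (simp add: X_def)
  have "\<forall>v\<in>X. \<exists>e. e \<in> links G \<and> e \<in> incident_edges G v"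
  proof
    fix v assume v: "v \<in> X"
    have "card (semis G \<inter> incident_edges G v) \<le> 1" "card (incident_edges G v) = 3"
      using v G by (auto simp: X_def semi_sparse_def precubic_def)
    then have "\<not> incident_edges G v \<subseteq> semis G" by (auto simp: Int_absorb1)
    then show "\<exists>e. e \<in> links G \<and> e \<in> incident_edges G v" using sp(1) by (auto simp: incident_edges_def)
  qed
  then obtain l where l: "\<forall>v\<in>X. l v \<in> links G \<and> l v \<in> incident_edges G v" by (auto dest: bchoice)
  define w :: "'e \<Rightarrow> real" where
    "w e = real r * (\<Sum>v\<in>X. if l v = e then 1 else 0) + (if e \<in> S then 1 else 0)" for e
  have wsum: "sum w (F \<inter> links G) = real (r * card {v \<in> X. l v \<in> F} + card (F \<inter> S))" for F
  proof -
    have fin: "finite (F \<inter> links G)" using sp by simp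
    have "(\<Sum>e\<in>F \<inter> links G. \<Sum>v\<in>X. if l v = e then 1 else 0) =
      (\<Sum>v\<in>X. \<Sum>e\<in>F \<inter> links G. if l v = e then 1 else (0::real))" by (rule sum.swap)
    also have "\<dots> = (\<Sum>v\<in>X. if l v \<in> F then 1 else 0)"
      using l fin by (intro sum.cong) (auto simp: sum.delta)
    also have "\<dots> = real (card {v \<in> X. l v \<in> F})" using fX by (simp add: sum.If_cases Int_def)
    finally have 1: "(\<Sum>e\<in>F \<inter> links G. \<Sum>v\<in>X. if l v = e then 1 else 0) = real (card {v \<in> X. l v \<in> F})" .
    have "F \<inter> links G \<inter> S = F \<inter> S" using S by blast
    then have "(\<Sum>e\<in>F \<inter> links G. if e \<in> S then 1 else (0::real)) = real (card (F \<inter> S))"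
      using fin by (simp add: sum.If_cases)
    then show ?thesis using 1 by (simp add: w_def sum.distrib flip: sum_distrib_left)
  qed
  obtain M where M: "quasi_matching G M" "3 * sum w (M \<inter> links G) \<le> sum w (links G)"
    by (rule light_quasi_matching[OF G])
  have "v \<in> unsaturated G M \<longleftrightarrow> v \<in> X \<and> l v \<in> M" for v
  proof (cases "v \<in> X")
    case True
    then have "v \<in> verts G" "semis G \<inter> incident_edges G v \<noteq> {}" by (auto simp: X_def)
    then show ?thesis using unsaturated_iff[OF G(1) M(1), of v "l v"] l True by blast
  next
    case False
    then show ?thesis by (auto simp: X_def unsaturated_def)
  qed
  then have "unsaturated G M = {v \<in> X. l v \<in> M}" by blast
  then have "sum w (M \<inter> links G) = real (r * card (unsaturated G M) + card (M \<inter> S))" using wsum[of M] by simp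
  moreover have "sum w (links G) = real (r * card (semis G) + card S)"
    using wsum[of UNIV] card_verts_with_semi[OF G(1,2)] by (simp add: X_def)
  ultimately have "real (3 * (r * card (unsaturated G M) + card (M \<inter> S))) \<le> real (r * card (semis G) + card S)"
    using M(2) by simp
  then show thesis using that M(1) by (simp only: of_nat_le_iff)
qed

text \<open>Edges in both, only the first, only the second quasi-matching become \<open>TP\<close> and the two
  parallel edges; the remaining paths and cycles alternate between \<open>PQ\<close> and \<open>PR\<close>, which fails
  once on every odd cycle. The set \<open>D\<close> collects the vertices of these cycles.\<close>

lemma quasi_matching_pair_coloring:
  fixes G :: "('v, 'e) multigraph"
  assumes G: "precubic G" "semi_sparse G" and M: "quasi_matching G M" and M': "quasi_matching G M'"
  obtains f k D where "palette_coloring G f"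
    "card (defects G f) \<le> card (unsaturated G M \<union> unsaturated G M') + k"
    "D \<subseteq> verts G" "3 * k \<le> card D" "\<not> has_triangle G \<Longrightarrow> 5 * k \<le> card D"
    "\<And>u. u \<in> D \<Longrightarrow> card (incident_edges G u \<inter> links G - M - M') = 2"
    "\<And>u e. u \<in> D \<Longrightarrow> e \<in> incident_edges G u \<inter> links G - M - M' \<Longrightarrow> ends G e \<subseteq> D"
proof -
  note sp = precubic_edges[OF G(1)]
  have fV: "finite (verts G)" using G by (auto simp: precubic_def)
  define K where "K = \<lparr>verts = verts G, edges = links G - M - M', ends = ends G\<rparr>"
  have "card (ends G e) = 2 \<and> ends G e \<subseteq> verts G" if "e \<in> links G" for e
    using G(1) that by (auto simp: links_def precubic_def)
  then have gK: "is_graph K" unfolding is_graph_def using fV sp(3) by (simp add: K_def)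
  have inc: "incident_edges K v = incident_edges G v \<inter> links G - M - M'" for v
    by (auto simp: K_def incident_edges_def links_def)
  have VK: "verts K = verts G" by (simp add: K_def)
  from alternating_coloring[OF gK] obtain c W where
    W: "\<forall>v\<in>mono_at K c. v \<in> W v \<and> W v \<subseteq> verts K \<and> W v \<inter> mono_at K c = {v} \<and>
      (\<forall>u\<in>W v. card (incident_edges K u) = 2 \<and> (\<forall>e\<in>incident_edges K u. ends K e \<subseteq> W v)) \<and>
      (\<forall>u\<in>mono_at K c. u \<noteq> v \<longrightarrow> W v \<inter> W u = {})" by auto
  define B where "B = mono_at K c"
  define D where "D = (\<Union>v\<in>B. W v)"
  define f where "f e = (if e \<in> semis G then TP I1 else if e \<in> M then (if e \<in> M' then TP I1 else QR I1 False)
    else if e \<in> M' then QR I1 True else if c e then PQ I1 else PR I1)" for e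
  \<comment> \<open>The two links of a vertex with a semi-edge lie in the same quasi-matchings.
    Where one of these leaves the semi-edge out, both links thus get the same colour, so such a
    defect automatically repeats a colour. Elsewhere only a conflict of the alternation can spoil a
    star.\<close>
  have key: "f ` incident_edges G v \<in> stars \<or>
      \<not> inj_on f (incident_edges G v) \<and> v \<in> unsaturated G M \<union> unsaturated G M' \<union> B"
    if v: "v \<in> verts G" for v
  proof -
    have c3: "card (incident_edges G v) = 3" using G(1) v by (auto simp: precubic_def)
    have alt: ?thesis if m: "m \<in> incident_edges G v" "f m = TP I1" "incident_edges K v = incident_edges G v - {m}" for m
    proof -
      have c2: "card (incident_edges G v - {m}) = 2" using m c3 by (simp add: card_Diff_singleton)
      then obtain a b where ab: "incident_edges G v - {m} = {a, b}" "a \<noteq> b" by (meson card_2_iff)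
      have iv: "incident_edges G v = {m, a, b}" using ab m(1) by blast
      have K: "{a, b} \<subseteq> links G - M - M'" using ab(1) m(3) inc by blast
      then have fab: "f a = (if c a then PQ I1 else PR I1)" "f b = (if c b then PQ I1 else PR I1)"
        using sp(2) by (auto simp: f_def)
      show ?thesis
      proof (cases "c a = c b")
        case True
        then have "v \<in> B" using v ab m(3) c2 by (auto simp: B_def mono_at_def VK)
        moreover have "\<not> inj_on f (incident_edges G v)" using True fab ab(2) iv by (auto simp: inj_on_def)
        ultimately show ?thesis by blast
      next
        case False
        then have "f ` incident_edges G v = {TP I1, PQ I1, PR I1}" using fab m(2) iv by auto
        then show ?thesis by (simp add: stars_def)
      qed
    qed
    show ?thesis
      using G(1) M v
    proof (cases rule: quasi_matching_cases)
      case p: (plain m)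
      have lk: "incident_edges G v \<subseteq> links G" using p(1) sp(1) by (auto simp: incident_edges_def)
      from G(1) M' v show ?thesis
      proof (cases rule: quasi_matching_cases)
        case p': (plain m')
        have mem: "m \<in> incident_edges G v" "m \<in> M" "m' \<in> incident_edges G v" "m' \<in> M'" using p p' by auto
        show ?thesis
        proof (cases "m = m'")
          case True
          have "f m = TP I1" using mem True by (simp add: f_def)
          moreover have "incident_edges K v = incident_edges G v - {m}"
            unfolding inc using lk p(2) p'(2) True by blast
          ultimately show ?thesis using alt mem by blast
        next
          case False
          have "card (incident_edges G v - {m, m'}) = 1" using c3 mem False by (simp add: card_Diff_subset)
          then obtain a where a: "incident_edges G v - {m, m'} = {a}" by (metis card_1_singletonE)
          then have iv: "incident_edges G v = {m, m', a}" using mem by blast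
          have ns: "x \<notin> semis G" if "x \<in> incident_edges G v" for x using lk that sp(2) by blast
          have inM: "x \<in> M \<longleftrightarrow> x = m" if "x \<in> incident_edges G v" for x using p(2) that by blast
          have inM': "x \<in> M' \<longleftrightarrow> x = m'" if "x \<in> incident_edges G v" for x using p'(2) that by blast
          have "a \<in> incident_edges G v - {m, m'}" by (simp add: a)
          then have "m \<notin> M'" "m' \<notin> M" "a \<notin> M" "a \<notin> M'" using False inM inM' mem by auto
          then have "f m = QR I1 False" "f m' = QR I1 True" "f a = PQ I1 \<or> f a = PR I1"
            using mem ns iv by (auto simp: f_def)
          then have "f ` incident_edges G v \<in> stars" unfolding iv by (auto simp: stars_def)
          then show ?thesis by blast
        qed
      qed (use p in auto)
    next
      case p: (sat s)
      have s: "s \<in> incident_edges G v" "s \<in> semis G" using p by auto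
      from G(1) M' v show ?thesis
      proof (cases rule: quasi_matching_cases)
        case p': (sat s')
        have "f s = TP I1" using s by (simp add: f_def)
        moreover have "s' = s" using p p' by simp
        moreover have "incident_edges G v - {s} \<subseteq> links G" using p(1) sp(1) by (auto simp: incident_edges_def)
        then have "incident_edges K v = incident_edges G v - {s}"
          unfolding inc using p(2) p'(2) \<open>s' = s\<close> s sp(2) by blast
        ultimately show ?thesis using alt s by blast
      next
        case p': (unsat s')
        have "s' = s" using p p' by simp
        obtain e1 e2 where e: "e1 \<noteq> e2" "incident_edges G v = {s, e1, e2}" "s \<notin> {e1, e2}" "{e1, e2} \<subseteq> links G"
          by (rule link_minus_semi[OF G(1) v p(1)])
        have inM: "x \<in> M \<longleftrightarrow> x = s" if "x \<in> incident_edges G v" for x using p(2) that by blast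
        have inM': "x \<in> M' \<longleftrightarrow> x \<noteq> s" if "x \<in> incident_edges G v" for x
          using p'(2) that \<open>s' = s\<close> by blast
        have "e1 \<in> incident_edges G v" "e2 \<in> incident_edges G v" "e1 \<noteq> s" "e2 \<noteq> s" using e by auto
        then have "e1 \<in> M' \<and> e2 \<in> M' \<and> e1 \<notin> M \<and> e2 \<notin> M" using inM inM' by blast
        then have "f e1 = f e2" using e(4) sp(2) by (auto simp: f_def)
        then have "\<not> inj_on f (incident_edges G v)" using e(1,2) by (auto simp: inj_on_def)
        then show ?thesis using p'(3) by blast
      qed (use p in auto)
    next
      case p: (unsat s)
      obtain e1 e2 where e: "e1 \<noteq> e2" "incident_edges G v = {s, e1, e2}" "s \<notin> {e1, e2}" "{e1, e2} \<subseteq> links G"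
        by (rule link_minus_semi[OF G(1) v p(1)])
      have "x \<in> M \<longleftrightarrow> x \<noteq> s" if "x \<in> incident_edges G v" for x using p(2) that by blast
      then have eM: "e1 \<in> M" "e2 \<in> M" using e by auto
      have "e1 \<in> M' \<longleftrightarrow> e2 \<in> M'"
        using unsaturated_iff[OF G(1) M' v, of e1] unsaturated_iff[OF G(1) M' v, of e2] e p(1) by auto
      then have "f e1 = f e2" using eM e(4) sp(2) by (auto simp: f_def)
      then have "\<not> inj_on f (incident_edges G v)" using e(1,2) by (auto simp: inj_on_def)
      then show ?thesis using p(3) by blast
    qed
  qed
  have fB: "finite B" using fV by (auto simp: B_def mono_at_def VK)
  note WB = bspec[OF W[folded B_def]]
  have fW: "finite (W v)" if "v \<in> B" for v using WB[OF that] fV by (auto simp: VK intro: finite_subset)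
  have cardD: "card D = (\<Sum>v\<in>B. card (W v))"
    unfolding D_def using fB fW WB by (intro card_UN_disjoint) auto
  have size: "card (W v) \<ge> 5 \<or> card (W v) = 3 \<and> has_triangle K" if v: "v \<in> B" for v
    by (rule alternating_component_size[OF gK]) (use WB[OF v] in \<open>auto simp: B_def\<close>)
  have tri: "has_triangle G" if "has_triangle K"
    using that unfolding has_triangle_def by (auto simp: K_def links_def) blast
  show thesis
  proof (rule that[of f "card B" D])
    show "palette_coloring G f"
      unfolding palette_coloring_def
    proof (intro conjI ballI)
      show "f ` edges G \<subseteq> \<Union> stars" by (auto simp: f_def stars_def)
      show "f ` semis G \<subseteq> {TP I1}" by (auto simp: f_def)
      show "\<not> inj_on f (incident_edges G v)" if "v \<in> defects G f" for v
        using key that by (auto simp: defects_def)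
    qed
    have fU: "finite (unsaturated G M \<union> unsaturated G M')" using fV by (auto simp: unsaturated_def)
    have "defects G f \<subseteq> (unsaturated G M \<union> unsaturated G M') \<union> B"
      using key by (auto simp: defects_def)
    then have "card (defects G f) \<le> card ((unsaturated G M \<union> unsaturated G M') \<union> B)"
      using fU fB by (intro card_mono) auto
    also have "\<dots> \<le> card (unsaturated G M \<union> unsaturated G M') + card B" by (rule card_Un_le)
    finally show "card (defects G f) \<le> card (unsaturated G M \<union> unsaturated G M') + card B" .
    have "W v \<subseteq> verts G" if "v \<in> B" for v using WB[OF that] VK by simp
    then show "D \<subseteq> verts G" by (auto simp: D_def)
    show "3 * card B \<le> card D"
    proof -
      have "(\<Sum>v\<in>B. 3) \<le> (\<Sum>v\<in>B. card (W v))" using size by (intro sum_mono) force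
      then show ?thesis by (simp add: cardD)
    qed
    show "5 * card B \<le> card D" if "\<not> has_triangle G"
    proof -
      have "(\<Sum>v\<in>B. 5) \<le> (\<Sum>v\<in>B. card (W v))" using size tri that by (intro sum_mono) force
      then show ?thesis by (simp add: cardD)
    qed
    show "card (incident_edges G u \<inter> links G - M - M') = 2" if u: "u \<in> D" for u
    proof -
      obtain v where v: "v \<in> B" "u \<in> W v" using u by (auto simp: D_def)
      then show ?thesis using WB[OF v(1)] inc by simp
    qed
    show "ends G e \<subseteq> D" if ue: "u \<in> D" "e \<in> incident_edges G u \<inter> links G - M - M'" for u e
    proof -
      obtain v where v: "v \<in> B" "u \<in> W v" using ue(1) by (auto simp: D_def)
      have "ends K e \<subseteq> W v" using WB[OF v(1)] v(2) ue(2) inc by blast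
      then show ?thesis using v by (auto simp: D_def K_def)
    qed
  qed
qed

text \<open>An end of an edge in exactly one of the two quasi-matchings has one edge outside both,
  or none if it carries a semi-edge. It therefore lies on no defective cycle; in this way the second
  quasi-matching repairs the cycles it meets.\<close>

lemma mismatch_degree:
  assumes G: "precubic G" and M: "quasi_matching G M" and M': "quasi_matching G M'" and v: "v \<in> verts G"
    and e: "e \<in> incident_edges G v" "e \<in> links G" "e \<in> M \<longleftrightarrow> e \<notin> M'"
  shows "card (incident_edges G v \<inter> links G - M - M') \<noteq> 2"
proof (cases "semis G \<inter> incident_edges G v = {}")
  case True
  obtain m where m: "M \<inter> incident_edges G v = {m}"
    by (rule quasi_matching_cases[OF G M v]) (use True in auto)
  obtain m' where m': "M' \<inter> incident_edges G v = {m'}"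
    by (rule quasi_matching_cases[OF G M' v]) (use True in auto)
  have "m \<noteq> m'" using m m' e by blast
  have lk: "incident_edges G v \<subseteq> links G" using True precubic_edges(1)[OF G] by (auto simp: incident_edges_def)
  have "incident_edges G v \<inter> links G - M - M' = incident_edges G v - {m, m'}" using lk m m' by blast
  moreover have "card (incident_edges G v - {m, m'}) = 1"
  proof -
    have "{m, m'} \<subseteq> incident_edges G v" using m m' by blast
    then have "card (incident_edges G v - {m, m'}) = card (incident_edges G v) - card {m, m'}"
      by (intro card_Diff_subset) auto
    then show ?thesis using \<open>m \<noteq> m'\<close> G v by (simp add: precubic_def)
  qed
  ultimately show ?thesis by simp
next
  case False
  have "x \<in> M \<or> x \<in> M'" if x: "x \<in> incident_edges G v" "x \<in> links G" for x
    using unsaturated_iff[OF G M v False x(2,1)] unsaturated_iff[OF G M v False e(2,1)]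
      unsaturated_iff[OF G M' v False x(2,1)] unsaturated_iff[OF G M' v False e(2,1)] e(3) by blast
  then have "incident_edges G v \<inter> links G - M - M' = {}" by blast
  then show ?thesis by (metis card.empty zero_neq_numeral)
qed

text \<open>The degree is 0 here, as \<open>M\<close> takes both links. Unsaturated vertices are
  thus never on a defective cycle and can be subtracted from the vertices available for
  cycles.\<close>

lemma unsaturated_degree:
  assumes G: "precubic G" and M: "quasi_matching G M" and v: "v \<in> unsaturated G M"
  shows "card (incident_edges G v \<inter> links G - M - M') \<noteq> 2"
proof -
  have v': "v \<in> verts G" "semis G \<inter> incident_edges G v \<noteq> {}" using v by (auto simp: unsaturated_def)
  have "x \<in> M" if x: "x \<in> incident_edges G v" "x \<in> links G" for x
    using unsaturated_iff[OF G M v' x(2,1)] v by blast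
  then have "incident_edges G v \<inter> links G - M - M' = {}" by blast
  then show ?thesis by (metis card.empty zero_neq_numeral)
qed

section \<open>Graphs without bridges and triangles\<close>

text \<open>With a semi-edge this is \<open>5 * d <= n + 3 * (b - 2)\<close>, written without
  subtraction. For \<open>b = 0\<close> the same formula would already fail on four vertices, so
  only \<open>5 * d <= n\<close> is asked; a graph glued at a bridge satisfies the stronger form
  anyway.\<close>

definition defect_bound :: "('v, 'e) multigraph \<Rightarrow> nat \<Rightarrow> bool" where
  "defect_bound G d \<longleftrightarrow> (if semis G = {} then 5 * d \<le> card (verts G)
     else 5 * d + 6 \<le> card (verts G) + 3 * card (semis G))"

lemma defect_bound_mono: "defect_bound G d \<Longrightarrow> d' \<le> d \<Longrightarrow> defect_bound G d'"
  by (auto simp: defect_bound_def split: if_splits)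

lemma base_coloring:
  fixes G :: "('v, 'e) multigraph"
  assumes G: "precubic G" "semi_sparse G" "bridgeless G"
    and tri: "\<not> has_triangle G \<or> card (verts G) = 3"
  shows "\<exists>f. palette_coloring G f \<and> defect_bound G (card (defects G f))"
proof -
  note sp = precubic_edges[OF G(1)]
  define n where "n = card (verts G)"
  define b where "b = card (semis G)"
  have fV: "finite (verts G)" using G by (auto simp: precubic_def)
  define X where "X = {v \<in> verts G. semis G \<inter> incident_edges G v \<noteq> {}}"
  have X: "X \<subseteq> verts G" "card X = b" "finite X"
    using card_verts_with_semi[OF G(1,2)] fV by (auto simp: X_def b_def)
  have par: "even (n + b)" using even_verts_semis[OF G(1)] by (simp add: n_def b_def)
  have nb: "b \<le> n" using X fV card_mono unfolding n_def by metis
  have unsX: "unsaturated G M \<subseteq> X" for M by (auto simp: unsaturated_def X_def)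
  have unsV: "unsaturated G M \<subseteq> verts G" for M by (auto simp: unsaturated_def)
  have finu: "finite (unsaturated G M)" for M using unsV fV finite_subset by blast
  have uns_iff: "v \<in> unsaturated G M \<longleftrightarrow> e \<in> M"
    if "quasi_matching G M" "v \<in> X" "e \<in> links G" "e \<in> incident_edges G v" for M v e
    using unsaturated_iff[OF G(1) that(1) _ _ that(3,4)] that(2) by (auto simp: X_def)
  have Xlink: "\<exists>e. e \<in> links G \<and> e \<in> incident_edges G x" if "x \<in> X" for x
  proof -
    have x: "x \<in> verts G" using that by (simp add: X_def)
    have "card (semis G \<inter> incident_edges G x) \<le> 1" "card (incident_edges G x) = 3"
      using x G by (auto simp: semi_sparse_def precubic_def)
    then have "\<not> incident_edges G x \<subseteq> semis G" by (auto simp: Int_absorb1)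
    then show ?thesis using sp(1) by (auto simp: incident_edges_def)
  qed
  text \<open>Each vertex of \<open>Z\<close> lies on none of the defective cycles.\<close>
  have finish: ?thesis
    if M: "quasi_matching G M" "quasi_matching G M'"
      and Z: "Z \<subseteq> verts G"
        "\<And>v D. v \<in> Z \<Longrightarrow> (\<And>u. u \<in> D \<Longrightarrow> card (incident_edges G u \<inter> links G - M - M') = 2) \<Longrightarrow>
          (\<And>u e. u \<in> D \<Longrightarrow> e \<in> incident_edges G u \<inter> links G - M - M' \<Longrightarrow> ends G e \<subseteq> D) \<Longrightarrow> v \<notin> D"
      and bound: "\<And>k. 3 * k + card Z \<le> n \<Longrightarrow> n \<noteq> 3 \<Longrightarrow> 5 * k + card Z \<le> n \<Longrightarrow>
         defect_bound G (card (unsaturated G M \<union> unsaturated G M') + k)"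
        "\<And>k. n = 3 \<Longrightarrow> 3 * k + card Z \<le> n \<Longrightarrow>
         defect_bound G (card (unsaturated G M \<union> unsaturated G M') + k)"
    for M M' Z
  proof -
    obtain f k D where f: "palette_coloring G f"
      "card (defects G f) \<le> card (unsaturated G M \<union> unsaturated G M') + k"
      "D \<subseteq> verts G" "3 * k \<le> card D" "\<not> has_triangle G \<Longrightarrow> 5 * k \<le> card D"
      "\<And>u. u \<in> D \<Longrightarrow> card (incident_edges G u \<inter> links G - M - M') = 2"
      "\<And>u e. u \<in> D \<Longrightarrow> e \<in> incident_edges G u \<inter> links G - M - M' \<Longrightarrow> ends G e \<subseteq> D"
      by (rule quasi_matching_pair_coloring[OF G(1,2) M]) blast
    have "v \<notin> D" if "v \<in> Z" for v by (rule Z(2)[OF that f(6,7)])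
    then have "D \<inter> Z = {}" by blast
    then have "card D + card Z = card (D \<union> Z)"
      using f(3) Z(1) fV by (intro card_Un_disjoint[symmetric]) (auto intro: finite_subset)
    also have "\<dots> \<le> n" unfolding n_def using f(3) Z(1) fV by (intro card_mono) auto
    finally have DZ: "card D + card Z \<le> n" .
    have "defect_bound G (card (unsaturated G M \<union> unsaturated G M') + k)"
    proof (cases "n = 3")
      case True
      then show ?thesis using bound(2)[of k] DZ f(4) by linarith
    next
      case False
      then have "5 * k \<le> card D" using f(5) tri by (simp add: n_def)
      then show ?thesis using bound(1)[of k] DZ f(4) False by linarith
    qed
    then show ?thesis using f(1,2) defect_bound_mono by blast
  qed
  have finish1: ?thesis
    if M: "quasi_matching G M"
      and bound: "\<And>k. n \<noteq> 3 \<Longrightarrow> 5 * k + card (unsaturated G M) \<le> n \<Longrightarrow> defect_bound G (card (unsaturated G M) + k)"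
        "\<And>k. n = 3 \<Longrightarrow> 3 * k + card (unsaturated G M) \<le> n \<Longrightarrow> defect_bound G (card (unsaturated G M) + k)"
    for M
  proof (rule finish[OF M M, of "unsaturated G M"])
    show "v \<notin> D" if "v \<in> unsaturated G M"
      "\<And>u. u \<in> D \<Longrightarrow> card (incident_edges G u \<inter> links G - M - M) = 2" for v D
      using unsaturated_degree[OF G(1) M that(1), of M] that(2) by blast
  qed (use unsV bound in auto)
  have empty_iff: "semis G = {} \<longleftrightarrow> b = 0" using sp(4) by (simp add: b_def)
  have db: "defect_bound G d \<longleftrightarrow> (if b = 0 then 5 * d \<le> n else 5 * d + 6 \<le> n + 3 * b)" for d
    by (simp add: defect_bound_def empty_iff n_def b_def)
  obtain M where M: "quasi_matching G M" "3 * card (unsaturated G M) \<le> b"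
    by (rule light_quasi_matching_unsaturated[OF G, of "{}" 1]) (auto simp: b_def)
  consider "b = 0 \<or> b = 2 \<or> b \<ge> 4" | "b = 1" | "b = 3" by linarith
  then show ?thesis
  proof cases
    case 1
    show ?thesis
    proof (rule finish1[OF M(1)])
      fix k
      show "defect_bound G (card (unsaturated G M) + k)" if "5 * k + card (unsaturated G M) \<le> n"
        using 1
      proof (elim disjE)
        \<comment> \<open>Here \<open>5 * (u + k) <= n + 4 * u\<close> and
          \<open>3 * u <= b\<close>; the surplus \<open>4 * b / 3\<close> is at most
          \<open>3 * b - 6\<close> from \<open>b = 4\<close> on.\<close>
        assume "b \<ge> 4"
        then show ?thesis using that M(2) unfolding db by simp
      next
        assume b: "b = 2"
        then have "card (unsaturated G M) = 0" using M(2) by linarith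
        then show ?thesis using that b unfolding db by simp
      qed (use that M(2) in \<open>simp add: db\<close>)
      have "n \<noteq> 3" using 1 par nb by auto
      then show "defect_bound G (card (unsaturated G M) + k)" if "n = 3" using that by simp
    qed
  next
    case 2
    \<comment> \<open>One semi-edge requires \<open>5 * k <= n - 3\<close>. The three vertices kept
      off the defective cycles will be \<open>x\<close>, a neighbour \<open>a\<close> of it, and a
      neighbour \<open>y\<close> of \<open>a\<close>.\<close>
    obtain x where x: "X = {x}" using X(2) 2 by (metis card_1_singletonE)
    have xV: "x \<in> verts G" using x X by auto
    have "card (unsaturated G M) = 0" using M(2) 2 by linarith
    then have u0: "unsaturated G M = {}" using finu by simp
    obtain xa where xa: "xa \<in> links G" "xa \<in> incident_edges G x" using Xlink x by blast
    have "card (ends G xa) = 2" "x \<in> ends G xa" using xa by (auto simp: links_def incident_edges_def)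
    then obtain a where a: "a \<noteq> x" "ends G xa = {x, a}" by (metis card2_other)
    have aV: "a \<in> verts G" using a xa G(1) by (auto simp: links_def precubic_def)
    have aX: "a \<notin> X" "semis G \<inter> incident_edges G a = {}" using a x aV by (auto simp: X_def)
    have lk: "incident_edges G a \<subseteq> links G" using aX(2) sp(1) by (auto simp: incident_edges_def)
    have xaM: "xa \<notin> M" using uns_iff[OF M(1) _ xa] x u0 by auto
    obtain m1 where m1: "M \<inter> incident_edges G a = {m1}"
      by (rule quasi_matching_cases[OF G(1) M(1) aV]) (use aX in auto)
    \<comment> \<open>A third of two edges is less than one edge, so \<open>M'\<close> avoids both.
      Avoiding \<open>xa\<close> keeps \<open>x\<close> saturated; avoiding \<open>m1\<close> makes
      \<open>M\<close> and \<open>M'\<close> differ at \<open>a\<close>.\<close>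
    have "{xa, m1} \<subseteq> links G" using xa m1 lk by blast
    then obtain M' where M': "quasi_matching G M'" "3 * card (M' \<inter> {xa, m1}) \<le> card {xa, m1}"
      by (rule light_quasi_matching_unsaturated[OF G, of "{xa, m1}" 0]) auto
    have "card {xa, m1} \<le> 2" by (simp add: card_insert_if)
    then have "card (M' \<inter> {xa, m1}) = 0" using M'(2) by linarith
    then have av: "xa \<notin> M'" "m1 \<notin> M'" by auto
    have u0': "unsaturated G M' = {}" using uns_iff[OF M'(1) _ xa] x av unsX[of M'] by auto
    obtain m2 where m2: "M' \<inter> incident_edges G a = {m2}"
      by (rule quasi_matching_cases[OF G(1) M'(1) aV]) (use aX in auto)
    have m2': "m2 \<in> links G" "m2 \<in> incident_edges G a" "m2 \<in> M'" using m2 lk by auto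
    have m2M: "m2 \<notin> M" using m1 m2' av by auto
    have "card (ends G m2) = 2" "a \<in> ends G m2" using m2' by (auto simp: links_def incident_edges_def)
    then obtain y where y: "y \<noteq> a" "ends G m2 = {a, y}" by (metis card2_other)
    have yV: "y \<in> verts G" using y m2' G(1) by (auto simp: links_def precubic_def)
    have yI: "m2 \<in> incident_edges G y" using y m2' by (auto simp: incident_edges_def links_def)
    have yx: "y \<noteq> x"
    proof
      assume "y = x"
      then have "x \<in> unsaturated G M'" using uns_iff[OF M'(1) _ m2'(1)] x yI m2' by auto
      then show False using u0' by simp
    qed
    have c3: "card {x, a, y} = 3" using a(1) y(1) yx by auto
    show ?thesis
    proof (rule finish[OF M(1) M'(1), of "{x, a, y}"])
      show "{x, a, y} \<subseteq> verts G" using xV aV yV by simp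
      fix v D assume v: "v \<in> {x, a, y}"
        and D: "\<And>u. u \<in> D \<Longrightarrow> card (incident_edges G u \<inter> links G - M - M') = 2"
          "\<And>u e. u \<in> D \<Longrightarrow> e \<in> incident_edges G u \<inter> links G - M - M' \<Longrightarrow> ends G e \<subseteq> D"
      have "a \<notin> D" using mismatch_degree[OF G(1) M(1) M'(1) aV m2'(2,1)] m2' m2M D(1) by blast
      moreover have "y \<notin> D" using mismatch_degree[OF G(1) M(1) M'(1) yV yI m2'(1)] m2' m2M D(1) by blast
      \<comment> \<open>The edge \<open>xa\<close> is outside both quasi-matchings, so a defective
        cycle through \<open>x\<close> would continue to \<open>a\<close>.\<close>
      moreover have "x \<notin> D" using D(2)[of x xa] xa xaM av \<open>a \<notin> D\<close> a by blast
      ultimately show "v \<notin> D" using v by blast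
    qed (use c3 u0 u0' 2 in \<open>auto simp: db\<close>)
  next
    case 3
    have n_odd: "odd n" "n \<ge> 3" using par nb 3 by auto
    \<comment> \<open>Now \<open>5 * d <= n + 3\<close> is required. One unsaturated vertex gives
      \<open>5 * k <= n - 1\<close> and hence only \<open>5 * d <= n + 4\<close>: a single unit is
      missing, unless all vertices can be saturated.\<close>
    show ?thesis
    proof (cases "\<exists>M. quasi_matching G M \<and> unsaturated G M = {}")
      case True
      then obtain M where "quasi_matching G M" "unsaturated G M = {}" by blast
      then show ?thesis using 3 by (intro finish1) (auto simp: db)
    next
      case False
      have one: "\<exists>v. unsaturated G M = {v}" if "quasi_matching G M" "card (unsaturated G M) \<le> 1" for M
      proof -
        have "card (unsaturated G M) \<noteq> 0" using False that finu by auto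
        then show ?thesis using that(2) by (metis card_1_singletonE le_neq_implies_less less_one)
      qed
      obtain x1 where x1: "unsaturated G M = {x1}" using one[OF M(1)] M(2) 3 by auto
      have x1X: "x1 \<in> X" using unsX[of M] x1 by auto
      show ?thesis
      proof (cases "n \<le> 5")
        case True
        have cu: "card (unsaturated G M) = 1" using x1 by simp
        show ?thesis
        proof (rule finish1[OF M(1)])
          fix k
          show "defect_bound G (card (unsaturated G M) + k)" if "5 * k + card (unsaturated G M) \<le> n"
          proof -
            have "k = 0" using that True cu by linarith
            then show ?thesis using n_odd 3 cu by (simp add: db)
          qed
          show "defect_bound G (card (unsaturated G M) + k)" if "3 * k + card (unsaturated G M) \<le> n" "n = 3"
          proof -
            have "k = 0" using that cu by linarith
            then show ?thesis using n_odd 3 cu by (simp add: db)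
          qed
        qed
      next
        case large: False
        then have n7: "n \<ge> 7" using n_odd by presburger
        obtain l1 where l1: "l1 \<in> links G" "l1 \<in> incident_edges G x1" using Xlink[OF x1X] by blast
        \<comment> \<open>For \<open>r = 10\<close> the bound reads
          \<open>30 * u + 3 * c <= 31\<close>, with \<open>c\<close> counting whether
          \<open>l1\<close> is used. So \<open>u <= 1\<close>, and \<open>u = 1\<close> leaves no
          room for \<open>l1\<close>; the unsaturated vertex of \<open>N\<close> then differs from
          \<open>x1\<close>.\<close>
        obtain N where N: "quasi_matching G N"
          "3 * (10 * card (unsaturated G N) + card (N \<inter> {l1})) \<le> 10 * b + card {l1}"
          using light_quasi_matching_unsaturated[OF G, of "{l1}" 10] l1(1) unfolding b_def by blast
        then have "card (unsaturated G N) \<le> 1" using 3 by simp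
        then obtain x2 where x2: "unsaturated G N = {x2}" using one[OF N(1)] by blast
        then have "l1 \<notin> N" using N(2) 3 by (cases "l1 \<in> N") auto
        then have x12: "x1 \<noteq> x2" using uns_iff[OF N(1) x1X l1] x2 by auto
        have x2X: "x2 \<in> X" using unsX[of N] x2 by auto
        show ?thesis
        proof (cases "M \<inter> N \<inter> links G = {}")
          case True
          \<comment> \<open>Being disjoint on links, \<open>M\<close> and \<open>N\<close> differ at
            every vertex without a semi-edge, and \<open>x1\<close>, \<open>x2\<close> are
            unsaturated. A single vertex remains for cycles, so \<open>k = 0\<close>. The two
            defects need \<open>10 <= n + 3\<close>, which is the reason for
            \<open>n >= 7\<close>.\<close>
          show ?thesis
          proof (rule finish[OF M(1) N(1), of "(verts G - X) \<union> {x1, x2}"])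
            show "verts G - X \<union> {x1, x2} \<subseteq> verts G" using x1X x2X X by auto
            fix v D assume v: "v \<in> verts G - X \<union> {x1, x2}"
              and D: "\<And>u. u \<in> D \<Longrightarrow> card (incident_edges G u \<inter> links G - M - N) = 2"
            show "v \<notin> D"
            proof (cases "v \<in> X")
              case False
              then have vV: "v \<in> verts G" and vs: "semis G \<inter> incident_edges G v = {}"
                using v x1X x2X by (auto simp: X_def)
              obtain m where m: "M \<inter> incident_edges G v = {m}"
                by (rule quasi_matching_cases[OF G(1) M(1) vV]) (use vs in auto)
              have "m \<in> incident_edges G v" "m \<in> M" "m \<in> links G"
                using m vs sp(1) by (auto simp: incident_edges_def)
              moreover have "m \<notin> N" using calculation True by blast
              ultimately show ?thesis using mismatch_degree[OF G(1) M(1) N(1) vV, of m] D by blast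
            next
              case True
              then consider "v = x1" | "v = x2" using v by auto
              then show ?thesis
              proof cases
                case 1
                then show ?thesis using unsaturated_degree[OF G(1) M(1), of v N] x1 D by blast
              next
                case 2
                have "incident_edges G v \<inter> links G - M - N = incident_edges G v \<inter> links G - N - M" by blast
                then show ?thesis using unsaturated_degree[OF G(1) N(1), of v M] x2 2 D by (metis singletonI)
              qed
            qed
          next
            have "card (verts G - X \<union> {x1, x2}) = card (verts G - X) + card {x1, x2}"
              using fV x1X x2X by (intro card_Un_disjoint) auto
            also have "\<dots> = n - 3 + 2"
              using X fV 3 x12 by (simp add: card_Diff_subset n_def)
            finally have cZ: "card (verts G - X \<union> {x1, x2}) = n - 1" using n7 by simp
            have "unsaturated G M \<union> unsaturated G N = {x1, x2}" using x1 x2 by auto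
            then have cu: "card (unsaturated G M \<union> unsaturated G N) = 2" using x12 by simp
            fix k assume "3 * k + card (verts G - X \<union> {x1, x2}) \<le> n"
            then have "k = 0" using cZ n7 by simp
            then show "defect_bound G (card (unsaturated G M \<union> unsaturated G N) + k)"
              "defect_bound G (card (unsaturated G M \<union> unsaturated G N) + k)"
              using cu n7 3 by (auto simp: db)
          qed
        next
          case False
          then obtain e where e: "e \<in> M" "e \<in> N" "e \<in> links G" by blast
          have "card (X - {x1, x2}) = 1" using X 3 x1X x2X x12 by (simp add: card_Diff_subset)
          then obtain x3 where x3: "X - {x1, x2} = {x3}" by (metis card_1_singletonE)
          obtain l3 where l3: "l3 \<in> links G" "l3 \<in> incident_edges G x3" using Xlink x3 by blast
          \<comment> \<open>Now \<open>30 * u + 3 * c <= 32\<close> gives \<open>u <= 1\<close>,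
            hence \<open>u = 1\<close> in the present case, and both edges are avoided. Without
            \<open>l3\<close> the vertex \<open>x3\<close> is saturated, so the unsaturated vertex
            of \<open>N'\<close> is the one of \<open>M\<close> or of \<open>N\<close>. Either of
            these contains \<open>e\<close>, which \<open>N'\<close> avoids.\<close>
          have S: "{e, l3} \<subseteq> links G" using e l3 by simp
          obtain N' where N': "quasi_matching G N'"
            "3 * (10 * card (unsaturated G N') + card (N' \<inter> {e, l3})) \<le> 10 * b + card {e, l3}"
            using light_quasi_matching_unsaturated[OF G S, of 10] unfolding b_def by blast
          have c2: "card {e, l3} \<le> 2" by (simp add: card_insert_if)
          have le: "30 * card (unsaturated G N') + 3 * card (N' \<inter> {e, l3}) \<le> 32"
            using N'(2) 3 c2 by (simp add: algebra_simps)
          then have "card (unsaturated G N') \<le> 1" by linarith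
          then obtain z where z: "unsaturated G N' = {z}" using one[OF N'(1)] by blast
          then have "card (unsaturated G N') = 1" by simp
          then have "card (N' \<inter> {e, l3}) = 0" using le by linarith
          then have av: "e \<notin> N'" "l3 \<notin> N'" by auto
          have "x3 \<notin> unsaturated G N'" using uns_iff[OF N'(1) _ l3] x3 av by blast
          then have "z \<noteq> x3" using z by simp
          have zX: "z \<in> X" using unsX[of N'] z by auto
          have z12: "z \<in> {x1, x2}"
          proof (rule ccontr)
            assume "z \<notin> {x1, x2}"
            then have "z \<in> X - {x1, x2}" using zX by simp
            then show False unfolding x3 using \<open>z \<noteq> x3\<close> by simp
          qed
          obtain L where L: "quasi_matching G L" "unsaturated G L = {z}" "e \<in> L"
          proof (cases "z = x1")
            case True
            then show thesis using that[of M] M(1) x1 e(1) by simp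
          next
            case False
            then show thesis using that[of N] z12 N(1) x2 e(2) by simp
          qed
          have e2: "card (ends G e) = 2" "ends G e \<subseteq> verts G"
            using e(3) G(1) by (auto simp: links_def precubic_def)
          have ei: "e \<in> incident_edges G u" if "u \<in> ends G e" for u
            using that e(3) by (auto simp: links_def incident_edges_def)
          \<comment> \<open>An unsaturated vertex has all its links in \<open>N'\<close>, and
            \<open>e\<close> is not there. So \<open>z\<close> and the ends of \<open>e\<close> are
            three vertices off the cycles, while only \<open>z\<close> is unsaturated: the missing
            unit is recovered.\<close>
          have "z \<notin> ends G e" using uns_iff[OF N'(1) zX e(3)] ei z av by auto
          then have cZ: "card (insert z (ends G e)) = 3"
            using e2 fV finite_subset[OF e2(2)] by simp
          show ?thesis
          proof (rule finish[OF L(1) N'(1), of "insert z (ends G e)"])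
            show "insert z (ends G e) \<subseteq> verts G" using e2 zX X by auto
            fix v D assume v: "v \<in> insert z (ends G e)"
              and D: "\<And>u. u \<in> D \<Longrightarrow> card (incident_edges G u \<inter> links G - L - N') = 2"
            show "v \<notin> D"
            proof (cases "v = z")
              case True
              then show ?thesis using unsaturated_degree[OF G(1) L(1), of v N'] L(2) D by blast
            next
              case False
              then have "v \<in> ends G e" using v by simp
              then show ?thesis
                using mismatch_degree[OF G(1) L(1) N'(1) _ ei e(3)] e2(2) L(3) av D by blast
            qed
          next
            have "unsaturated G L \<union> unsaturated G N' = {z}" using L z by simp
            then have cu: "card (unsaturated G L \<union> unsaturated G N') = 1" by simp
            fix k
            show "defect_bound G (card (unsaturated G L \<union> unsaturated G N') + k)"
              if "5 * k + card (insert z (ends G e)) \<le> n"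
              using that cu cZ 3 n7 by (auto simp: db)
            show "defect_bound G (card (unsaturated G L \<union> unsaturated G N') + k)" if "n = 3"
              using that n7 by simp
          qed
        qed
      qed
    qed
  qed
qed

section \<open>Contracting triangles\<close>

text \<open>Connectivity is phrased by cuts because contraction and restriction are controlled
  through the cuts that they preserve.\<close>

definition cut_connected :: "('v, 'e) multigraph \<Rightarrow> bool" where
  "cut_connected G \<longleftrightarrow> (\<forall>A\<subseteq>verts G. A \<noteq> {} \<longrightarrow> A \<noteq> verts G \<longrightarrow> edge_cut G A \<noteq> {})"

section \<open>Extending a colouring from a contracted vertex to a triangle\<close>

lemma card_star: "S \<in> stars \<Longrightarrow> card S = 3"
  by (auto simp: stars_def)

lemma star_completion:
  assumes "\<alpha> \<in> \<Union> stars"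
  obtains s t where "{\<alpha>, s, t} \<in> stars"
proof -
  obtain S where S: "S \<in> stars" "\<alpha> \<in> S" using assms by blast
  then have "card (S - {\<alpha>}) = 2" using card_star by (simp add: card_Diff_singleton)
  then obtain s t where "S - {\<alpha>} = {s, t}" by (meson card_2_iff)
  then have "S = {\<alpha>, s, t}" using S(2) by blast
  then show thesis using that S(1) by blast
qed

text \<open>Here \<open>\<alpha>, \<beta>, \<gamma>\<close> are the colours of the edges leaving a triangle at its corners \<open>a, b, c\<close>,
  and \<open>p, q, r\<close> become the colours of \<open>ab, bc, ac\<close>.\<close>

lemma triangle_extension:
  assumes pal: "{\<alpha>, \<beta>, \<gamma>} \<subseteq> \<Union> stars"
    and adm: "{\<alpha>, \<beta>, \<gamma>} \<in> stars \<or> \<alpha> = \<beta> \<or> \<alpha> = \<gamma> \<or> \<beta> = \<gamma>"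
  obtains p q r where "{p, q, r} \<subseteq> \<Union> stars"
    "{\<alpha>, \<beta>, \<gamma>} \<in> stars \<Longrightarrow> {\<alpha>, p, r} \<in> stars \<and> {\<beta>, p, q} \<in> stars \<and> {\<gamma>, q, r} \<in> stars"
    "{\<alpha>, p, r} \<in> stars \<and> {\<beta>, p, q} \<in> stars \<and> ({\<gamma>, q, r} \<in> stars \<or> q = r) \<or>
     {\<alpha>, p, r} \<in> stars \<and> {\<gamma>, q, r} \<in> stars \<and> p = q \<or>
     {\<beta>, p, q} \<in> stars \<and> {\<gamma>, q, r} \<in> stars \<and> p = r"
proof (cases "{\<alpha>, \<beta>, \<gamma>} \<in> stars")
  case True
  \<comment> \<open>Each side of the triangle takes the colour that leaves at the opposite corner,
    so all three corners see the same star.\<close>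
  then show thesis using pal by (intro that[of \<gamma> \<alpha> \<beta>]) (auto simp: insert_commute)
next
  case False
  obtain s t where st: "{\<alpha>, s, t} \<in> stars" using star_completion pal by blast
  obtain s' t' where st': "{\<beta>, s', t'} \<in> stars" using star_completion pal by blast
  have pal': "{s, t, s', t'} \<subseteq> \<Union> stars" using st st' by blast
  consider "\<alpha> = \<beta>" | "\<alpha> = \<gamma>" | "\<beta> = \<gamma>" using adm False by blast
  then show thesis
  proof cases
    case 1
    \<comment> \<open>The two corners with equal outer colours share one star: the side between them
      gets \<open>s\<close>, the other two sides get \<open>t\<close>, and the third corner sees
      \<open>t\<close> twice. The other cases are the same up to symmetry.\<close>
    show thesis by (rule that[of s t t]) (use False st 1 pal' in \<open>simp_all add: insert_commute\<close>)
  next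
    case 2
    show thesis by (rule that[of t t s]) (use False st 2 pal' in \<open>simp_all add: insert_commute\<close>)
  next
    case 3
    show thesis by (rule that[of t' s' t']) (use False st' 3 pal' in \<open>simp_all add: insert_commute\<close>)
  qed
qed

text \<open>Fewer vertices with the same semi-edges make the bound for \<open>G'\<close> the
  stronger one, so it is enough that expanding the triangle adds no defect. Once triangles are gone,
  the shortest defective cycle has five vertices instead of three.\<close>

lemma triangle_contraction:
  fixes G :: "('v, 'e) multigraph"
  assumes G: "precubic G" "semi_sparse G" "bridgeless G" "cut_connected G"
    and tri: "has_triangle G" and n: "card (verts G) \<noteq> 3"
  obtains G' :: "('v, 'e) multigraph" where
    "precubic G'" "semi_sparse G'" "bridgeless G'" "cut_connected G'"
    "card (verts G') < card (verts G)" "semis G' = semis G"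
    "\<And>f'. palette_coloring G' f' \<Longrightarrow> \<exists>f. palette_coloring G f \<and> card (defects G f) \<le> card (defects G' f')"
proof -
  note sp = precubic_edges[OF G(1)]
  have fV: "finite (verts G)" and fE: "finite (edges G)" using G by (auto simp: precubic_def)
  obtain a b c eab ebc eac where T0: "card {a, b, c} = 3 \<and> {eab, ebc, eac} \<subseteq> edges G \<and>
      ends G eab = {a, b} \<and> ends G ebc = {b, c} \<and> ends G eac = {a, c}"
    using tri unfolding has_triangle_def by (elim exE)
  have T: "card {a, b, c} = 3" "{eab, ebc, eac} \<subseteq> edges G"
    "ends G eab = {a, b}" "ends G ebc = {b, c}" "ends G eac = {a, c}"
    using T0 by blast+
  have abc: "a \<noteq> b" "a \<noteq> c" "b \<noteq> c" using T(1) by (auto simp: card_insert_if split: if_splits)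
  have ev: "ends G e \<subseteq> verts G" if "e \<in> edges G" for e using that G(1) by (auto simp: precubic_def)
  have TV: "{a, b, c} \<subseteq> verts G" using ev[of eab] ev[of ebc] T(2-5) by auto
  have ediff: "eab \<noteq> ebc" "eab \<noteq> eac" "ebc \<noteq> eac" using T(3-5) abc by (auto simp: doubleton_eq_iff)
  have third: "\<exists>x. incident_edges G v = {d, d', x} \<and> x \<notin> {d, d'}"
    if "v \<in> verts G" "d \<in> incident_edges G v" "d' \<in> incident_edges G v" "d \<noteq> d'" for v d d'
  proof -
    have "card (incident_edges G v) = 3" using that G(1) by (auto simp: precubic_def)
    then have "card (incident_edges G v - {d, d'}) = 1" using that by (simp add: card_Diff_subset)
    then obtain x where "incident_edges G v - {d, d'} = {x}" by (metis card_1_singletonE)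
    then have "incident_edges G v = {d, d', x}" "x \<notin> {d, d'}" using that by blast+
    then show ?thesis by blast
  qed
  have inT: "eab \<in> incident_edges G a" "eab \<in> incident_edges G b" "ebc \<in> incident_edges G b"
    "ebc \<in> incident_edges G c" "eac \<in> incident_edges G a" "eac \<in> incident_edges G c"
    using T(2-5) by (auto simp: incident_edges_def)
  obtain xa where xa: "incident_edges G a = {eab, eac, xa}" "xa \<notin> {eab, eac}"
    using third[of a eab eac] TV inT ediff by blast
  obtain xb where xb: "incident_edges G b = {eab, ebc, xb}" "xb \<notin> {eab, ebc}"
    using third[of b eab ebc] TV inT ediff by blast
  obtain xc where xc: "incident_edges G c = {ebc, eac, xc}" "xc \<notin> {ebc, eac}"
    using third[of c ebc eac] TV inT ediff by blast
  have xinc: "xa \<in> edges G" "a \<in> ends G xa" "xb \<in> edges G" "b \<in> ends G xb" "xc \<in> edges G" "c \<in> ends G xc"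
    using xa(1) xb(1) xc(1) by (auto simp: incident_edges_def)
  have xtri: "xa \<notin> {eab, ebc, eac}" "xb \<notin> {eab, ebc, eac}" "xc \<notin> {eab, ebc, eac}"
    using xa(2) xb(2) xc(2) xinc T(2-5) abc by auto
  define C where "C = edge_cut G {a, b, c}"
  have "{a, b, c} \<noteq> verts G" using n T(1) by auto
  then have "C \<noteq> {}" using G(4) TV unfolding cut_connected_def C_def by blast
  moreover have "card C \<noteq> 1" using G(3) TV by (auto simp: bridgeless_def C_def)
  moreover have fC: "finite C" using fE by (simp add: C_def finite_cut)
  \<comment> \<open>At least two edges leave the triangle: the cut is non-empty by connectivity, as
    there are further vertices, and it is not a bridge. Hence no side of the triangle is doubled, so
    \<open>xa\<close>, \<open>xb\<close>, \<open>xc\<close> are distinct, and at most one of them is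
    a semi-edge at the contracted vertex.\<close>
  ultimately have C2: "card C \<ge> 2" by (metis One_nat_def card_0_eq le_antisym not_less_eq_eq numeral_2_eq_2 le_zero_eq)
  have Csub: "C \<subseteq> {xa, xb, xc}"
  proof
    fix e assume e: "e \<in> C"
    then have "e \<in> incident_edges G a \<union> incident_edges G b \<union> incident_edges G c"
      by (auto simp: C_def edge_cut_def incident_edges_def)
    moreover have "e \<notin> {eab, ebc, eac}" using e T(2-5) by (auto simp: C_def edge_cut_def)
    ultimately show "e \<in> {xa, xb, xc}" using xa xb xc by auto
  qed
  have two: "\<not> C \<subseteq> {x}" for x
  proof
    assume "C \<subseteq> {x}"
    then have "card C \<le> card {x}" by (intro card_mono) auto
    then show False using C2 by simp
  qed
  have inner: "ends G e = {u, v} \<Longrightarrow> {u, v} \<subseteq> {a, b, c} \<Longrightarrow> e \<notin> C" for e u v by (auto simp: C_def edge_cut_def)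
  have ends_pair: "ends G e = {u, v}" if "e \<in> edges G" "u \<in> ends G e" "v \<in> ends G e" "u \<noteq> v" for e u v
  proof -
    have "card (ends G e) = 1 \<or> card (ends G e) = 2" using that(1) G(1) by (auto simp: precubic_def)
    then have "card (ends G e) = 2" using that by (auto simp: card_1_singleton_iff)
    then show ?thesis using that(2-4) by (metis card2_other insertE singletonD)
  qed
  have xdiff: "xa \<noteq> xb" "xa \<noteq> xc" "xb \<noteq> xc"
  proof -
    show "xa \<noteq> xb"
    proof
      assume "xa = xb"
      then have "xa \<notin> C" "xb \<notin> C" using ends_pair[of xa a b] xinc abc inner[of xa a b] by auto
      then show False using Csub two[of xc] by auto
    qed
    show "xa \<noteq> xc"
    proof
      assume "xa = xc"
      then have "xa \<notin> C" "xc \<notin> C" using ends_pair[of xa a c] xinc abc inner[of xa a c] by auto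
      then show False using Csub two[of xb] by auto
    qed
    show "xb \<noteq> xc"
    proof
      assume "xb = xc"
      then have "xb \<notin> C" "xc \<notin> C" using ends_pair[of xb b c] xinc abc inner[of xb b c] by auto
      then show False using Csub two[of xa] by auto
    qed
  qed
  have semiC: "e \<notin> C" if "e \<in> semis G" for e
    using that by (auto simp: semis_def C_def edge_cut_def card_1_singleton_iff)
  define h where "h v = (if v \<in> {b, c} then a else v)" for v
  define G' :: "('v, 'e) multigraph" where
    "G' = \<lparr>verts = verts G - {b, c}, edges = edges G - {eab, ebc, eac}, ends = \<lambda>e. h ` ends G e\<rparr>"
  have VG': "verts G' = verts G - {b, c}" and EG': "edges G' = edges G - {eab, ebc, eac}"
    and endsG': "ends G' e = h ` ends G e" for e by (simp_all add: G'_def)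
  have meet: "u \<notin> {a, b, c} \<or> v \<notin> {a, b, c}"
    if e: "e \<in> edges G'" "u \<in> ends G e" "v \<in> ends G e" "u \<noteq> v" for e u v
  proof (rule ccontr)
    assume uv: "\<not> (u \<notin> {a, b, c} \<or> v \<notin> {a, b, c})"
    have "e \<in> {xa, xb, xc}" "e \<notin> {eab, ebc, eac}" "e \<in> edges G"
      using e uv xa xb xc by (auto simp: EG' incident_edges_def)
    moreover have "e \<in> incident_edges G u" "e \<in> incident_edges G v"
      using e by (auto simp: EG' incident_edges_def)
    ultimately show False using uv e(4) xa(1) xb(1) xc(1) xdiff by auto
  qed
  have card_ends: "card (ends G' e) = card (ends G e)" if e: "e \<in> edges G'" for e
  proof -
    have "inj_on h (ends G e)"
    proof (rule inj_onI, rule ccontr)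
      fix u v assume uv: "u \<in> ends G e" "v \<in> ends G e" "h u = h v" "u \<noteq> v"
      then show False using meet[OF e uv(1,2,4)] by (auto simp: h_def split: if_splits)
    qed
    then show ?thesis by (simp add: endsG' card_image)
  qed
  have semi': "semis G' = semis G"
  proof -
    have "card (ends G e) = 2" if "e \<in> {eab, ebc, eac}" for e using that T(2-5) abc by auto
    then have tri: "e \<notin> semis G" if "e \<in> {eab, ebc, eac}" for e using that by (auto simp: semis_def)
    have "e \<in> semis G' \<longleftrightarrow> e \<in> semis G" for e
    proof (cases "e \<in> edges G'")
      case True
      then show ?thesis using card_ends[OF True] by (simp add: semis_def EG')
    next
      case False
      then show ?thesis using tri[of e] by (auto simp: semis_def EG')
    qed
    then show ?thesis by blast
  qed
  have inc_out: "incident_edges G' v = incident_edges G v" if v: "v \<in> verts G" "v \<notin> {a, b, c}" for v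
  proof -
    have "v \<in> ends G' e \<longleftrightarrow> v \<in> ends G e" for e using v by (auto simp: endsG' h_def image_iff)
    moreover have "e \<notin> {eab, ebc, eac}" if "v \<in> ends G e" for e using that v T(2-5) by auto
    ultimately show ?thesis by (auto simp: incident_edges_def EG')
  qed
  have inc_a: "incident_edges G' a = {xa, xb, xc}"
  proof -
    have "a \<in> ends G' e \<longleftrightarrow> ends G e \<inter> {a, b, c} \<noteq> {}" for e by (auto simp: endsG' h_def image_iff)
    then have "incident_edges G' a =
      (incident_edges G a \<union> incident_edges G b \<union> incident_edges G c) - {eab, ebc, eac}"
      by (auto simp: incident_edges_def EG')
    then show ?thesis using xa(1) xb(1) xc(1) xtri by auto
  qed
  have cuts: "\<exists>B\<subseteq>verts G. edge_cut G' A = edge_cut G B \<and> (A \<noteq> {} \<longrightarrow> B \<noteq> {}) \<and> (A \<noteq> verts G' \<longrightarrow> B \<noteq> verts G)"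
    if A: "A \<subseteq> verts G'" for A
  proof -
    define B where "B = {v \<in> verts G. h v \<in> A}"
    have "e \<in> edge_cut G' A \<longleftrightarrow> e \<in> edge_cut G B" for e
    proof (cases "e \<in> edges G'")
      case True
      then have "ends G e \<subseteq> verts G" "e \<in> edges G" using ev by (auto simp: EG')
      then show ?thesis using True by (auto simp: edge_cut_def endsG' B_def)
    next
      case False
      have "e \<notin> edge_cut G B"
      proof (cases "e \<in> {eab, ebc, eac}")
        case True
        then have "ends G e \<subseteq> {a, b, c}" using T(2-5) by auto
        then have "ends G e \<inter> B = {} \<or> ends G e \<subseteq> B" using TV by (auto simp: B_def h_def)
        then show ?thesis by (auto simp: edge_cut_def)
      qed (use False in \<open>auto simp: edge_cut_def EG'\<close>)
      then show ?thesis using False by (auto simp: edge_cut_def)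
    qed
    moreover have "B \<inter> verts G' = A" using A by (auto simp: B_def VG' h_def)
    moreover have "B \<subseteq> verts G" by (auto simp: B_def)
    ultimately show ?thesis using VG' by (intro exI[of _ B]) auto
  qed
  have pre': "precubic G'"
    unfolding precubic_def
  proof (intro conjI ballI)
    show "finite (verts G')" "finite (edges G')" using fV fE by (auto simp: VG' EG')
    show "ends G' e \<subseteq> verts G'" if "e \<in> edges G'" for e
      using that ev[of e] TV abc by (auto simp: EG' VG' endsG' h_def)
    show "card (ends G' e) = 1 \<or> card (ends G' e) = 2" if "e \<in> edges G'" for e
      using card_ends[OF that] that G(1) by (auto simp: EG' precubic_def)
    show "card (incident_edges G' v) = 3" if "v \<in> verts G'" for v
    proof (cases "v = a")
      case True
      then show ?thesis using inc_a xdiff by simp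
    next
      case False
      then have "v \<in> verts G" "v \<notin> {a, b, c}" using that by (auto simp: VG')
      then show ?thesis using inc_out G(1) by (simp add: precubic_def)
    qed
  qed
  have sparse': "semi_sparse G'"
    unfolding semi_sparse_def
  proof
    fix v assume v: "v \<in> verts G'"
    show "card (semis G' \<inter> incident_edges G' v) \<le> 1"
    proof (cases "v = a")
      case True
      have "semis G \<inter> {xa, xb, xc} \<subseteq> {xa, xb, xc} - C" using semiC by blast
      then have "card (semis G \<inter> {xa, xb, xc}) \<le> card ({xa, xb, xc} - C)" by (intro card_mono) auto
      also have "\<dots> = 3 - card C" using Csub fC xdiff by (simp add: card_Diff_subset)
      finally show ?thesis using True inc_a semi' C2 by simp
    next
      case False
      then have "v \<in> verts G" "v \<notin> {a, b, c}" using v by (auto simp: VG')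
      then show ?thesis using inc_out G(2) semi' by (simp add: semi_sparse_def)
    qed
  qed
  have bl': "bridgeless G'"
    unfolding bridgeless_def using cuts G(3) by (metis bridgeless_def)
  have con': "cut_connected G'"
    unfolding cut_connected_def using cuts G(4) by (metis cut_connected_def)
  have less': "card (verts G') < card (verts G)"
    using TV fV by (intro psubset_card_mono) (auto simp: VG')
  have ext: "\<exists>f. palette_coloring G f \<and> card (defects G f) \<le> card (defects G' f')"
    if f': "palette_coloring G' f'" for f'
  proof -
    have img: "f' ` incident_edges G' a = {f' xa, f' xb, f' xc}" by (simp add: inc_a)
    have aV: "a \<in> verts G'" using TV abc by (auto simp: VG')
    have "{xa, xb, xc} \<subseteq> edges G'" using xinc xtri by (auto simp: EG')
    then have pal: "{f' xa, f' xb, f' xc} \<subseteq> \<Union> stars" using f' by (auto simp: palette_coloring_def)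
    have adef: "a \<in> defects G' f' \<longleftrightarrow> {f' xa, f' xb, f' xc} \<notin> stars" using aV img by (simp add: defects_def)
    have adm: "{f' xa, f' xb, f' xc} \<in> stars \<or> f' xa = f' xb \<or> f' xa = f' xc \<or> f' xb = f' xc"
    proof (rule ccontr)
      assume *: "\<not> ?thesis"
      then have "inj_on f' (incident_edges G' a)" by (auto simp: inc_a)
      then show False using * f' adef by (auto simp: palette_coloring_def)
    qed
    obtain p q r where pqr: "{p, q, r} \<subseteq> \<Union> stars"
      "{f' xa, f' xb, f' xc} \<in> stars \<Longrightarrow> {f' xa, p, r} \<in> stars \<and> {f' xb, p, q} \<in> stars \<and> {f' xc, q, r} \<in> stars"
      "{f' xa, p, r} \<in> stars \<and> {f' xb, p, q} \<in> stars \<and> ({f' xc, q, r} \<in> stars \<or> q = r) \<or>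
       {f' xa, p, r} \<in> stars \<and> {f' xc, q, r} \<in> stars \<and> p = q \<or>
       {f' xb, p, q} \<in> stars \<and> {f' xc, q, r} \<in> stars \<and> p = r"
      by (rule triangle_extension[OF pal adm]) blast
    define f where "f = f'(eab := p, ebc := q, eac := r)"
    have fe: "f eab = p" "f ebc = q" "f eac = r" using ediff by (auto simp: f_def)
    have fx: "f e = f' e" if "e \<notin> {eab, ebc, eac}" for e using that by (simp add: f_def)
    have ia: "f ` incident_edges G a = {f' xa, p, r}" using fe fx[OF xtri(1)] by (auto simp: xa(1))
    have ib: "f ` incident_edges G b = {f' xb, p, q}" using fe fx[OF xtri(2)] by (auto simp: xb(1))
    have ic: "f ` incident_edges G c = {f' xc, q, r}" using fe fx[OF xtri(3)] by (auto simp: xc(1))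
    have na: "p = r \<Longrightarrow> \<not> inj_on f (incident_edges G a)" using fe ediff by (auto simp: xa(1) inj_on_def)
    have nb: "p = q \<Longrightarrow> \<not> inj_on f (incident_edges G b)" using fe ediff by (auto simp: xb(1) inj_on_def)
    have nc: "q = r \<Longrightarrow> \<not> inj_on f (incident_edges G c)" using fe ediff by (auto simp: xc(1) inj_on_def)
    \<comment> \<open>The corner \<open>t\<close> is the only one that may be defective; it inherits
      the defect of the contracted vertex \<open>a\<close>.\<close>
    obtain t where t: "\<forall>v\<in>{a, b, c} - {t}. f ` incident_edges G v \<in> stars"
      "f ` incident_edges G t \<in> stars \<or> \<not> inj_on f (incident_edges G t)" "t \<in> {a, b, c}"
    proof -
      from pqr(3) consider
        "{f' xa, p, r} \<in> stars" "{f' xb, p, q} \<in> stars" "{f' xc, q, r} \<in> stars \<or> q = r" |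
        "{f' xa, p, r} \<in> stars" "{f' xc, q, r} \<in> stars" "p = q" |
        "{f' xb, p, q} \<in> stars" "{f' xc, q, r} \<in> stars" "p = r" by blast
      then show thesis
      proof cases
        case 1
        show thesis by (rule that[of c]) (use 1 ia ib ic nc in auto)
      next
        case 2
        show thesis by (rule that[of b]) (use 2 ia ib ic nb in auto)
      next
        case 3
        show thesis by (rule that[of a]) (use 3 ia ib ic na in auto)
      qed
    qed
    have good: "\<forall>v\<in>{a, b, c}. f ` incident_edges G v \<in> stars" if "a \<notin> defects G' f'"
      using that pqr(2) adef ia ib ic by auto
    have outside: "f ` incident_edges G v = f' ` incident_edges G' v" "inj_on f (incident_edges G v) \<longleftrightarrow> inj_on f' (incident_edges G' v)"
      if v: "v \<in> verts G" "v \<notin> {a, b, c}" for v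
    proof -
      have "f e = f' e" if "e \<in> incident_edges G v" for e
        using that v T(2-5) by (intro fx) (auto simp: incident_edges_def)
      then show "f ` incident_edges G v = f' ` incident_edges G' v" "inj_on f (incident_edges G v) \<longleftrightarrow> inj_on f' (incident_edges G' v)"
        using inc_out[OF v] by (auto intro!: image_cong inj_on_cong)
    qed
    have def_out: "v \<in> defects G f \<longleftrightarrow> v \<in> defects G' f'" if "v \<in> verts G" "v \<notin> {a, b, c}" for v
      using outside[OF that] that by (auto simp: defects_def VG')
    have fd: "finite (defects G' f')" using fV by (simp add: defects_def VG')
    have "palette_coloring G f"
      unfolding palette_coloring_def
    proof (intro conjI ballI)
      show "f ` edges G \<subseteq> \<Union> stars"
      proof
        fix y assume "y \<in> f ` edges G"
        then obtain e where e: "e \<in> edges G" "y = f e" by blast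
        show "y \<in> \<Union> stars"
        proof (cases "e \<in> {eab, ebc, eac}")
          case True
          then show ?thesis using e(2) pqr(1) fe by auto
        next
          case False
          then show ?thesis using e fx[OF False] f' by (auto simp: palette_coloring_def EG')
        qed
      qed
      show "f ` semis G \<subseteq> {TP I1}"
      proof
        fix y assume "y \<in> f ` semis G"
        then obtain e where e: "e \<in> semis G'" "y = f e" using semi' by blast
        then have "e \<notin> {eab, ebc, eac}" by (auto simp: semis_def EG')
        then show "y \<in> {TP I1}" using fx e f' by (auto simp: palette_coloring_def)
      qed
      fix v assume v: "v \<in> defects G f"
      show "\<not> inj_on f (incident_edges G v)"
      proof (cases "v \<in> {a, b, c}")
        case True
        then have "v = t" using v t(1) by (auto simp: defects_def)
        then show ?thesis using v t(2) by (auto simp: defects_def)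
      next
        case False
        have vV: "v \<in> verts G" using v by (simp add: defects_def)
        have "v \<in> defects G' f'" using def_out[OF vV False] v by blast
        then have "\<not> inj_on f' (incident_edges G' v)" using f' unfolding palette_coloring_def by blast
        then show ?thesis using outside(2)[OF vV False] by blast
      qed
    qed
    moreover have "card (defects G f) \<le> card (defects G' f')"
    proof (cases "a \<in> defects G' f'")
      case True
      have "defects G f \<subseteq> insert t (defects G' f' - {a})"
      proof
        fix v assume v: "v \<in> defects G f"
        show "v \<in> insert t (defects G' f' - {a})"
        proof (cases "v \<in> {a, b, c}")
          case True
          then show ?thesis using v t(1) by (auto simp: defects_def)
        next
          case False
          moreover have "v \<in> verts G" using v by (simp add: defects_def)
          ultimately show ?thesis using v def_out[of v] by blast
        qed
      qed
      then have "card (defects G f) \<le> card (insert t (defects G' f' - {a}))" using fd by (intro card_mono) auto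
      also have "\<dots> \<le> Suc (card (defects G' f' - {a}))" using fd by (simp add: card_insert_if)
      also have "\<dots> = card (defects G' f')" by (rule card_Suc_Diff1[OF fd True])
      finally show ?thesis .
    next
      case False
      have "defects G f \<subseteq> defects G' f'"
      proof
        fix v assume v: "v \<in> defects G f"
        then have "v \<notin> {a, b, c}" using good[OF False] by (auto simp: defects_def)
        moreover have "v \<in> verts G" using v by (simp add: defects_def)
        ultimately show "v \<in> defects G' f'" using v def_out[of v] by blast
      qed
      then show ?thesis using fd by (rule card_mono[rotated])
    qed
    ultimately show ?thesis by blast
  qed
  show thesis by (rule that[OF pre' sparse' bl' con' less' semi' ext])
qed

lemma bridgeless_coloring:
  fixes G :: "('v, 'e) multigraph"
  assumes "precubic G" "semi_sparse G" "bridgeless G" "cut_connected G"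
  shows "\<exists>f. palette_coloring G f \<and> defect_bound G (card (defects G f))"
  using assms
proof (induction "card (verts G)" arbitrary: G rule: less_induct)
  case less
  show ?case
  proof (cases "has_triangle G \<and> card (verts G) \<noteq> 3")
    case False
    then show ?thesis using base_coloring less.prems(1-3) by blast
  next
    case True
    obtain G' :: "('v, 'e) multigraph" where G':
      "precubic G'" "semi_sparse G'" "bridgeless G'" "cut_connected G'"
      "card (verts G') < card (verts G)" "semis G' = semis G"
      "\<And>f'. palette_coloring G' f' \<Longrightarrow> \<exists>f. palette_coloring G f \<and> card (defects G f) \<le> card (defects G' f')"
      by (rule triangle_contraction[OF less.prems]) (use True in blast)+
    obtain f' where f': "palette_coloring G' f'" "defect_bound G' (card (defects G' f'))"
      using less.hyps[OF G'(5,1-4)] by blast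
    then obtain f where "palette_coloring G f" "card (defects G f) \<le> card (defects G' f')"
      using G'(7) by blast
    moreover have "defect_bound G (card (defects G' f'))"
      using f'(2) G'(5,6) by (auto simp: defect_bound_def split: if_splits)
    ultimately show ?thesis using defect_bound_mono by blast
  qed
qed

section \<open>Cutting along bridges\<close>

text \<open>Edges across the boundary keep their names but lose one end, and so become semi-edges of
  the part.\<close>

definition restrict_verts :: "('v, 'e) multigraph \<Rightarrow> 'v set \<Rightarrow> ('v, 'e) multigraph" where
  "restrict_verts G A =
     \<lparr>verts = A, edges = {e \<in> edges G. ends G e \<inter> A \<noteq> {}}, ends = \<lambda>e. ends G e \<inter> A\<rparr>"

definition bridges :: "('v, 'e) multigraph \<Rightarrow> 'e set" where
  "bridges G = {e. \<exists>A\<subseteq>verts G. edge_cut G A = {e}}"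

lemma incident_restrict: "v \<in> A \<Longrightarrow> incident_edges (restrict_verts G A) v = incident_edges G v"
  by (auto simp: incident_edges_def restrict_verts_def)

lemma cut_edge_link:
  assumes "precubic G" "e \<in> edge_cut G A"
  shows "e \<in> links G" "card (ends G e \<inter> A) = 1" "card (ends G e - A) = 1"
proof -
  have e: "e \<in> edges G" "ends G e \<inter> A \<noteq> {}" "ends G e - A \<noteq> {}" using assms by (auto simp: edge_cut_def)
  have "card (ends G e) \<noteq> 1" using e by (auto simp: card_1_singleton_iff)
  then have c2: "card (ends G e) = 2" using assms(1) e by (auto simp: precubic_def)
  then show "e \<in> links G" using e by (simp add: links_def)
  obtain u where u: "u \<in> ends G e" "u \<in> A" using e by blast
  obtain v where v: "v \<in> ends G e" "v \<notin> A" using e by blast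
  have "u \<noteq> v" using u v by auto
  then have "ends G e = {u, v}" using c2 u v by (metis card2_other insertE singletonD)
  then have "ends G e \<inter> A = {u}" "ends G e - A = {v}" using u v by auto
  then show "card (ends G e \<inter> A) = 1" "card (ends G e - A) = 1" by simp_all
qed

lemma precubic_restrict:
  assumes G: "precubic G" and A: "A \<subseteq> verts G"
  shows "precubic (restrict_verts G A)"
  unfolding precubic_def
proof (intro conjI ballI)
  show "finite (verts (restrict_verts G A))" "finite (edges (restrict_verts G A))"
    using G finite_subset[OF A] by (auto simp: precubic_def restrict_verts_def)
  show "card (incident_edges (restrict_verts G A) v) = 3" if "v \<in> verts (restrict_verts G A)" for v
  proof -
    have v: "v \<in> A" using that by (simp add: restrict_verts_def)
    then have "v \<in> verts G" using A by blast
    then show ?thesis using G incident_restrict[OF v, of G] by (simp add: precubic_def)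
  qed
  fix e assume e: "e \<in> edges (restrict_verts G A)"
  show "ends (restrict_verts G A) e \<subseteq> verts (restrict_verts G A)" by (simp add: restrict_verts_def)
  show "card (ends (restrict_verts G A) e) = 1 \<or> card (ends (restrict_verts G A) e) = 2"
  proof (cases "e \<in> edge_cut G A")
    case True
    then show ?thesis using cut_edge_link[OF G] by (simp add: restrict_verts_def)
  next
    case False
    then have "e \<in> edges G" "ends G e \<inter> A = ends G e" using e by (auto simp: restrict_verts_def edge_cut_def)
    then show ?thesis using G by (auto simp: precubic_def restrict_verts_def)
  qed
qed

lemma semis_restrict:
  assumes G: "precubic G"
  shows "semis (restrict_verts G A) = {s \<in> semis G. ends G s \<subseteq> A} \<union> edge_cut G A"
proof (intro set_eqI)
  fix e
  show "e \<in> semis (restrict_verts G A) \<longleftrightarrow> e \<in> {s \<in> semis G. ends G s \<subseteq> A} \<union> edge_cut G A"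
  proof (cases "e \<in> edge_cut G A")
    case True
    then show ?thesis using cut_edge_link(2)[OF G True] by (auto simp: semis_def restrict_verts_def edge_cut_def)
  next
    case False
    then show ?thesis
      by (auto simp: semis_def restrict_verts_def edge_cut_def Int_absorb2 card_1_singleton_iff)
  qed
qed

text \<open>Edges across the cut are semi-edges on both sides, so both colourings give them
  \<open>TP I1\<close> and agree; every vertex sees only edges of its own side.\<close>

lemma glue_coloring:
  assumes G: "precubic G" and A: "A \<subseteq> verts G"
    and f1: "palette_coloring (restrict_verts G A) f1"
    and f2: "palette_coloring (restrict_verts G (verts G - A)) f2"
  shows "\<exists>f. palette_coloring G f \<and> card (defects G f) \<le>
    card (defects (restrict_verts G A) f1) + card (defects (restrict_verts G (verts G - A)) f2)"
proof -
  define B where "B = verts G - A"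
  define f where "f e = (if ends G e \<inter> A \<noteq> {} then f1 e else f2 e)" for e
  have ev: "ends G e \<subseteq> verts G" "ends G e \<noteq> {}" if "e \<in> edges G" for e
    using that G by (auto simp: precubic_def)
  have cutB: "edge_cut G B = edge_cut G A" unfolding B_def by (rule edge_cut_compl[OF ev(1) A])
  have on_cut: "f1 e = TP I1" "f2 e = TP I1" if "e \<in> edge_cut G A" for e
    using that f1 f2 semis_restrict[OF G, of A] semis_restrict[OF G, of B] cutB
    by (auto simp: palette_coloring_def B_def)
  have onA: "f e = f1 e" if "v \<in> A" "e \<in> incident_edges G v" for v e
    using that by (auto simp: f_def incident_edges_def)
  have onB: "f e = f2 e" if "v \<in> B" "e \<in> incident_edges G v" for v e
  proof (cases "ends G e \<inter> A = {}")
    case False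
    then have "e \<in> edge_cut G A" using that by (auto simp: edge_cut_def incident_edges_def B_def)
    then show ?thesis using on_cut by (simp add: f_def)
  qed (simp add: f_def)
  have imgA: "f ` incident_edges G v = f1 ` incident_edges (restrict_verts G A) v"
    "inj_on f (incident_edges G v) = inj_on f1 (incident_edges (restrict_verts G A) v)" if v: "v \<in> A" for v
    unfolding incident_restrict[OF v] using onA[OF v] by (auto intro!: image_cong inj_on_cong)
  have imgB: "f ` incident_edges G v = f2 ` incident_edges (restrict_verts G B) v"
    "inj_on f (incident_edges G v) = inj_on f2 (incident_edges (restrict_verts G B) v)" if v: "v \<in> B" for v
    unfolding incident_restrict[OF v] using onB[OF v] by (auto intro!: image_cong inj_on_cong)
  have VA: "verts (restrict_verts G A) = A" and VB: "verts (restrict_verts G B) = B"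
    by (simp_all add: restrict_verts_def)
  have VU: "verts G = A \<union> B" using A by (auto simp: B_def)
  have dA: "v \<in> defects G f \<longleftrightarrow> v \<in> defects (restrict_verts G A) f1" if "v \<in> A" for v
    using imgA(1)[OF that] that VU VA by (simp add: defects_def)
  have dB: "v \<in> defects G f \<longleftrightarrow> v \<in> defects (restrict_verts G B) f2" if "v \<in> B" for v
    using imgB(1)[OF that] that VU VB by (simp add: defects_def)
  have "palette_coloring G f"
    unfolding palette_coloring_def
  proof (intro conjI ballI)
    have EB: "e \<in> edges (restrict_verts G B)" if "e \<in> edges G" "ends G e \<inter> A = {}" for e
      using that ev[OF that(1)] VU by (auto simp: restrict_verts_def)
    show "f ` edges G \<subseteq> \<Union> stars"
    proof
      fix y assume "y \<in> f ` edges G"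
      then obtain e where e: "e \<in> edges G" "y = f e" by blast
      show "y \<in> \<Union> stars"
      proof (cases "ends G e \<inter> A = {}")
        case True
        then have "f2 e \<in> \<Union> stars" using EB[OF e(1)] f2 by (auto simp: palette_coloring_def B_def)
        then show ?thesis using e True by (simp add: f_def)
      next
        case False
        then have "e \<in> edges (restrict_verts G A)" using e by (simp add: restrict_verts_def)
        then have "f1 e \<in> \<Union> stars" using f1 by (auto simp: palette_coloring_def)
        then show ?thesis using e False by (simp add: f_def)
      qed
    qed
    show "f ` semis G \<subseteq> {TP I1}"
    proof
      fix y assume "y \<in> f ` semis G"
      then obtain e where e: "e \<in> semis G" "y = f e" by blast
      obtain v where v: "ends G e = {v}" "e \<in> edges G" using e(1) by (auto simp: semis_def card_1_singleton_iff)
      show "y \<in> {TP I1}"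
      proof (cases "v \<in> A")
        case True
        then have "e \<in> semis (restrict_verts G A)" using e v semis_restrict[OF G, of A] by auto
        then show ?thesis using f1 e True v by (auto simp: palette_coloring_def f_def)
      next
        case False
        then have "e \<in> semis (restrict_verts G B)" using e v ev[OF v(2)] semis_restrict[OF G, of B] by (auto simp: B_def)
        then show ?thesis using f2 e False v by (auto simp: palette_coloring_def f_def B_def)
      qed
    qed
    fix v assume v: "v \<in> defects G f"
    then consider "v \<in> A" | "v \<in> B" using VU by (auto simp: defects_def)
    then show "\<not> inj_on f (incident_edges G v)"
    proof cases
      case 1
      then have "v \<in> defects (restrict_verts G A) f1" using dA v by blast
      then show ?thesis using f1 imgA(2)[OF 1] unfolding palette_coloring_def by blast
    next
      case 2
      then have "v \<in> defects (restrict_verts G B) f2" using dB v by blast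
      then show ?thesis using f2[folded B_def] imgB(2)[OF 2] unfolding palette_coloring_def by blast
    qed
  qed
  moreover have "card (defects G f) \<le> card (defects (restrict_verts G A) f1) + card (defects (restrict_verts G B) f2)"
  proof -
    have fin: "finite A" "finite B" using G A by (auto simp: B_def precubic_def intro: finite_subset)
    have "v \<in> defects (restrict_verts G A) f1 \<union> defects (restrict_verts G B) f2" if v: "v \<in> defects G f" for v
    proof -
      have "v \<in> A \<or> v \<in> B" using v VU by (auto simp: defects_def)
      then show ?thesis using v dA dB by blast
    qed
    then have "defects G f \<subseteq> defects (restrict_verts G A) f1 \<union> defects (restrict_verts G B) f2" by blast
    then have "card (defects G f) \<le> card (defects (restrict_verts G A) f1 \<union> defects (restrict_verts G B) f2)"
      using fin by (intro card_mono) (auto simp: defects_def VA VB)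
    also have "\<dots> \<le> card (defects (restrict_verts G A) f1) + card (defects (restrict_verts G B) f2)" by (rule card_Un_le)
    finally show ?thesis .
  qed
  ultimately show ?thesis unfolding B_def by blast
qed

lemma edge_cut_restrict:
  assumes "B \<subseteq> A" "\<And>e. e \<in> edge_cut G A \<Longrightarrow> ends G e \<inter> B = {}"
  shows "edge_cut (restrict_verts G A) B = edge_cut G B"
  using assms by (fastforce simp: edge_cut_def restrict_verts_def)

text \<open>Up to complementation, a cut of the restriction avoids the end of the single cut edge.\<close>

lemma edge_cut_restrict_bridge:
  assumes G: "precubic G" and A: "A \<subseteq> verts G" and br: "edge_cut G A = {e}"
    and B: "B \<subseteq> A"
  obtains B' where "B' \<subseteq> A" "edge_cut (restrict_verts G A) B = edge_cut G B'" "B' = B \<or> B' = A - B"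
proof -
  have "card (ends G e \<inter> A) = 1" using cut_edge_link(2)[OF G] br by blast
  then obtain x where x: "ends G e \<inter> A = {x}" by (metis card_1_singletonE)
  show thesis
  proof (cases "x \<in> B")
    case False
    then have "edge_cut (restrict_verts G A) B = edge_cut G B"
      using x B br by (intro edge_cut_restrict) auto
    then show thesis using that B by blast
  next
    case True
    have "edge_cut (restrict_verts G A) (A - B) = edge_cut G (A - B)"
      using x B br True by (intro edge_cut_restrict) auto
    moreover have "edge_cut (restrict_verts G A) (A - B) = edge_cut (restrict_verts G A) B"
      using edge_cut_compl[of "restrict_verts G A" B] B by (auto simp: restrict_verts_def)
    ultimately show thesis using that[of "A - B"] by auto
  qed
qed

text \<open>Semi-edges and bridges are counted together because cutting turns the latter into the
  former: the new semi-edge \<open>e\<close> was a bridge of \<open>G\<close>, and no edge becomes a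
  bridge that was not one before. So the count at a vertex does not grow.\<close>

lemma restrict_bridge_side:
  assumes G: "precubic G" "cut_connected G"
    and sparse: "\<And>v. v \<in> verts G \<Longrightarrow> card ((semis G \<union> bridges G) \<inter> incident_edges G v) \<le> 1"
    and A: "A \<subseteq> verts G" and br: "edge_cut G A = {e}"
  shows "precubic (restrict_verts G A)" "cut_connected (restrict_verts G A)"
    "\<And>v. v \<in> verts (restrict_verts G A) \<Longrightarrow>
      card ((semis (restrict_verts G A) \<union> bridges (restrict_verts G A)) \<inter> incident_edges (restrict_verts G A) v) \<le> 1"
    "card (verts (restrict_verts G A)) < card (verts G)"
proof -
  have VA: "verts (restrict_verts G A) = A" by (simp add: restrict_verts_def)
  have fin: "finite (verts G)" "finite (edges G)" using G by (auto simp: precubic_def)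
  show "precubic (restrict_verts G A)" by (rule precubic_restrict[OF G(1) A])
  have "edge_cut G (verts G) = {}" using G(1) by (auto simp: edge_cut_def precubic_def)
  then have AV: "A \<noteq> verts G" using br by auto
  then show "card (verts (restrict_verts G A)) < card (verts G)"
    using A fin VA by (metis psubsetI psubset_card_mono)
  show "cut_connected (restrict_verts G A)"
    unfolding cut_connected_def VA
  proof (intro allI impI)
    fix B assume B: "B \<subseteq> A" "B \<noteq> {}" "B \<noteq> A"
    obtain B' where B': "B' \<subseteq> A" "edge_cut (restrict_verts G A) B = edge_cut G B'" "B' = B \<or> B' = A - B"
      by (rule edge_cut_restrict_bridge[OF G(1) A br B(1)])
    have "B' \<noteq> {}" using B B' by auto
    moreover have "B' \<noteq> verts G" using B'(1) A AV by auto
    moreover have "B' \<subseteq> verts G" using B'(1) A by blast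
    ultimately show "edge_cut (restrict_verts G A) B \<noteq> {}" using G(2) B'(2) by (simp add: cut_connected_def)
  qed
  fix v assume v: "v \<in> verts (restrict_verts G A)"
  have vA: "v \<in> A" "v \<in> verts G" using v VA A by auto
  have "bridges (restrict_verts G A) \<subseteq> bridges G"
  proof
    fix g assume "g \<in> bridges (restrict_verts G A)"
    then obtain B where B: "B \<subseteq> A" "edge_cut (restrict_verts G A) B = {g}" by (auto simp: bridges_def VA)
    obtain B' where B': "B' \<subseteq> A" "edge_cut (restrict_verts G A) B = edge_cut G B'"
      by (rule edge_cut_restrict_bridge[OF G(1) A br B(1)])
    have "edge_cut G B' = {g}" "B' \<subseteq> verts G" using B(2) B' A by auto
    then show "g \<in> bridges G" unfolding bridges_def by blast
  qed
  moreover have "e \<in> bridges G" unfolding bridges_def using A br by blast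
  then have "semis (restrict_verts G A) \<subseteq> semis G \<union> bridges G"
    using semis_restrict[OF G(1), of A] br by auto
  ultimately have "(semis (restrict_verts G A) \<union> bridges (restrict_verts G A)) \<inter> incident_edges (restrict_verts G A) v
    \<subseteq> (semis G \<union> bridges G) \<inter> incident_edges G v"
    unfolding incident_restrict[OF vA(1)] by blast
  then have "card ((semis (restrict_verts G A) \<union> bridges (restrict_verts G A)) \<inter> incident_edges (restrict_verts G A) v)
    \<le> card ((semis G \<union> bridges G) \<inter> incident_edges G v)"
    using fin(2) by (intro card_mono) (auto intro: finite_incident)
  then show "card ((semis (restrict_verts G A) \<union> bridges (restrict_verts G A)) \<inter> incident_edges (restrict_verts G A) v) \<le> 1"
    using sparse[OF vA(2)] by simp
qed

text \<open>At a bridge the bounds of the two sides add up exactly: each side has one extra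
  semi-edge, worth 3, and together these cancel one of the two constants 6.\<close>

lemma connected_coloring:
  fixes G :: "('v, 'e) multigraph"
  assumes "precubic G" "cut_connected G"
    "\<And>v. v \<in> verts G \<Longrightarrow> card ((semis G \<union> bridges G) \<inter> incident_edges G v) \<le> 1"
  shows "\<exists>f. palette_coloring G f \<and> defect_bound G (card (defects G f))"
  using assms
proof (induction "card (verts G)" arbitrary: G rule: less_induct)
  case less
  have fin: "finite (verts G)" "finite (edges G)" using less.prems(1) by (auto simp: precubic_def)
  note sp = precubic_edges[OF less.prems(1)]
  show ?case
  proof (cases "bridgeless G")
    case True
    have "semi_sparse G"
      unfolding semi_sparse_def
    proof
      fix v assume v: "v \<in> verts G"
      have "card (semis G \<inter> incident_edges G v) \<le> card ((semis G \<union> bridges G) \<inter> incident_edges G v)"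
        using fin(2) by (intro card_mono) (auto intro: finite_incident)
      then show "card (semis G \<inter> incident_edges G v) \<le> 1" using less.prems(3)[OF v] by simp
    qed
    then show ?thesis by (rule bridgeless_coloring[OF less.prems(1) _ True less.prems(2)])
  next
    case False
    then obtain A where A: "A \<subseteq> verts G" "card (edge_cut G A) = 1" by (auto simp: bridgeless_def)
    obtain e where e: "edge_cut G A = {e}" using A(2) by (metis card_1_singletonE)
    define B where "B = verts G - A"
    have B: "B \<subseteq> verts G" by (auto simp: B_def)
    have eB: "edge_cut G B = {e}"
      unfolding B_def e[symmetric] by (rule edge_cut_compl[OF _ A(1)]) (use less.prems(1) in \<open>auto simp: precubic_def\<close>)
    note sideA = restrict_bridge_side[OF less.prems A(1) e]
    note sideB = restrict_bridge_side[OF less.prems B eB]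
    obtain f1 where f1: "palette_coloring (restrict_verts G A) f1"
      "defect_bound (restrict_verts G A) (card (defects (restrict_verts G A) f1))"
      using less.hyps[OF sideA(4,1,2,3)] by blast
    obtain f2 where f2: "palette_coloring (restrict_verts G B) f2"
      "defect_bound (restrict_verts G B) (card (defects (restrict_verts G B) f2))"
      using less.hyps[OF sideB(4,1,2,3)] by blast
    obtain f where f: "palette_coloring G f" "card (defects G f) \<le>
      card (defects (restrict_verts G A) f1) + card (defects (restrict_verts G B) f2)"
      using glue_coloring[OF less.prems(1) A(1) f1(1)] f2(1) unfolding B_def by blast
    define SA where "SA = {s \<in> semis G. ends G s \<subseteq> A}"
    define SB where "SB = {s \<in> semis G. ends G s \<subseteq> B}"
    have "e \<in> links G" using cut_edge_link(1)[OF less.prems(1)] e by blast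
    then have en: "e \<notin> semis G" using sp(2) by blast
    have semA: "semis (restrict_verts G A) = insert e SA" and semB: "semis (restrict_verts G B) = insert e SB"
      using semis_restrict[OF less.prems(1)] e eB by (auto simp: SA_def SB_def)
    have cA: "card (semis (restrict_verts G A)) = Suc (card SA)" and cB: "card (semis (restrict_verts G B)) = Suc (card SB)"
      unfolding semA semB using en sp(4) by (auto simp: SA_def SB_def)
    have "semis G = SA \<union> SB"
    proof -
      have "ends G s \<subseteq> A \<or> ends G s \<subseteq> B" if "s \<in> semis G" for s
      proof -
        obtain v where "ends G s = {v}" "s \<in> edges G" using \<open>s \<in> semis G\<close> by (auto simp: semis_def card_1_singleton_iff)
        then show ?thesis using less.prems(1) by (auto simp: B_def precubic_def)
      qed
      then show ?thesis by (auto simp: SA_def SB_def)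
    qed
    moreover have "SA \<inter> SB = {}"
    proof -
      have "ends G s \<noteq> {}" if "s \<in> semis G" for s using that by (auto simp: semis_def)
      then show ?thesis by (fastforce simp: SA_def SB_def B_def)
    qed
    ultimately have cS: "card (semis G) = card SA + card SB" using sp(4) by (metis card_Un_disjoint finite_Un)
    have cV: "card (verts G) = card A + card B"
      using A(1) fin(1) unfolding B_def by (metis card_Diff_subset card_mono finite_subset le_add_diff_inverse)
    have bA: "5 * card (defects (restrict_verts G A) f1) + 6 \<le> card A + 3 * card SA + 3"
      using f1(2) semA cA by (simp add: defect_bound_def restrict_verts_def)
    have bB: "5 * card (defects (restrict_verts G B) f2) + 6 \<le> card B + 3 * card SB + 3"
      using f2(2) semB cB by (simp add: defect_bound_def restrict_verts_def)
    have main: "5 * card (defects G f) + 6 \<le> card (verts G) + 3 * card (semis G)"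
      using f(2) bA bB cS cV by linarith
    have "defect_bound G (card (defects G f))"
    proof (cases "semis G = {}")
      case True
      then show ?thesis using main by (simp add: defect_bound_def)
    next
      case False
      then show ?thesis using main by (simp add: defect_bound_def)
    qed
    then show ?thesis using f(1) by blast
  qed
qed

text \<open>The bound \<open>5 * d <= n\<close> is additive over components, which are split off
  along empty cuts and so acquire no semi-edges.\<close>

lemma semi_free_coloring:
  fixes G :: "('v, 'e) multigraph"
  assumes "precubic G" "semis G = {}" "\<And>v. v \<in> verts G \<Longrightarrow> card (bridges G \<inter> incident_edges G v) \<le> 1"
  shows "\<exists>f. palette_coloring G f \<and> 5 * card (defects G f) \<le> card (verts G)"
  using assms
proof (induction "card (verts G)" arbitrary: G rule: less_induct)
  case less
  have fin: "finite (verts G)" "finite (edges G)" using less.prems(1) by (auto simp: precubic_def)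
  show ?case
  proof (cases "cut_connected G")
    case True
    then show ?thesis using connected_coloring[OF less.prems(1) True] less.prems(2,3)
      by (simp add: defect_bound_def)
  next
    case False
    then obtain A where A: "A \<subseteq> verts G" "A \<noteq> {}" "A \<noteq> verts G" "edge_cut G A = {}"
      by (auto simp: cut_connected_def)
    have side: "\<exists>f. palette_coloring (restrict_verts G C) f \<and> 5 * card (defects (restrict_verts G C) f) \<le> card C"
      if C: "C \<subseteq> verts G" "C \<noteq> verts G" "edge_cut G C = {}" for C
    proof -
      have VC: "verts (restrict_verts G C) = C" by (simp add: restrict_verts_def)
      have "card (verts (restrict_verts G C)) < card (verts G)"
        using C fin VC by (metis psubsetI psubset_card_mono)
      moreover have "precubic (restrict_verts G C)" by (rule precubic_restrict[OF less.prems(1) C(1)])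
      moreover have "semis (restrict_verts G C) = {}"
        using semis_restrict[OF less.prems(1), of C] C(3) less.prems(2) by simp
      moreover have "card (bridges (restrict_verts G C) \<inter> incident_edges (restrict_verts G C) v) \<le> 1"
        if v: "v \<in> verts (restrict_verts G C)" for v
      proof -
        have vC: "v \<in> C" using v VC by simp
        have "bridges (restrict_verts G C) \<subseteq> bridges G"
        proof
          fix g assume "g \<in> bridges (restrict_verts G C)"
          then obtain B where B: "B \<subseteq> C" "edge_cut (restrict_verts G C) B = {g}" by (auto simp: bridges_def VC)
          have "edge_cut (restrict_verts G C) B = edge_cut G B"
            using B(1) C(3) by (intro edge_cut_restrict) auto
          then show "g \<in> bridges G" unfolding bridges_def using B C(1) by blast
        qed
        then have "bridges (restrict_verts G C) \<inter> incident_edges (restrict_verts G C) v \<subseteq> bridges G \<inter> incident_edges G v"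
          unfolding incident_restrict[OF vC] by blast
        then have "card (bridges (restrict_verts G C) \<inter> incident_edges (restrict_verts G C) v) \<le> card (bridges G \<inter> incident_edges G v)"
          using fin(2) by (intro card_mono) (auto intro: finite_incident)
        then show ?thesis using less.prems(3)[of v] vC C(1) by (meson order_trans subsetD)
      qed
      ultimately show ?thesis using less.hyps[of "restrict_verts G C"] VC by simp
    qed
    obtain f1 where f1: "palette_coloring (restrict_verts G A) f1" "5 * card (defects (restrict_verts G A) f1) \<le> card A"
      using side[OF A(1,3,4)] by blast
    have "edge_cut G (verts G - A) = edge_cut G A"
      by (rule edge_cut_compl[OF _ A(1)]) (use less.prems(1) in \<open>auto simp: precubic_def\<close>)
    then obtain f2 where f2: "palette_coloring (restrict_verts G (verts G - A)) f2"
      "5 * card (defects (restrict_verts G (verts G - A)) f2) \<le> card (verts G - A)"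
      using side[of "verts G - A"] A by auto
    obtain f where f: "palette_coloring G f" "card (defects G f) \<le>
      card (defects (restrict_verts G A) f1) + card (defects (restrict_verts G (verts G - A)) f2)"
      using glue_coloring[OF less.prems(1) A(1) f1(1) f2(1)] by blast
    have "card (verts G) = card A + card (verts G - A)"
      using A(1) fin(1) by (metis card_Diff_subset card_mono finite_subset le_add_diff_inverse)
    then have "5 * card (defects G f) \<le> card (verts G)" using f(2) f1(2) f2(2) by linarith
    then show ?thesis using f(1) by blast
  qed
qed

text \<open>Every vertex has degree 2 outside \<open>M\<close>, so by parity these edges cross any
  cut an even number of times, and a cut edge that is alone cannot be one of them.\<close>

lemma bridge_in_perfect_matching:
  assumes G: "cubic G" and M: "perfect_matching G M" and e: "e \<in> bridges G"
  shows "e \<in> M"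
proof (rule ccontr)
  assume eM: "e \<notin> M"
  obtain A where A: "A \<subseteq> verts G" "edge_cut G A = {e}" using e by (auto simp: bridges_def)
  have g: "is_graph G" using G by (simp add: cubic_def)
  have fin: "finite (edges G - M)" "finite A" using g A finite_subset by (auto simp: is_graph_def)
  have "card {d \<in> edges G - M. v \<in> ends G d} = 2" if v: "v \<in> A" for v
  proof -
    have vV: "v \<in> verts G" using v A by blast
    obtain m where m: "m \<in> M" "v \<in> ends G m" "\<And>d. d \<in> M \<Longrightarrow> v \<in> ends G d \<Longrightarrow> d = m"
      using M vV unfolding perfect_matching_def by blast
    have "M \<subseteq> edges G" using M by (simp add: perfect_matching_def)
    then have "m \<in> edges G" using m(1) by blast
    then have mv: "m \<in> incident_edges G v" using m(2) by (simp add: incident_edges_def)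
    have only: "d \<in> M \<longleftrightarrow> d = m" if "v \<in> ends G d" for d using m that by blast
    have "d \<in> {d \<in> edges G - M. v \<in> ends G d} \<longleftrightarrow> d \<in> incident_edges G v - {m}" for d
      using only[of d] by (cases "v \<in> ends G d") (simp_all add: incident_edges_def)
    then have "{d \<in> edges G - M. v \<in> ends G d} = incident_edges G v - {m}" by blast
    then show ?thesis using G vV mv by (simp add: cubic_def card_Diff_singleton)
  qed
  then have "(\<Sum>v\<in>A. card {d \<in> edges G - M. v \<in> ends G d}) = 2 * card A" by simp
  moreover have "{d \<in> edges G - M. ends G d \<inter> A \<noteq> {} \<and> ends G d - A \<noteq> {}} = {e}"
    using A(2) eM unfolding edge_cut_def by blast
  moreover have "even ((\<Sum>v\<in>A. card {d \<in> edges G - M. v \<in> ends G d}) +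
    card {d \<in> edges G - M. ends G d \<inter> A \<noteq> {} \<and> ends G d - A \<noteq> {}})"
    using g by (intro even_degree_sum_cut fin) (auto simp: is_graph_def)
  ultimately show False by simp
qed

section \<open>From the three stars back to the graph S12\<close>

lemma star_of_S12:
  assumes "S \<in> stars"
  shows "\<exists>x\<in>verts S12. S = incident_edges S12 x"
proof -
  have "S = incident_edges S12 (VP I1) \<or> S = incident_edges S12 (VQ I1) \<or> S = incident_edges S12 (VR I1)"
    using assms by (simp add: stars_def incident_edges_S12)
  then show ?thesis by (auto simp: S12_def)
qed

theorem theorem3:
  fixes G :: "('v, 'e) multigraph"
  assumes "cubic G"
    and "\<exists>M. perfect_matching G M"
  shows "\<exists>f :: 'e \<Rightarrow> s12_edge.
           f ` edges G \<subseteq> edges S12 \<and>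
           real (card (good_verts G S12 f)) \<ge> 4 / 5 * real (card (verts G)) \<and>
           (\<forall>u \<in> verts G - good_verts G S12 f.
              \<exists>e \<in> incident_edges G u. \<exists>e' \<in> incident_edges G u. e \<noteq> e' \<and> f e = f e')"
proof -
  obtain M where M: "perfect_matching G M" using assms(2) by blast
  have g: "is_graph G" using assms(1) by (simp add: cubic_def)
  have fin: "finite (verts G)" "finite (edges G)" using g by (auto simp: is_graph_def)
  have "precubic G" using assms(1) by (simp add: precubic_def cubic_def is_graph_def)
  moreover have "semis G = {}" using g by (auto simp: semis_def is_graph_def)
  moreover have "card (bridges G \<inter> incident_edges G v) \<le> 1" if v: "v \<in> verts G" for v
  proof -
    obtain m where "\<And>d. d \<in> M \<Longrightarrow> v \<in> ends G d \<Longrightarrow> d = m"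
      using M v unfolding perfect_matching_def by blast
    then have "bridges G \<inter> incident_edges G v \<subseteq> {m}"
      using bridge_in_perfect_matching[OF assms(1) M] by (auto simp: incident_edges_def)
    then have "card (bridges G \<inter> incident_edges G v) \<le> card {m}" by (intro card_mono) auto
    then show ?thesis by simp
  qed
  ultimately obtain f where f: "palette_coloring G f" "5 * card (defects G f) \<le> card (verts G)"
    using semi_free_coloring by blast
  have good: "verts G - defects G f \<subseteq> good_verts G S12 f"
    using star_of_S12 by (auto simp: defects_def good_verts_def)
  have "f ` edges G \<subseteq> edges S12" by (simp add: S12_def)
  moreover have "real (card (good_verts G S12 f)) \<ge> 4 / 5 * real (card (verts G))"
  proof -
    have "card (verts G) \<le> card (verts G - defects G f) + card (defects G f)"
    proof -
      have "card (verts G) \<le> card ((verts G - defects G f) \<union> defects G f)"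
        using fin by (intro card_mono) (auto simp: defects_def)
      also have "\<dots> \<le> card (verts G - defects G f) + card (defects G f)" by (rule card_Un_le)
      finally show ?thesis .
    qed
    also have "card (verts G - defects G f) \<le> card (good_verts G S12 f)"
      using good fin by (intro card_mono) (auto simp: good_verts_def)
    finally have "5 * card (verts G) \<le> 5 * card (good_verts G S12 f) + card (verts G)" using f(2) by linarith
    then show ?thesis by linarith
  qed
  moreover have "\<exists>e \<in> incident_edges G u. \<exists>e' \<in> incident_edges G u. e \<noteq> e' \<and> f e = f e'"
    if "u \<in> verts G - good_verts G S12 f" for u
  proof -
    have "u \<in> defects G f" using that good by blast
    then have "\<not> inj_on f (incident_edges G u)" using f(1) by (simp add: palette_coloring_def)
    then show ?thesis by (auto simp: inj_on_def)
  qed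
  ultimately show ?thesis by blast
qed

end
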